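(* Let $(\alpha_i)_{i\in I}$ be a sequence of $d\times d$ matrices with $\|\alpha_i\|<1$, indexed either by $I=\{0,\dots,N-1\}$ (finite), $I=\{0,1,2,\dots\}$ (semi-infinite), or $I=\mathbb{Z}$ (doubly infinite), and let $\mathcal{C},\hat{\mathcal{C}}$ be the associated block CMV matrices (in the finite case $\mathcal{C}=\mathcal{C}_N(\alpha_0,\dots,\alpha_{N-1})$, $\hat{\mathcal{C}}=\hat{\mathcal{C}}_N(\alpha_0,\dots,\alpha_{N-1})$), with Schur iterates $f_j$ and inverse Schur iterates $b_j$. Let $V_j$ be the canonical subspaces. Then for every admissible $j$: (1) the $\mathcal{C}$-Schur function of $V_j$ is $b_jf_j$ if $j$ is even and $f_jb_j$ if $j$ is odd; (2) the $\hat{\mathcal{C}}$-Schur function of $V_j$ is $f_jb_j$ if $j$ is even and $b_jf_j$ if $j$ is odd. Moreover, for admissible $j\le k$ the $\mathcal{C}$-Schur function of $V_j\oplus V_{j+1}\oplus\cdots\oplus V_k$ equals $(b_j\oplus\mathbb{1}_{k-j})\mathcal{C}_{(j,k)}^\dagger(\mathbb{1}_{k-j}\oplus f_k)$ for $j,k$ even; $(\mathbb{1}_{k-j}\oplus f_k)\mathcal{C}_{(j,k)}^\dagger(b_j\oplus\mathbb{1}_{k-j})$ for $j,k$ odd; $(b_j\oplus\mathbb{1}_{k-j-1}\oplus f_k)\mathcal{C}_{(j,k)}^\dagger$ for $j$ even, $k$ odd; $\mathcal{C}_{(j,k)}^\dagger(b_j\oplus\mathbb{1}_{k-j-1}\oplus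 f_k)$ for $j$ odd, $k$ even; and the $\hat{\mathcal{C}}$-Schur function of the same subspace is given by the same four formulas with $\mathcal{C}_{(j,k)}$ replaced by $\hat{\mathcal{C}}_{(j,k)}$ and the parities of both $j$ and $k$ interchanged. (That is, these Schur functions result from substituting $-\alpha_{j-1}^\dagger\to b_j$ and $\alpha_k\to f_k$ into $\mathcal{C}_{[j,k]}^\dagger$, resp. $\hat{\mathcal{C}}_{[j,k]}^\dagger$, the adjoints of the principal $d$-block submatrices on blocks $j,\dots,k$.)
   Context: $\ell^2$ has canonical basis $\{e_i\}$ indexed by $\{0,\dots,(N+1)d-1\}$, $\mathbb{Z}_{\ge0}$ or $\mathbb{Z}$ respectively, and canonical subspaces $V_m=\operatorname{span}\{e_{md},\dots,e_{md+d-1}\}$ ($0\le m\le N$ in the finite case, $m\ge0$ semi-infinite, $m\in\mathbb{Z}$ doubly infinite). With $\rho^L=(\mathbb{1}-\alpha^\dagger\alpha)^{1/2}$, $\rho^R=(\mathbb{1}-\alpha\alpha^\dagger)^{1/2}$ and $\Theta(\alpha)=\begin{pmatrix}\alpha^\dagger&\rho^L\\ \rho^R&-\alpha\end{pmatrix}$ acting (as $\Theta(\alpha_i)$) on $V_i\oplus V_{i+1}$: semi-infinite $\mathcal{L}=\Theta(\alpha_0)\oplus\Theta(\alpha_2)\oplus\cdots$, $\mathcal{M}=\mathbb{1}\oplus\Theta(\alpha_1)\oplus\cdots$; doubly infinite $\mathcal{L}=\bigoplus_{m\in\mathbb{Z}}\Theta(\alpha_{2m})$, $\mathcal{M}=\bigoplus_{m\in\mathbb{Z}}\Theta(\alpha_{2m-1})$;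 in both cases $\mathcal{C}=\mathcal{L}\mathcal{M}$, $\hat{\mathcal{C}}=\mathcal{M}\mathcal{L}$. Finite: for $(\beta_0,\dots,\beta_{M-1})$, $\mathcal{C}_M=\mathcal{L}_M\mathcal{M}_M$, $\hat{\mathcal{C}}_M=\mathcal{M}_M\mathcal{L}_M$ of order $(M+1)d$, with (odd $M$) $\mathcal{L}_M=\Theta(\beta_0)\oplus\Theta(\beta_2)\oplus\cdots\oplus\Theta(\beta_{M-1})$, $\mathcal{M}_M=\mathbb{1}\oplus\Theta(\beta_1)\oplus\cdots\oplus\Theta(\beta_{M-2})\oplus\mathbb{1}$, (even $M$) $\mathcal{L}_M=\Theta(\beta_0)\oplus\cdots\oplus\Theta(\beta_{M-2})\oplus\mathbb{1}$, $\mathcal{M}_M=\mathbb{1}\oplus\Theta(\beta_1)\oplus\cdots\oplus\Theta(\beta_{M-1})$, and $\mathcal{C}_0=\hat{\mathcal{C}}_0=\mathbb{1}$. Truncations: for even $j$, $\mathcal{C}_{(j,k)}=\mathcal{C}_{k-j}(\alpha_j,\dots,\alpha_{k-1})$, $\hat{\mathcal{C}}_{(j,k)}=\hat{\mathcal{C}}_{k-j}(\alpha_j,\dots,\alpha_{k-1})$; for odd $j$, $\mathcal{C}_{(j,k)}=\hat{\mathcal{C}}_{k-j}(\alpha_j,\dots,\alpha_{k-1})$, $\hat{\mathcal{C}}_{(j,k)}=\mathcal{C}_{k-j}(\alpha_j,\dots,\alpha_{k-1})$. A matrix Schur function is analytic $g:\mathbb{D}\to\mathbb{C}^{d\times d}$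 with $\|g\|\le1$; its Schur parameters come from the matrix Schur algorithm $g_0=g$, $\beta_m=g_m(0)$, $g_{m+1}=z^{-1}(\rho_m^R)^{-1}(g_m-\beta_m)(\mathbb{1}-\beta_m^\dagger g_m)^{-1}\rho_m^L$, and a Schur function is uniquely determined by its (finite, ending with $\mathbb{1}$, or infinite) sequence of Schur parameters. Schur iterates: $f_j$ is the Schur function with parameters $(\alpha_j,\alpha_{j+1},\dots)$ (finite case: $(\alpha_j,\dots,\alpha_{N-1},\mathbb{1})$, so $f_N\equiv\mathbb{1}$). Inverse iterates: $b_j$ has parameters $(-\alpha_{j-1}^\dagger,\dots,-\alpha_0^\dagger,\mathbb{1})$ in the finite and semi-infinite cases ($b_0\equiv\mathbb{1}$), and $(-\alpha_{j-1}^\dagger,-\alpha_{j-2}^\dagger,\dots)$ in the doubly infinite case. For a unitary $U$ and subspace $S$ with projection $P$, the $U$-Schur function of $S$ is $f_S(z)=z^{-1}(F_S-\mathbb{1}_S)(F_S+\mathbb{1}_S)^{-1}$ with $F_S(z)=P(U+z)(U-z)^{-1}P|_S$. $\mathbb{1}_m$ is the $md\times md$ identity. *)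

theory Defs
  imports "HOL-Analysis.Analysis" "Jordan_Normal_Form.Schur_Decomposition"
begin

definition vnorm :: "complex vec \<Rightarrow> real" where
  "vnorm v = sqrt (\<Sum>i<dim_vec v. (cmod (v $ i))^2)"

definition opnorm :: "complex mat \<Rightarrow> real" where
  "opnorm A = Sup {vnorm (A *\<^sub>v v) | v. v \<in> carrier_vec (dim_col A) \<and> vnorm v \<le> 1}"

definition psd_mat :: "nat \<Rightarrow> complex mat \<Rightarrow> bool" where
  "psd_mat n R \<longleftrightarrow> R \<in> carrier_mat n n \<and> mat_adjoint R = R \<and>
     (\<forall>v\<in>carrier_vec n. 0 \<le> Re ((R *\<^sub>v v) \<bullet>c v))"

definition msqrt :: "complex mat \<Rightarrow> complex mat" where
  "msqrt A = (THE R. psd_mat (dim_row A) R \<and> R * R = A)"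

definition minv :: "complex mat \<Rightarrow> complex mat" where
  "minv A = (THE B. B \<in> carrier_mat (dim_row A) (dim_row A) \<and>
                    A * B = 1\<^sub>m (dim_row A) \<and> B * A = 1\<^sub>m (dim_row A))"

definition rhoL :: "complex mat \<Rightarrow> complex mat" where
  "rhoL a = msqrt (1\<^sub>m (dim_col a) - mat_adjoint a * a)"

definition rhoR :: "complex mat \<Rightarrow> complex mat" where
  "rhoR a = msqrt (1\<^sub>m (dim_row a) - a * mat_adjoint a)"

definition Theta :: "complex mat \<Rightarrow> complex mat" where
  "Theta a = four_block_mat (mat_adjoint a) (rhoL a) (rhoR a) (- a)"

definition bdiag :: "complex mat \<Rightarrow> complex mat \<Rightarrow> complex mat" where
  "bdiag A B = four_block_mat A (0\<^sub>m (dim_row A) (dim_col B)) (0\<^sub>m (dim_row B) (dim_col A)) B"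

type_synonym imat = "int \<Rightarrow> int \<Rightarrow> complex"

definition imult :: "imat \<Rightarrow> imat \<Rightarrow> imat" where
  "imult A B x y = (\<Sum>\<^sub>\<infinity>w. A x w * B w y)"

definition imv :: "imat \<Rightarrow> (int \<Rightarrow> complex) \<Rightarrow> int \<Rightarrow> complex" where
  "imv A v x = (\<Sum>\<^sub>\<infinity>w. A x w * v w)"

definition l2 :: "int set \<Rightarrow> (int \<Rightarrow> complex) \<Rightarrow> bool" where
  "l2 X v \<longleftrightarrow> (\<forall>i. i \<notin> X \<longrightarrow> v i = 0) \<and> (\<lambda>i. (cmod (v i))^2) summable_on UNIV"

definition idX :: "int set \<Rightarrow> imat" where
  "idX X x y = (if x = y \<and> x \<in> X then 1 else 0)"

definition evec :: "int \<Rightarrow> int \<Rightarrow> complex" where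
  "evec b x = (if x = b then 1 else 0)"

text \<open>Block-diagonal factor built from the Theta blocks: block positions form the set B;
  the block pair (t, t+1) carries Theta (a t) where t = 2m - s (s = 0 gives the L-type pairing
  (2m,2m+1), s = 1 the M-type pairing (2m-1,2m)); a block whose partner is not in B carries the
  identity.  The basis vector with index x lies in the block V_(x div d).\<close>
definition cmv_factor :: "nat \<Rightarrow> (int \<Rightarrow> complex mat) \<Rightarrow> int set \<Rightarrow> int \<Rightarrow> imat" where
  "cmv_factor d a B s x y =
    (let p = x div int d; q = y div int d; t = 2 * ((p + s) div 2) - s in
     if p \<notin> B \<or> q \<notin> B then 0
     else if 2 * ((q + s) div 2) - s = t \<and> t \<in> B \<and> t + 1 \<in> B
       then Theta (a t) $$ (nat (x - t * int d), nat (y - t * int d))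
     else if x = y then 1 else 0)"

datatype cmv_kind = Fin nat | Semi | Dbl

text \<open>Block positions m of the canonical subspaces V_m (= admissible indices j).\<close>
fun blocks :: "cmv_kind \<Rightarrow> int set" where
  "blocks (Fin N) = {0..int N}"
| "blocks Semi = {0..}"
| "blocks Dbl = UNIV"

fun alpha_idx :: "cmv_kind \<Rightarrow> int set" where
  "alpha_idx (Fin N) = {0..<int N}"
| "alpha_idx Semi = {0..}"
| "alpha_idx Dbl = UNIV"

definition l2idx :: "nat \<Rightarrow> cmv_kind \<Rightarrow> int set" where
  "l2idx d K = {x. x div int d \<in> blocks K}"

definition cmvL :: "nat \<Rightarrow> cmv_kind \<Rightarrow> (int \<Rightarrow> complex mat) \<Rightarrow> imat" where
  "cmvL d K a = cmv_factor d a (blocks K) 0"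

definition cmvM :: "nat \<Rightarrow> cmv_kind \<Rightarrow> (int \<Rightarrow> complex mat) \<Rightarrow> imat" where
  "cmvM d K a = cmv_factor d a (blocks K) 1"

definition cmvC :: "nat \<Rightarrow> cmv_kind \<Rightarrow> (int \<Rightarrow> complex mat) \<Rightarrow> imat" where
  "cmvC d K a = imult (cmvL d K a) (cmvM d K a)"

definition cmvCh :: "nat \<Rightarrow> cmv_kind \<Rightarrow> (int \<Rightarrow> complex mat) \<Rightarrow> imat" where
  "cmvCh d K a = imult (cmvM d K a) (cmvL d K a)"

definition cmvC_fin :: "nat \<Rightarrow> nat \<Rightarrow> (int \<Rightarrow> complex mat) \<Rightarrow> complex mat" where
  "cmvC_fin d M b = mat ((M+1)*d) ((M+1)*d) (\<lambda>(x,y). cmvC d (Fin M) b (int x) (int y))"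

definition cmvCh_fin :: "nat \<Rightarrow> nat \<Rightarrow> (int \<Rightarrow> complex mat) \<Rightarrow> complex mat" where
  "cmvCh_fin d M b = mat ((M+1)*d) ((M+1)*d) (\<lambda>(x,y). cmvCh d (Fin M) b (int x) (int y))"

definition truncC :: "nat \<Rightarrow> (int \<Rightarrow> complex mat) \<Rightarrow> int \<Rightarrow> int \<Rightarrow> complex mat" where
  "truncC d a j k = (if even j then cmvC_fin d (nat (k - j)) (\<lambda>i. a (j + i))
                     else cmvCh_fin d (nat (k - j)) (\<lambda>i. a (j + i)))"

definition truncCh :: "nat \<Rightarrow> (int \<Rightarrow> complex mat) \<Rightarrow> int \<Rightarrow> int \<Rightarrow> complex mat" where
  "truncCh d a j k = (if even j then cmvCh_fin d (nat (k - j)) (\<lambda>i. a (j + i))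
                      else cmvC_fin d (nat (k - j)) (\<lambda>i. a (j + i)))"

text \<open>F_S(z) = P (U+z)(U-z)^(-1) P restricted to S; the column (U-z)^(-1) e_b is the unique
  l2 solution y of (U-z) y = e_b.\<close>
definition FS :: "int set \<Rightarrow> imat \<Rightarrow> int \<Rightarrow> nat \<Rightarrow> complex \<Rightarrow> complex mat" where
  "FS X U lo n z = mat n n (\<lambda>(r,c).
     let y = (THE y. l2 X y \<and> imv (\<lambda>a b. U a b - z * idX X a b) y = evec (lo + int c))
     in imv (\<lambda>a b. U a b + z * idX X a b) y (lo + int r))"

definition subspace_schur :: "int set \<Rightarrow> imat \<Rightarrow> int \<Rightarrow> nat \<Rightarrow> complex \<Rightarrow> complex mat" where
  "subspace_schur X U lo n z =
     (1 / z) \<cdot>\<^sub>m ((FS X U lo n z - 1\<^sub>m n) * minv (FS X U lo n z + 1\<^sub>m n))"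

definition schur_fun :: "nat \<Rightarrow> (complex \<Rightarrow> complex mat) \<Rightarrow> bool" where
  "schur_fun d g \<longleftrightarrow> (\<forall>z\<in>ball 0 1. g z \<in> carrier_mat d d \<and> opnorm (g z) \<le> 1) \<and>
     (\<forall>i<d. \<forall>j<d. (\<lambda>z. g z $$ (i,j)) holomorphic_on ball 0 1)"

text \<open>One step of the matrix Schur algorithm (valid for z \<noteq> 0; the value at 0 is
  determined by analyticity).\<close>
definition schur_step :: "complex mat \<Rightarrow> (complex \<Rightarrow> complex mat) \<Rightarrow> complex \<Rightarrow> complex mat" where
  "schur_step b g z = (1 / z) \<cdot>\<^sub>m
     (minv (rhoR b) * (g z - b) * minv (1\<^sub>m (dim_row b) - mat_adjoint b * g z) * rhoL b)"

definition has_schur_params_inf :: "nat \<Rightarrow> (complex \<Rightarrow> complex mat) \<Rightarrow> (nat \<Rightarrow> complex mat) \<Rightarrow> bool" where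
  "has_schur_params_inf d g b \<longleftrightarrow> (\<exists>G. G 0 = g \<and> (\<forall>m. schur_fun d (G m) \<and> b m = G m 0 \<and>
      opnorm (b m) < 1 \<and> (\<forall>z\<in>ball 0 1 - {0}. G (Suc m) z = schur_step (b m) (G m) z)))"

definition has_schur_params_fin :: "nat \<Rightarrow> (complex \<Rightarrow> complex mat) \<Rightarrow> nat \<Rightarrow> (nat \<Rightarrow> complex mat) \<Rightarrow> bool" where
  "has_schur_params_fin d g M b \<longleftrightarrow> (\<exists>G. G 0 = g \<and> (\<forall>m\<le>M. schur_fun d (G m)) \<and>
      (\<forall>m<M. b m = G m 0 \<and> opnorm (b m) < 1 \<and>
         (\<forall>z\<in>ball 0 1 - {0}. G (Suc m) z = schur_step (b m) (G m) z)) \<and>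
      G M 0 = 1\<^sub>m d)"

definition schur_of_inf :: "nat \<Rightarrow> (nat \<Rightarrow> complex mat) \<Rightarrow> complex \<Rightarrow> complex mat" where
  "schur_of_inf d b = (THE g. (\<forall>z. z \<notin> ball 0 1 \<longrightarrow> g z = 0\<^sub>m d d) \<and> schur_fun d g \<and>
                              has_schur_params_inf d g b)"

definition schur_of_fin :: "nat \<Rightarrow> nat \<Rightarrow> (nat \<Rightarrow> complex mat) \<Rightarrow> complex \<Rightarrow> complex mat" where
  "schur_of_fin d M b = (THE g. (\<forall>z. z \<notin> ball 0 1 \<longrightarrow> g z = 0\<^sub>m d d) \<and> schur_fun d g \<and>
                                has_schur_params_fin d g M b)"

definition f_iter :: "nat \<Rightarrow> cmv_kind \<Rightarrow> (int \<Rightarrow> complex mat) \<Rightarrow> int \<Rightarrow> complex \<Rightarrow> complex mat" where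
  "f_iter d K a j = (case K of
      Fin N \<Rightarrow> schur_of_fin d (nat (int N - j)) (\<lambda>m. a (j + int m))
    | _ \<Rightarrow> schur_of_inf d (\<lambda>m. a (j + int m)))"

definition b_iter :: "nat \<Rightarrow> cmv_kind \<Rightarrow> (int \<Rightarrow> complex mat) \<Rightarrow> int \<Rightarrow> complex \<Rightarrow> complex mat" where
  "b_iter d K a j = (case K of
      Dbl \<Rightarrow> schur_of_inf d (\<lambda>m. - mat_adjoint (a (j - 1 - int m)))
    | _ \<Rightarrow> schur_of_fin d (nat j) (\<lambda>m. - mat_adjoint (a (j - 1 - int m))))"

end

(*  For |z| < 1 the U-Schur function of S maps P U y to P y, where y runs through the l2 vectors for
    which U y - z y is supported in S.  For U = L M put v = M y and u = L v.  To the right of the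
    block k, the equation u = z y decouples: one step of it is exactly one step of the Schur
    algorithm, written as a relation through the unitary Theta(alpha), so that the half-line acts on
    the block k as multiplication by f_k.  Reversing the order of the blocks turns Theta(alpha) into
    Theta(-alpha'), alpha' the adjoint of alpha, so the left half-line acts on the block j by b_j.
    What remains between j and k is the adjoint of the truncated CMV matrix.

    Unitarity of Theta gives an energy identity along the half-line.  It shows that the solutions
    are square summable, that a Schur function is determined by its parameters, and that the finite
    Schur approximants converge locally uniformly.  *)
theory Submission
  imports Defs "HOL-Complex_Analysis.Conformal_Mappings"
begin

unbundle no vec_syntax
hide_const (open) Finite_Cartesian_Product.vec Finite_Cartesian_Product.row

section \<open>Matrices as operators between Euclidean spaces\<close>

text \<open>The inverse of U - z enters \<open>FS\<close> only through a definite description, so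
  existence and uniqueness of square summable solutions are both needed. Uniqueness is cheap, the
  two factors being isometric and |z| < 1; existence is the real work, and the solution is assembled
  from two half-lines and the window. A cut between two neighbouring blocks severs a pair of exactly
  one of the two factors, and the parity of the cut decides of which. If L is severed at the right
  edge, the half-line turns the block u into v by f_k; if M is severed, it turns v into y by f_k;
  likewise on the left with b_j. For U = L M the matrices f_k and b_j therefore stand to the right
  of the adjoint truncation where L is cut and to its left where M is cut: this is the whole content
  of the parity cases. A parameter \<open>s\<close>, the type of the outer factor, treats C and its
  companion at once. Squared norms are used throughout because the energy identities are additive in
  them.\<close>

definition nsq :: "complex vec \<Rightarrow> real" where
  "nsq v = (\<Sum>i<dim_vec v. (cmod (v $ i))\<^sup>2)"

lemma nsq_nonneg [simp]: "0 \<le> nsq v"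
  by (simp add: nsq_def sum_nonneg)

lemma vnorm_nsq: "vnorm v = sqrt (nsq v)"
  by (simp add: vnorm_def nsq_def)

lemma nsq_zero [simp]: "nsq (0\<^sub>v n) = 0"
  by (simp add: nsq_def)

lemma nsq_eq_0: "v \<in> carrier_vec n \<Longrightarrow> nsq v = 0 \<Longrightarrow> v = 0\<^sub>v n"
  by (intro eq_vecI) (auto simp: nsq_def sum_nonneg_eq_0_iff)

lemma nsq_smult: "nsq (c \<cdot>\<^sub>v v) = (cmod c)\<^sup>2 * nsq v"
  by (simp add: nsq_def norm_mult power_mult_distrib sum_distrib_left)

lemma nsq_append: "nsq (u @\<^sub>v v) = nsq u + nsq v"
proof -
  have "(\<Sum>i<m + n. f i) = (\<Sum>i<m. f i) + (\<Sum>i<n. f (m + i))" for m n and f :: "nat \<Rightarrow> real"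
    by (induct n) auto
  then show ?thesis by (simp add: nsq_def)
qed

lemma entry_le_nsq: "i < dim_vec v \<Longrightarrow> (cmod (v $ i))\<^sup>2 \<le> nsq v"
  unfolding nsq_def by (rule member_le_sum) auto

lemma nsq_unit_vec: "j < n \<Longrightarrow> nsq (unit_vec n j) = 1"
proof -
  assume j: "j < n"
  have "nsq (unit_vec n j) = (\<Sum>i<n. if i = j then 1 else 0)"
    unfolding nsq_def by (rule sum.cong) (auto simp: unit_vec_def)
  then show ?thesis using j by simp
qed

lemma nsq_cscalar: "complex_of_real (nsq v) = v \<bullet>c v"
  by (simp add: nsq_def scalar_prod_def complex_norm_square atLeast0LessThan del: of_real_power)

section \<open>Adjoints and the Hermitian inner product\<close>

lemma mat_adjoint_dims [simp]:
  "dim_row (mat_adjoint A) = dim_col A" "dim_col (mat_adjoint A) = dim_row A"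
  by (simp_all add: mat_adjoint_def)

lemma mat_adjoint_carrier [simp]:
  "mat_adjoint A \<in> carrier_mat n m \<longleftrightarrow> A \<in> carrier_mat m n"
  unfolding carrier_mat_def mem_Collect_eq mat_adjoint_dims by (rule conj_commute)

lemma mat_adjoint_index [simp]:
  "i < dim_col A \<Longrightarrow> j < dim_row A \<Longrightarrow> mat_adjoint A $$ (i, j) = cnj (A $$ (j, i))"
  by (simp add: mat_adjoint_def mat_of_rows_def)

lemma mat_adjoint_adjoint [simp]: "mat_adjoint (mat_adjoint (A :: complex mat)) = A"
  by (intro eq_matI) auto

lemma mat_adjoint_one [simp]: "mat_adjoint (1\<^sub>m n :: complex mat) = 1\<^sub>m n"
  by (intro eq_matI) auto

lemma mat_adjoint_uminus [simp]: "mat_adjoint (- A :: complex mat) = - mat_adjoint A"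
  by (intro eq_matI) auto

lemma mat_adjoint_mult:
  "A \<in> carrier_mat n m \<Longrightarrow> B \<in> carrier_mat m k \<Longrightarrow>
   mat_adjoint (A * B :: complex mat) = mat_adjoint B * mat_adjoint A"
  by (intro eq_matI) (auto simp: scalar_prod_def mult.commute)

lemma cscalar_adjoint:
  fixes A :: "complex mat"
  assumes "A \<in> carrier_mat n m" "u \<in> carrier_vec m" "v \<in> carrier_vec n"
  shows "(A *\<^sub>v u) \<bullet>c v = u \<bullet>c (mat_adjoint A *\<^sub>v v)"
proof -
  have "(A *\<^sub>v u) \<bullet>c v = (\<Sum>i<n. \<Sum>j<m. A $$ (i,j) * u $ j * cnj (v $ i))"
    using assms by (auto simp: scalar_prod_def sum_distrib_right atLeast0LessThan intro!: sum.cong)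
  also have "\<dots> = (\<Sum>j<m. \<Sum>i<n. A $$ (i,j) * u $ j * cnj (v $ i))"
    by (rule sum.swap)
  also have "\<dots> = u \<bullet>c (mat_adjoint A *\<^sub>v v)"
    using assms by (auto simp: scalar_prod_def sum_distrib_left atLeast0LessThan mult_ac intro!: sum.cong)
  finally show ?thesis .
qed

lemma cmod_cscalar_le:
  assumes "u \<in> carrier_vec n" "v \<in> carrier_vec n"
  shows "cmod (u \<bullet>c v) \<le> vnorm u * vnorm v"
proof -
  have "cmod (u \<bullet>c v) \<le> (\<Sum>i<n. \<bar>cmod (u $ i)\<bar> * \<bar>cmod (v $ i)\<bar>)"
    using assms by (auto simp: scalar_prod_def norm_mult atLeast0LessThan intro!: sum_norm_le)
  also have "\<dots> \<le> L2_set (\<lambda>i. cmod (u $ i)) {..<n} * L2_set (\<lambda>i. cmod (v $ i)) {..<n}"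
    by (rule L2_set_mult_ineq)
  also have "\<dots> = vnorm u * vnorm v"
    using assms by (simp add: vnorm_def L2_set_def)
  finally show ?thesis .
qed

lemma vnorm_smult: "vnorm (c \<cdot>\<^sub>v v) = cmod c * vnorm v"
  by (simp add: vnorm_nsq nsq_smult real_sqrt_mult)

lemma nsq_isometry:
  assumes A: "A \<in> carrier_mat n m" and AA: "mat_adjoint A * A = 1\<^sub>m m" and v: "v \<in> carrier_vec m"
  shows "nsq (A *\<^sub>v v) = nsq v"
proof -
  have "(A *\<^sub>v v) \<bullet>c (A *\<^sub>v v) = v \<bullet>c (mat_adjoint A *\<^sub>v (A *\<^sub>v v))"
    using A v by (intro cscalar_adjoint) auto
  also have "mat_adjoint A *\<^sub>v (A *\<^sub>v v) = v"
    using A v AA by (simp flip: assoc_mult_mat_vec[of _ m n _ m])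
  finally show ?thesis by (metis nsq_cscalar of_real_eq_iff)
qed

lemma smult_mat_vec:
  fixes A :: "complex mat"
  assumes "A \<in> carrier_mat n m" "v \<in> carrier_vec m"
  shows "z \<cdot>\<^sub>m A *\<^sub>v v = z \<cdot>\<^sub>v (A *\<^sub>v v)"
  using assms by (intro eq_vecI) auto

lemma mat_vec_zero: "(A :: complex mat) \<in> carrier_mat n m \<Longrightarrow> A *\<^sub>v 0\<^sub>v m = 0\<^sub>v n"
  by (intro eq_vecI) auto

text \<open>The constant bounds the square of the operator norm.\<close>

definition norm_bd :: "nat \<Rightarrow> real \<Rightarrow> complex mat \<Rightarrow> bool" where
  "norm_bd d c A \<longleftrightarrow> A \<in> carrier_mat d d \<and> 0 \<le> c \<and> (\<forall>v\<in>carrier_vec d. nsq (A *\<^sub>v v) \<le> c * nsq v)"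

lemma norm_bd_carrier: "norm_bd d c A \<Longrightarrow> A \<in> carrier_mat d d"
  by (simp add: norm_bd_def)

lemma norm_bd_vec: "norm_bd d c A \<Longrightarrow> v \<in> carrier_vec d \<Longrightarrow> nsq (A *\<^sub>v v) \<le> c * nsq v"
  by (simp add: norm_bd_def)

lemma norm_bd_mult:
  assumes "norm_bd d a A" "norm_bd d b B"
  shows "norm_bd d (a * b) (A * B)"
proof -
  have "nsq (A * B *\<^sub>v v) \<le> a * b * nsq v" if v: "v \<in> carrier_vec d" for v
  proof -
    have "nsq (A * B *\<^sub>v v) = nsq (A *\<^sub>v (B *\<^sub>v v))"
      using norm_bd_carrier[OF assms(1)] norm_bd_carrier[OF assms(2)] v by simp
    also have "\<dots> \<le> a * nsq (B *\<^sub>v v)"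
      using assms v by (intro norm_bd_vec) (auto simp: norm_bd_def)
    also have "\<dots> \<le> a * (b * nsq v)"
      using assms v by (intro mult_left_mono norm_bd_vec) (auto simp: norm_bd_def)
    finally show ?thesis by simp
  qed
  then show ?thesis using assms by (auto simp: norm_bd_def)
qed

lemma norm_bd_one: "norm_bd d 1 (1\<^sub>m d)"
  by (simp add: norm_bd_def)

lemma norm_bd_pow: "norm_bd d c A \<Longrightarrow> norm_bd d (c ^ n) (A ^\<^sub>m n)"
proof (induct n)
  case 0
  then show ?case using norm_bd_carrier[OF 0] norm_bd_one by auto
next
  case (Suc n)
  then show ?case using norm_bd_mult[of d "c ^ n" "A ^\<^sub>m n" c A] by (simp add: mult.commute)
qed

lemma norm_bd_smult: "norm_bd d c A \<Longrightarrow> norm_bd d ((cmod z)\<^sup>2 * c) (z \<cdot>\<^sub>m A)"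
proof -
  assume A: "norm_bd d c A"
  have "nsq (z \<cdot>\<^sub>m A *\<^sub>v v) \<le> (cmod z)\<^sup>2 * c * nsq v" if v: "v \<in> carrier_vec d" for v
  proof -
    have "z \<cdot>\<^sub>m A *\<^sub>v v = z \<cdot>\<^sub>v (A *\<^sub>v v)"
      using norm_bd_carrier[OF A] v by (intro smult_mat_vec)
    then show ?thesis using norm_bd_vec[OF A v] by (simp add: nsq_smult mult_left_mono mult.assoc)
  qed
  then show ?thesis using A by (auto simp: norm_bd_def)
qed

lemma norm_bd_uminus: "norm_bd d c A \<Longrightarrow> norm_bd d c (- A)"
proof -
  assume A: "norm_bd d c A"
  have "nsq (- A *\<^sub>v v) = nsq (A *\<^sub>v v)" if v: "v \<in> carrier_vec d" for v
  proof -
    have "- A *\<^sub>v v = - (A *\<^sub>v v)"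
      using A v by (intro eq_vecI) (auto simp: norm_bd_def)
    then show ?thesis by (simp add: nsq_def)
  qed
  then show ?thesis using A by (auto simp: norm_bd_def)
qed

lemma norm_bd_entry:
  assumes "norm_bd d c A" "i < d" "j < d"
  shows "(cmod (A $$ (i, j)))\<^sup>2 \<le> c"
proof -
  have A: "A \<in> carrier_mat d d" using assms by (simp add: norm_bd_def)
  have "(A *\<^sub>v unit_vec d j) $ i = A $$ (i, j)"
    using A assms by (simp add: scalar_prod_right_unit)
  then have "(cmod (A $$ (i, j)))\<^sup>2 \<le> nsq (A *\<^sub>v unit_vec d j)"
    using entry_le_nsq[of i "A *\<^sub>v unit_vec d j"] A assms by simp
  also have "\<dots> \<le> c" using norm_bd_vec[OF assms(1), of "unit_vec d j"] assms by (simp add: nsq_unit_vec)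
  finally show ?thesis .
qed

text \<open>With w the image of v under the adjoint, |w|^2 = <A w, v>, and Cauchy-Schwarz gives
  |w|^4 <= c |w|^2 |v|^2; one factor |w|^2 is then cancelled.\<close>

lemma norm_bd_adjoint:
  assumes A: "norm_bd d c A"
  shows "norm_bd d c (mat_adjoint A)"
proof -
  have c: "0 \<le> c" and Ac: "A \<in> carrier_mat d d" using A by (auto simp: norm_bd_def)
  have "nsq (mat_adjoint A *\<^sub>v v) \<le> c * nsq v" if v: "v \<in> carrier_vec d" for v
  proof -
    let ?w = "mat_adjoint A *\<^sub>v v"
    have w: "?w \<in> carrier_vec d" using Ac v by simp
    have "complex_of_real (nsq ?w) = (A *\<^sub>v ?w) \<bullet>c v"
      using cscalar_adjoint[OF Ac w v] by (simp add: nsq_cscalar)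
    then have "nsq ?w = cmod ((A *\<^sub>v ?w) \<bullet>c v)"
      by (metis norm_of_real abs_of_nonneg nsq_nonneg)
    also have "\<dots> \<le> vnorm (A *\<^sub>v ?w) * vnorm v"
      using Ac w v by (intro cmod_cscalar_le) auto
    finally have "(nsq ?w)\<^sup>2 \<le> (vnorm (A *\<^sub>v ?w) * vnorm v)\<^sup>2"
      by (rule power_mono) simp
    also have "\<dots> = nsq (A *\<^sub>v ?w) * nsq v"
      by (simp add: vnorm_nsq power_mult_distrib)
    also have "\<dots> \<le> c * nsq ?w * nsq v"
      using norm_bd_vec[OF A w] by (simp add: mult_right_mono)
    finally have *: "nsq ?w * nsq ?w \<le> nsq ?w * (c * nsq v)"
      by (simp add: power2_eq_square mult_ac)
    show ?thesis
    proof (cases "nsq ?w = 0")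
      case True then show ?thesis using c by simp
    next
      case False
      then show ?thesis using * nsq_nonneg[of ?w]
        by (metis mult_le_cancel_left_pos order_less_le)
    qed
  qed
  then show ?thesis using c Ac by (auto simp: norm_bd_def)
qed

section \<open>Operator norm versus quadratic bounds\<close>

lemma opnorm_bdd:
  assumes c: "norm_bd d c A"
  shows "bdd_above {vnorm (A *\<^sub>v v) |v. v \<in> carrier_vec (dim_col A) \<and> vnorm v \<le> 1}" (is "bdd_above ?S")
proof (rule bdd_aboveI)
  fix x assume "x \<in> ?S"
  then obtain v where v: "v \<in> carrier_vec d" "vnorm v \<le> 1" "x = vnorm (A *\<^sub>v v)"
    using norm_bd_carrier[OF c] by auto
  have "nsq v \<le> 1" using v(2) by (simp add: vnorm_nsq)
  then have "c * nsq v \<le> c * 1" using c by (intro mult_left_mono) (auto simp: norm_bd_def)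
  then have "nsq (A *\<^sub>v v) \<le> c" using norm_bd_vec[OF c v(1)] by simp
  then show "x \<le> sqrt c" using v by (simp add: vnorm_nsq)
qed

lemma opnorm_le_of_nb:
  assumes "norm_bd d c A"
  shows "opnorm A \<le> sqrt c"
  unfolding opnorm_def
proof (rule cSup_least)
  have "vnorm (A *\<^sub>v 0\<^sub>v (dim_col A)) \<in> {vnorm (A *\<^sub>v v) |v. v \<in> carrier_vec (dim_col A) \<and> vnorm v \<le> 1}"
    by (intro CollectI exI[of _ "0\<^sub>v (dim_col A)"]) (auto simp: vnorm_nsq)
  then show "{vnorm (A *\<^sub>v v) |v. v \<in> carrier_vec (dim_col A) \<and> vnorm v \<le> 1} \<noteq> {}" by blast
next
  fix x assume "x \<in> {vnorm (A *\<^sub>v v) |v. v \<in> carrier_vec (dim_col A) \<and> vnorm v \<le> 1}"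
  then obtain v where v: "v \<in> carrier_vec d" "vnorm v \<le> 1" "x = vnorm (A *\<^sub>v v)"
    using assms by (auto simp: norm_bd_def)
  have "nsq v \<le> 1" using v(2) by (simp add: vnorm_nsq)
  then have "c * nsq v \<le> c * 1" using assms by (intro mult_left_mono) (auto simp: norm_bd_def)
  then have "nsq (A *\<^sub>v v) \<le> c" using norm_bd_vec[OF assms v(1)] by simp
  then show "x \<le> sqrt c" using v by (simp add: vnorm_nsq)
qed

lemma norm_bd_exists:
  assumes A: "A \<in> carrier_mat d d"
  shows "\<exists>c. norm_bd d c A"
proof -
  \<comment> \<open>The squared Frobenius norm; the bound is Cauchy-Schwarz row by row.\<close>
  define c where "c = (\<Sum>i<d. nsq (row A i))"
  have "nsq (A *\<^sub>v v) \<le> c * nsq v" if v: "v \<in> carrier_vec d" for v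
  proof -
    have "(cmod ((A *\<^sub>v v) $ i))\<^sup>2 \<le> nsq (row A i) * nsq v" if i: "i < d" for i
    proof -
      have "(A *\<^sub>v v) $ i = row A i \<bullet>c (conjugate v)" using A i by simp
      then have "cmod ((A *\<^sub>v v) $ i) \<le> vnorm (row A i) * vnorm (conjugate v)"
        using A v i by (metis cmod_cscalar_le carrier_vec_conjugate row_carrier_vec)
      then have "(cmod ((A *\<^sub>v v) $ i))\<^sup>2 \<le> (vnorm (row A i) * vnorm (conjugate v))\<^sup>2"
        by (rule power_mono) simp
      also have "\<dots> = nsq (row A i) * nsq v"
        by (simp add: vnorm_nsq power_mult_distrib) (simp add: nsq_def)
      finally show ?thesis .
    qed
    then have "nsq (A *\<^sub>v v) \<le> (\<Sum>i<d. nsq (row A i) * nsq v)"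
      unfolding nsq_def[of "A *\<^sub>v v"] using A by (auto intro: sum_mono)
    then show ?thesis by (simp add: c_def sum_distrib_right)
  qed
  then show ?thesis using A unfolding norm_bd_def c_def by (meson nsq_nonneg sum_nonneg)
qed

text \<open>The supremum only sees the unit ball, so a nonzero v is scaled to norm 1. A supremum of
  reals bounds its set only if that set is bounded above, which the bound c from
  \<open>norm_bd_exists\<close> supplies.\<close>

lemma norm_bd_of_opnorm_le:
  assumes A: "A \<in> carrier_mat d d" and le: "opnorm A \<le> q" and q: "0 \<le> q"
  shows "norm_bd d (q\<^sup>2) A"
proof -
  obtain c where c: "norm_bd d c A" using norm_bd_exists[OF A] by blast
  let ?S = "{vnorm (A *\<^sub>v v) |v. v \<in> carrier_vec (dim_col A) \<and> vnorm v \<le> 1}"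
  note bdd = opnorm_bdd[OF c]
  have "nsq (A *\<^sub>v v) \<le> q\<^sup>2 * nsq v" if v: "v \<in> carrier_vec d" for v
  proof (cases "nsq v = 0")
    case True
    then show ?thesis using norm_bd_vec[OF c v] by simp
  next
    case False
    define s where "s = vnorm v"
    have s: "s > 0" "s\<^sup>2 = nsq v" using False nsq_nonneg[of v] by (auto simp: s_def vnorm_nsq less_le)
    let ?u = "complex_of_real (1 / s) \<cdot>\<^sub>v v"
    have "vnorm ?u \<le> 1" using s by (simp add: vnorm_smult norm_divide s_def[symmetric])
    then have "vnorm (A *\<^sub>v ?u) \<in> ?S" using v A by (auto intro!: exI[of _ ?u])
    then have "vnorm (A *\<^sub>v ?u) \<le> q" using cSup_upper[OF _ bdd] le unfolding opnorm_def by fastforce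
    moreover have "A *\<^sub>v ?u = complex_of_real (1 / s) \<cdot>\<^sub>v (A *\<^sub>v v)"
      using A v by (intro mult_mat_vec)
    ultimately have "vnorm (A *\<^sub>v v) \<le> q * s" using s by (simp add: vnorm_smult norm_divide field_simps)
    then have "(vnorm (A *\<^sub>v v))\<^sup>2 \<le> (q * s)\<^sup>2" by (rule power_mono) (simp add: vnorm_nsq)
    then show ?thesis using s by (simp add: vnorm_nsq power_mult_distrib)
  qed
  then show ?thesis using A by (auto simp: norm_bd_def)
qed

lemma opnorm_nonneg: "A \<in> carrier_mat d d \<Longrightarrow> 0 \<le> opnorm A"
proof -
  assume A: "A \<in> carrier_mat d d"
  obtain c where c: "norm_bd d c A" using norm_bd_exists[OF A] by blast
  let ?S = "{vnorm (A *\<^sub>v v) |v. v \<in> carrier_vec (dim_col A) \<and> vnorm v \<le> 1}"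
  note bdd = opnorm_bdd[OF c]
  have "0 \<in> ?S" using A by (auto simp: vnorm_nsq mat_vec_zero intro!: exI[of _ "0\<^sub>v d"])
  then show ?thesis unfolding opnorm_def by (rule cSup_upper[OF _ bdd])
qed

section \<open>Inverses of matrices\<close>

lemma mat_inverse_ex:
  fixes A :: "complex mat"
  assumes A: "A \<in> carrier_mat n n" and inj: "\<And>v. v \<in> carrier_vec n \<Longrightarrow> A *\<^sub>v v = 0\<^sub>v n \<Longrightarrow> v = 0\<^sub>v n"
  shows "det A \<noteq> 0" and "\<exists>B. B \<in> carrier_mat n n \<and> A * B = 1\<^sub>m n \<and> B * A = 1\<^sub>m n"
proof -
  show det: "det A \<noteq> 0" using det_0_iff_vec_prod_zero_field[OF A] inj by blast
  note adj = adj_mat[OF A]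
  have 1: "(1 / det A) \<cdot>\<^sub>m (det A \<cdot>\<^sub>m 1\<^sub>m n) = 1\<^sub>m n"
    using det by (intro eq_matI) simp_all
  have "A * ((1 / det A) \<cdot>\<^sub>m adj_mat A) = 1\<^sub>m n"
    unfolding mult_smult_distrib[OF A adj(1)] adj(2) by (rule 1)
  moreover have "((1 / det A) \<cdot>\<^sub>m adj_mat A) * A = 1\<^sub>m n"
    unfolding mult_smult_assoc_mat[OF adj(1) A] adj(3) by (rule 1)
  ultimately show "\<exists>B. B \<in> carrier_mat n n \<and> A * B = 1\<^sub>m n \<and> B * A = 1\<^sub>m n"
    using adj_mat(1)[OF A] by (intro exI[of _ "(1 / det A) \<cdot>\<^sub>m adj_mat A"]) auto
qed

text \<open>For square matrices a right inverse is also a left inverse, so checking one product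
  identifies the definite description.\<close>

lemma minv_eqI:
  assumes A: "A \<in> carrier_mat n n" and B: "B \<in> carrier_mat n n" and AB: "A * B = 1\<^sub>m n"
  shows "minv A = B"
proof -
  have BA: "B * A = 1\<^sub>m n" by (rule mat_mult_left_right_inverse[OF A B AB])
  have *: "dim_row A = n" using A by simp
  show ?thesis unfolding minv_def *
  proof (rule the_equality)
    show "B \<in> carrier_mat n n \<and> A * B = 1\<^sub>m n \<and> B * A = 1\<^sub>m n" using AB BA B by blast
    fix C assume C: "C \<in> carrier_mat n n \<and> A * C = 1\<^sub>m n \<and> C * A = 1\<^sub>m n"
    have "C = C * (A * B)" using C unfolding AB by (auto simp: right_mult_one_mat)
    also have "\<dots> = (C * A) * B" using A B C by (intro assoc_mult_mat[symmetric]) auto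
    also have "\<dots> = B" using C B by simp
    finally show "C = B" .
  qed
qed

lemma norm_bd_one_minus_inj:
  assumes A: "norm_bd d c A" and c: "c < 1" and v: "v \<in> carrier_vec d"
    and 0: "(1\<^sub>m d - A) *\<^sub>v v = 0\<^sub>v d"
  shows "v = 0\<^sub>v d"
proof -
  have Ac: "A \<in> carrier_mat d d" using A by (simp add: norm_bd_def)
  have "(1\<^sub>m d - A) *\<^sub>v v = v - A *\<^sub>v v"
    using Ac v by (subst minus_mult_distrib_mat_vec[of _ d d]) auto
  then have e: "v - A *\<^sub>v v = 0\<^sub>v d" using 0 by simp
  have "A *\<^sub>v v = v"
  proof (rule eq_vecI)
    fix i assume "i < dim_vec v"
    then show "(A *\<^sub>v v) $ i = v $ i" using arg_cong[OF e, of "\<lambda>x. x $ i"] Ac v by simp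
  qed (use Ac v in auto)
  then have "nsq v \<le> c * nsq v" using norm_bd_vec[OF A v] by simp
  then have "(1 - c) * nsq v \<le> 0" by (simp add: algebra_simps)
  then have "nsq v = 0" using c nsq_nonneg[of v] by (simp add: mult_le_0_iff)
  then show ?thesis by (rule nsq_eq_0[OF v])
qed

text \<open>The square of the operator norm serves as the constant. An explicit c < 1 is what the
  power series and the inverses below consume.\<close>

lemma norm_bd_strict_of_opnorm:
  assumes "A \<in> carrier_mat d d" "opnorm A < 1"
  shows "\<exists>c. 0 \<le> c \<and> c < 1 \<and> norm_bd d c A"
proof (intro exI conjI)
  show "norm_bd d ((opnorm A)\<^sup>2) A"
    using assms opnorm_nonneg by (intro norm_bd_of_opnorm_le) auto
  show "(opnorm A)\<^sup>2 < 1"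
    using assms opnorm_nonneg[OF assms(1)] by (simp add: power_less_one_iff abs_square_less_1)
qed simp

lemma opnorm_le_1_iff: "A \<in> carrier_mat d d \<Longrightarrow> opnorm A \<le> 1 \<longleftrightarrow> norm_bd d 1 A"
  using norm_bd_of_opnorm_le[of A d 1] opnorm_le_of_nb[of d 1 A] by fastforce

lemma opnorm_adjoint_less:
  assumes "A \<in> carrier_mat d d" "opnorm A < 1"
  shows "opnorm (- mat_adjoint A) < 1"
proof -
  obtain c where "0 \<le> c" "c < 1" "norm_bd d c A" using norm_bd_strict_of_opnorm[OF assms] by blast
  then have "opnorm (- mat_adjoint A) \<le> sqrt c" "sqrt c < 1"
    using opnorm_le_of_nb norm_bd_adjoint norm_bd_uminus by (blast, simp)
  then show ?thesis by linarith
qed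

section \<open>The defect operators\<close>

text \<open>The coefficient of x^n in the expansion of (1 - x)^a.\<close>

definition bcoeff :: "real \<Rightarrow> nat \<Rightarrow> real" where
  "bcoeff a n = (a gchoose n) * (-1) ^ n"

text \<open>The power \<open>(1 - H)\<^sup>a\<close> as a binomial series; \<open>a = 1/2\<close> gives the defect operators, \<open>a = 1/4\<close> their
  positivity and \<open>a = -1/2\<close> their inverses.\<close>

definition bin_ser :: "nat \<Rightarrow> real \<Rightarrow> complex mat \<Rightarrow> complex mat" where
  "bin_ser d a H = mat d d (\<lambda>(i, j). \<Sum>n. complex_of_real (bcoeff a n) * (H ^\<^sub>m n) $$ (i, j))"

lemma bin_ser_carrier [simp]: "bin_ser d a H \<in> carrier_mat d d"
  by (simp add: bin_ser_def)

lemma bin_ser_dims [simp]: "dim_row (bin_ser d a H) = d" "dim_col (bin_ser d a H) = d"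
  by (simp_all add: bin_ser_def)

text \<open>Vandermonde's identity: the expansions of (1 - x)^a and (1 - x)^b multiply to that of (1
  - x)^(a + b).\<close>

lemma bcoeff_convolution: "(\<Sum>k\<le>n. bcoeff a k * bcoeff b (n - k)) = bcoeff (a + b) n"
proof -
  have "(\<Sum>k\<le>n. bcoeff a k * bcoeff b (n - k)) = (\<Sum>k\<le>n. (a gchoose k) * (b gchoose (n - k)) * (-1) ^ n)"
  proof (rule sum.cong)
    fix k assume "k \<in> {..n}"
    then have "(-1::real) ^ n = (-1) ^ k * (-1) ^ (n - k)" by (simp flip: power_add)
    then show "bcoeff a k * bcoeff b (n - k) = (a gchoose k) * (b gchoose (n - k)) * (-1) ^ n"
      by (simp add: bcoeff_def)
  qed simp
  also have "\<dots> = bcoeff (a + b) n"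
    using gbinomial_Vandermonde[of a b n] by (simp add: bcoeff_def atLeast0AtMost flip: sum_distrib_right)
  finally show ?thesis .
qed

lemma bcoeff_0: "bcoeff 0 n = (if n = 0 then 1 else 0)"
  by (cases n) (auto simp: bcoeff_def)

lemma bcoeff_1: "bcoeff 1 n = (if n = 0 then 1 else if n = 1 then -1 else 0)"
proof -
  have "(1::real) gchoose n = of_nat (1 choose n)" by (simp add: binomial_gbinomial)
  then show ?thesis by (cases n; cases "n - 1") (auto simp: bcoeff_def)
qed

text \<open>Entries of H^n are at most sqrt(c)^n, since \<open>norm_bd\<close> measures squares, and
  the scalar binomial series converges absolutely at sqrt(c) < 1.\<close>

lemma bin_ser_summable:
  assumes H: "norm_bd d c H" and c: "c < 1" and ij: "i < d" "j < d"
  shows "summable (\<lambda>n. norm (complex_of_real (bcoeff a n) * (H ^\<^sub>m n) $$ (i, j)))"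
proof -
  have c0: "0 \<le> c" using H by (simp add: norm_bd_def)
  define r where "r = sqrt c"
  have r: "0 \<le> r" "r < 1" using c0 c by (auto simp: r_def)
  \<comment> \<open>Any point strictly between r and 1 serves: convergence at s gives absolute
    convergence at the smaller r.\<close>
  define s where "s = (1 + r) / 2"
  have s: "r < s" "s < 1" using r by (auto simp: s_def)
  have "summable (\<lambda>n. (a gchoose n) * s ^ n)"
    using gen_binomial_real[of s a] s r by (auto intro: sums_summable)
  then have "summable (\<lambda>n. norm ((a gchoose n) * r ^ n))"
    by (rule powser_insidea) (use s r in auto)
  then show ?thesis
  proof (rule summable_comparison_test'[where N = 0])
    fix n
    have "(cmod ((H ^\<^sub>m n) $$ (i, j)))\<^sup>2 \<le> c ^ n"
      using norm_bd_entry[OF norm_bd_pow[OF H] ij] .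
    also have "\<dots> = (r ^ n)\<^sup>2"
      unfolding r_def using c0 by (metis mult.commute power_mult real_sqrt_pow2)
    finally have "cmod ((H ^\<^sub>m n) $$ (i, j)) \<le> r ^ n"
      using r by (simp add: power2_le_iff_abs_le)
    then show "norm (norm (complex_of_real (bcoeff a n) * (H ^\<^sub>m n) $$ (i, j))) \<le> norm ((a gchoose n) * r ^ n)"
      using r by (simp add: norm_mult norm_power bcoeff_def abs_mult power_abs mult_left_mono)
  qed
qed

lemma bin_ser_sums:
  assumes "norm_bd d c H" "c < 1" "i < d" "j < d"
  shows "(\<lambda>n. complex_of_real (bcoeff a n) * (H ^\<^sub>m n) $$ (i, j)) sums (bin_ser d a H $$ (i, j))"
  using summable_norm_cancel[OF bin_ser_summable[OF assms]] assms(3,4)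
  by (simp add: bin_ser_def summable_sums)

lemma mult_mat_index:
  "A \<in> carrier_mat n m \<Longrightarrow> B \<in> carrier_mat m k \<Longrightarrow> i < n \<Longrightarrow> j < k \<Longrightarrow>
   (A * B) $$ (i, j) = (\<Sum>l<m. A $$ (i, l) * B $$ (l, j))"
  by (auto simp: scalar_prod_def atLeast0LessThan intro!: sum.cong)

lemma pow_mat_add':
  "H \<in> carrier_mat d d \<Longrightarrow> H ^\<^sub>m (m + n) = H ^\<^sub>m m * H ^\<^sub>m n"
proof (induct n)
  case 0
  then show ?case by (simp add: right_mult_one_mat[of _ d d])
next
  case (Suc n)
  then show ?case by (simp add: assoc_mult_mat[of _ d d _ d _ d])
qed

text \<open>The law of exponents. Entrywise it is a Cauchy product of absolutely convergent series,
  and the sum over l recombines H^k and H^(n-k) into H^n.\<close>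

lemma bin_ser_mult:
  assumes H: "norm_bd d c H" and c: "c < 1"
  shows "bin_ser d a H * bin_ser d b H = bin_ser d (a + b) H"
proof (rule eq_matI)
  have Hc: "H \<in> carrier_mat d d" using H by (simp add: norm_bd_def)
  fix i j assume "i < dim_row (bin_ser d (a + b) H)" "j < dim_col (bin_ser d (a + b) H)"
  then have ij: "i < d" "j < d" by (auto simp: bin_ser_def)
  let ?A = "\<lambda>a n i j. complex_of_real (bcoeff a n) * (H ^\<^sub>m n) $$ (i, j)"
  have "(\<lambda>n. \<Sum>l<d. \<Sum>k\<le>n. ?A a k i l * ?A b (n - k) l j) sums (\<Sum>l<d. bin_ser d a H $$ (i, l) * bin_ser d b H $$ (l, j))"
  proof (rule sums_sum)
    fix l assume "l \<in> {..<d}"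
    then have l: "l < d" by simp
    have "(\<lambda>n. \<Sum>k\<le>n. ?A a k i l * ?A b (n - k) l j) sums ((\<Sum>n. ?A a n i l) * (\<Sum>n. ?A b n l j))"
      by (intro Cauchy_product_sums bin_ser_summable[OF H c] ij l)
    then show "(\<lambda>n. \<Sum>k\<le>n. ?A a k i l * ?A b (n - k) l j) sums (bin_ser d a H $$ (i, l) * bin_ser d b H $$ (l, j))"
      using ij l by (simp add: bin_ser_def)
  qed
  moreover have "(\<Sum>l<d. \<Sum>k\<le>n. ?A a k i l * ?A b (n - k) l j) = ?A (a + b) n i j" for n
  proof -
    have "(\<Sum>l<d. \<Sum>k\<le>n. ?A a k i l * ?A b (n - k) l j) =
      (\<Sum>k\<le>n. complex_of_real (bcoeff a k * bcoeff b (n - k)) * (\<Sum>l<d. (H ^\<^sub>m k) $$ (i, l) * (H ^\<^sub>m (n - k)) $$ (l, j)))"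
      by (subst sum.swap) (simp add: sum_distrib_left mult_ac)
    also have "\<dots> = (\<Sum>k\<le>n. complex_of_real (bcoeff a k * bcoeff b (n - k)) * (H ^\<^sub>m n) $$ (i, j))"
    proof (rule sum.cong)
      fix k assume "k \<in> {..n}"
      then have "H ^\<^sub>m n = H ^\<^sub>m k * H ^\<^sub>m (n - k)"
        using pow_mat_add'[OF Hc, of k "n - k"] by simp
      then have "(\<Sum>l<d. (H ^\<^sub>m k) $$ (i, l) * (H ^\<^sub>m (n - k)) $$ (l, j)) = (H ^\<^sub>m n) $$ (i, j)"
        using mult_mat_index[of "H ^\<^sub>m k" d d "H ^\<^sub>m (n - k)" d i j] Hc ij by simp
      then show "complex_of_real (bcoeff a k * bcoeff b (n - k)) * (\<Sum>l<d. (H ^\<^sub>m k) $$ (i, l) * (H ^\<^sub>m (n - k)) $$ (l, j)) =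
        complex_of_real (bcoeff a k * bcoeff b (n - k)) * (H ^\<^sub>m n) $$ (i, j)" by simp
    qed simp
    also have "\<dots> = complex_of_real (\<Sum>k\<le>n. bcoeff a k * bcoeff b (n - k)) * (H ^\<^sub>m n) $$ (i, j)"
      by (simp add: sum_distrib_right)
    finally show ?thesis by (simp add: bcoeff_convolution)
  qed
  ultimately have "(\<lambda>n. ?A (a + b) n i j) sums (\<Sum>l<d. bin_ser d a H $$ (i, l) * bin_ser d b H $$ (l, j))"
    by simp
  moreover have "(\<lambda>n. ?A (a + b) n i j) sums (bin_ser d (a + b) H $$ (i, j))"
    by (rule bin_ser_sums[OF H c ij])
  ultimately show "(bin_ser d a H * bin_ser d b H) $$ (i, j) = bin_ser d (a + b) H $$ (i, j)"
    using ij by (subst mult_mat_index[of _ d d _ d]) (auto intro: sums_unique2)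
qed (auto simp: bin_ser_def)

lemma bin_ser_0:
  assumes H: "H \<in> carrier_mat d d"
  shows "bin_ser d 0 H = 1\<^sub>m d"
proof (rule eq_matI)
  fix i j assume "i < dim_row (1\<^sub>m d :: complex mat)" "j < dim_col (1\<^sub>m d :: complex mat)"
  then have ij: "i < d" "j < d" by auto
  have "(\<Sum>n. complex_of_real (bcoeff 0 n) * (H ^\<^sub>m n) $$ (i, j)) =
        (\<Sum>n\<in>{0}. complex_of_real (bcoeff 0 n) * (H ^\<^sub>m n) $$ (i, j))"
    by (rule suminf_finite) (auto simp: bcoeff_0)
  then show "bin_ser d 0 H $$ (i, j) = 1\<^sub>m d $$ (i, j)" using ij H by (simp add: bin_ser_def bcoeff_0)
qed (auto simp: bin_ser_def)

lemma bin_ser_1: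
  assumes H: "H \<in> carrier_mat d d"
  shows "bin_ser d 1 H = 1\<^sub>m d - H"
proof (rule eq_matI)
  fix i j assume "i < dim_row (1\<^sub>m d - H)" "j < dim_col (1\<^sub>m d - H)"
  then have ij: "i < d" "j < d" using H by auto
  have "(\<Sum>n. complex_of_real (bcoeff 1 n) * (H ^\<^sub>m n) $$ (i, j)) =
        (\<Sum>n\<in>{0, 1}. complex_of_real (bcoeff 1 n) * (H ^\<^sub>m n) $$ (i, j))"
    by (rule suminf_finite) (auto simp: bcoeff_1)
  then show "bin_ser d 1 H $$ (i, j) = (1\<^sub>m d - H) $$ (i, j)" using ij H by (simp add: bin_ser_def bcoeff_1)
qed (use H in \<open>auto simp: bin_ser_def\<close>)

lemma pow_mat_intertwine:
  assumes "H \<in> carrier_mat d d" "H' \<in> carrier_mat d d" "X \<in> carrier_mat d d" "X * H = H' * (X :: complex mat)"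
  shows "X * H ^\<^sub>m n = H' ^\<^sub>m n * X"
proof (induct n)
  case 0
  then show ?case using assms by simp
next
  case (Suc n)
  have "X * H ^\<^sub>m Suc n = (X * H ^\<^sub>m n) * H"
    using assms by (simp add: assoc_mult_mat[of _ d d _ d _ d])
  also have "\<dots> = H' ^\<^sub>m n * (X * H)"
    using assms Suc by (simp add: assoc_mult_mat[of _ d d _ d _ d])
  also have "\<dots> = H' ^\<^sub>m Suc n * X"
    using assms by (simp add: assoc_mult_mat[of _ d d _ d _ d])
  finally show ?case .
qed

text \<open>The relation passes from H to its powers and from there to the series. It is used with X
  commuting with H, for the uniqueness of the square root, and with X = a, H = a' a, H' = a a' (a'
  the adjoint), for the two defect operators.\<close>

lemma bin_ser_intertwine:
  assumes H: "norm_bd d c H" and c: "c < 1" and H': "norm_bd d c' H'" and c': "c' < 1"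
    and X: "X \<in> carrier_mat d d" and XH: "X * H = H' * X"
  shows "X * bin_ser d a H = bin_ser d a H' * X"
proof (rule eq_matI)
  note Hc = norm_bd_carrier[OF H] norm_bd_carrier[OF H']
  fix i j assume "i < dim_row (bin_ser d a H' * X)" "j < dim_col (bin_ser d a H' * X)"
  then have ij: "i < d" "j < d" using X by (auto simp: bin_ser_def)
  have "(\<lambda>n. \<Sum>l<d. X $$ (i, l) * (complex_of_real (bcoeff a n) * (H ^\<^sub>m n) $$ (l, j)))
     sums (\<Sum>l<d. X $$ (i, l) * bin_ser d a H $$ (l, j))"
    by (intro sums_sum sums_mult bin_ser_sums[OF H c]) (use ij in auto)
  moreover have "(\<lambda>n. \<Sum>l<d. (complex_of_real (bcoeff a n) * (H' ^\<^sub>m n) $$ (i, l)) * X $$ (l, j))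
     sums (\<Sum>l<d. bin_ser d a H' $$ (i, l) * X $$ (l, j))"
    by (intro sums_sum sums_mult2 bin_ser_sums[OF H' c']) (use ij in auto)
  moreover have "(\<Sum>l<d. X $$ (i, l) * (complex_of_real (bcoeff a n) * (H ^\<^sub>m n) $$ (l, j))) =
     (\<Sum>l<d. (complex_of_real (bcoeff a n) * (H' ^\<^sub>m n) $$ (i, l)) * X $$ (l, j))" for n
  proof -
    have "(\<Sum>l<d. X $$ (i, l) * (H ^\<^sub>m n) $$ (l, j)) = (\<Sum>l<d. (H' ^\<^sub>m n) $$ (i, l) * X $$ (l, j))"
      using arg_cong[OF pow_mat_intertwine[OF Hc X XH, of n], of "\<lambda>A. A $$ (i, j)"]
        mult_mat_index[OF X pow_carrier_mat[OF Hc(1)] ij] mult_mat_index[OF pow_carrier_mat[OF Hc(2)] X ij]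
      by simp
    from arg_cong[OF this, of "\<lambda>x. complex_of_real (bcoeff a n) * x"]
    show ?thesis by (simp add: sum_distrib_left mult_ac)
  qed
  ultimately have "(\<Sum>l<d. X $$ (i, l) * bin_ser d a H $$ (l, j)) = (\<Sum>l<d. bin_ser d a H' $$ (i, l) * X $$ (l, j))"
    by (auto intro: sums_unique2)
  then show "(X * bin_ser d a H) $$ (i, j) = (bin_ser d a H' * X) $$ (i, j)"
    using mult_mat_index[OF X bin_ser_carrier ij] mult_mat_index[OF bin_ser_carrier X ij] by simp
qed (use X in \<open>auto simp: bin_ser_def\<close>)

text \<open>The coefficients are real, and powers of a self-adjoint H are self-adjoint.\<close>

lemma bin_ser_adjoint:
  assumes H: "norm_bd d c H" and c: "c < 1" and Ha: "mat_adjoint H = H"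
  shows "mat_adjoint (bin_ser d a H) = bin_ser d a H"
proof (rule eq_matI)
  have Hc: "H \<in> carrier_mat d d" using H by (simp add: norm_bd_def)
  have pa: "mat_adjoint (H ^\<^sub>m n) = H ^\<^sub>m n" for n
  proof (induct n)
    case (Suc n)
    have "mat_adjoint (H ^\<^sub>m Suc n) = H * H ^\<^sub>m n"
      using Hc Suc Ha by (simp add: mat_adjoint_mult[of _ d d _ d])
    also have "\<dots> = H ^\<^sub>m Suc n"
      using pow_mat_intertwine[OF Hc Hc Hc refl, of n] by simp
    finally show ?case .
  qed (use Hc in auto)
  fix i j assume "i < dim_row (bin_ser d a H)" "j < dim_col (bin_ser d a H)"
  then have ij: "i < d" "j < d" by (auto simp: bin_ser_def)
  have "(\<lambda>n. cnj (complex_of_real (bcoeff a n) * (H ^\<^sub>m n) $$ (j, i))) sums cnj (bin_ser d a H $$ (j, i))"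
    using bin_ser_sums[OF H c ij(2,1)] by (simp only: sums_cnj)
  moreover have eq: "cnj (complex_of_real (bcoeff a n) * (H ^\<^sub>m n) $$ (j, i)) = complex_of_real (bcoeff a n) * (H ^\<^sub>m n) $$ (i, j)" for n
    using arg_cong[OF pa[of n], of "\<lambda>A. A $$ (i, j)"] ij carrier_matD[OF pow_carrier_mat[OF Hc, of n]] by simp
  ultimately have "(\<lambda>n. complex_of_real (bcoeff a n) * (H ^\<^sub>m n) $$ (i, j)) sums cnj (bin_ser d a H $$ (j, i))"
    unfolding eq by blast
  from sums_unique2[OF this bin_ser_sums[OF H c ij]] have "cnj (bin_ser d a H $$ (j, i)) = bin_ser d a H $$ (i, j)" .
  then show "mat_adjoint (bin_ser d a H) $$ (i, j) = bin_ser d a H $$ (i, j)"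
    using ij by (simp add: bin_ser_def)
qed (auto simp: bin_ser_def)


lemma norm_bd_gram: "norm_bd d c A \<Longrightarrow> norm_bd d (c * c) (mat_adjoint A * A)"
  by (intro norm_bd_mult norm_bd_adjoint)

lemma adjoint_gram: "A \<in> carrier_mat n m \<Longrightarrow> mat_adjoint (mat_adjoint A * A) = mat_adjoint A * (A :: complex mat)"
  by (simp add: mat_adjoint_mult[of _ m n _ m])

text \<open>As H = 1 - L^2, L commutes with H and hence with the series R, so (R + L)(R - L) = R^2 -
  L^2 = 0. The factor R + L is injective: <L v, v> >= 0, and <R v, v> = |S v|^2 with S the fourth
  root, which is invertible.\<close>

lemma psd_mat_sqrt_unique:
  assumes H: "norm_bd d c H" and c: "c < 1" and Ha: "mat_adjoint H = H"
    and L: "psd_mat d L" and LL: "L * L = 1\<^sub>m d - H"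
  shows "L = bin_ser d (1/2) H"
proof -
  let ?R = "bin_ser d (1/2) H" and ?S = "bin_ser d (1/4) H" and ?S' = "bin_ser d (-1/4) H"
  have Hc: "H \<in> carrier_mat d d" using H by (simp add: norm_bd_def)
  have Lc: "L \<in> carrier_mat d d" using L by (simp add: psd_mat_def)
  note car = Hc Lc bin_ser_carrier[of d _ H]
  have RR: "?R * ?R = 1\<^sub>m d - H"
    using bin_ser_mult[OF H c, of "1/2" "1/2"] bin_ser_1[OF Hc] by simp
  have SS: "?S * ?S = ?R" using bin_ser_mult[OF H c, of "1/4" "1/4"] by simp
  have S'S: "?S' * ?S = 1\<^sub>m d" using bin_ser_mult[OF H c, of "-1/4" "1/4"] bin_ser_0[OF Hc] by simp
  have HL: "H = 1\<^sub>m d - L * L" using LL car by (intro eq_matI) auto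
  have "L * H = L * 1\<^sub>m d - L * (L * L)"
    by (subst HL) (use car in \<open>simp add: mult_minus_distrib_mat[of _ d d _ d]\<close>)
  also have "\<dots> = 1\<^sub>m d * L - L * L * L"
    using car by (simp add: assoc_mult_mat[of _ d d _ d _ d])
  also have "\<dots> = H * L"
    using arg_cong[OF HL, of "\<lambda>X. X * L"] car by (simp add: minus_mult_distrib_mat[of _ d d _ _ d])
  finally have "L * H = H * L" .
  from bin_ser_intertwine[OF H c H c Lc this]
  have LR: "L * ?R = ?R * L" .
  have "(?R + L) * (?R - L) = ?R * ?R + L * ?R - (?R * L + L * L)"
    using car by (simp add: add_mult_distrib_mat[of _ d d _ _ d] mult_minus_distrib_mat[of _ d d _ d])
  also have "\<dots> = 0\<^sub>m d d" unfolding RR LL LR using car by (intro eq_matI) auto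
  finally have prod: "(?R + L) * (?R - L) = 0\<^sub>m d d" .
  have Re0: "0 \<le> Re ((L *\<^sub>v v) \<bullet>c v)" if "v \<in> carrier_vec d" for v
    using L that by (simp add: psd_mat_def)
  have "v = 0\<^sub>v d" if v: "v \<in> carrier_vec d" and 0: "(?R + L) *\<^sub>v v = 0\<^sub>v d" for v
  proof -
    have "(?R *\<^sub>v v) \<bullet>c v = (?S *\<^sub>v (?S *\<^sub>v v)) \<bullet>c v"
      using SS v by (metis assoc_mult_mat_vec bin_ser_carrier)
    also have "\<dots> = (?S *\<^sub>v v) \<bullet>c (?S *\<^sub>v v)"
      using v bin_ser_adjoint[OF H c Ha, of "1/4"] by (subst cscalar_adjoint[of _ d d]) (auto intro: mult_mat_vec_carrier[OF bin_ser_carrier])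
    finally have RS: "Re ((?R *\<^sub>v v) \<bullet>c v) = nsq (?S *\<^sub>v v)"
      by (metis nsq_cscalar Re_complex_of_real)
    have "((?R + L) *\<^sub>v v) \<bullet>c v = (?R *\<^sub>v v) \<bullet>c v + (L *\<^sub>v v) \<bullet>c v"
      using car v add_scalar_prod_distrib[OF mult_mat_vec_carrier[OF bin_ser_carrier v, of "1/2" H] mult_mat_vec_carrier[OF Lc v], of "conjugate v"]
      by (simp add: add_mult_distrib_mat_vec[of _ d d])
    then have "Re ((?R *\<^sub>v v) \<bullet>c v) + Re ((L *\<^sub>v v) \<bullet>c v) = 0"
      using v by (simp add: 0 flip: plus_complex.sel)
    then have "nsq (?S *\<^sub>v v) = 0"
      using Re0[OF v] RS nsq_nonneg[of "?S *\<^sub>v v"] by linarith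
    then have "?S *\<^sub>v v = 0\<^sub>v d" using v by (intro nsq_eq_0) (auto intro: mult_mat_vec_carrier[OF bin_ser_carrier])
    then have "?S' *\<^sub>v (?S *\<^sub>v v) = 0\<^sub>v d" by (simp add: mat_vec_zero[of _ d d])
    then show "v = 0\<^sub>v d" using S'S v by (metis assoc_mult_mat_vec bin_ser_carrier one_mult_mat_vec)
  qed
  then obtain B where B: "B \<in> carrier_mat d d" "B * (?R + L) = 1\<^sub>m d"
    using mat_inverse_ex(2)[of "?R + L" d] car by auto
  have "?R - L = (B * (?R + L)) * (?R - L)" unfolding B(2) using car by simp
  also have "\<dots> = B * ((?R + L) * (?R - L))" using car B(1) by (intro assoc_mult_mat) auto
  also have "\<dots> = 0\<^sub>m d d" unfolding prod using B by simp
  finally have RL: "?R - L = 0\<^sub>m d d" .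
  show ?thesis
  proof (rule eq_matI)
    fix i j assume "i < dim_row ?R" "j < dim_col ?R"
    then show "L $$ (i, j) = ?R $$ (i, j)"
      using arg_cong[OF RL, of "\<lambda>A. A $$ (i, j)"] car by (simp add: bin_ser_def)
  qed (use car in \<open>auto simp: bin_ser_def\<close>)
qed

lemma msqrt_one_minus:
  assumes H: "norm_bd d c H" and c: "c < 1" and Ha: "mat_adjoint H = H"
  shows "msqrt (1\<^sub>m d - H) = bin_ser d (1/2) H"
proof -
  let ?R = "bin_ser d (1/2) H" and ?S = "bin_ser d (1/4) H"
  have Hc: "H \<in> carrier_mat d d" using H by (simp add: norm_bd_def)
  have dim: "dim_row (1\<^sub>m d - H) = d" using Hc by simp
  have "0 \<le> Re ((?R *\<^sub>v v) \<bullet>c v)" if v: "v \<in> carrier_vec d" for v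
  proof -
    have "(?R *\<^sub>v v) \<bullet>c v = (?S *\<^sub>v (?S *\<^sub>v v)) \<bullet>c v"
      using bin_ser_mult[OF H c, of "1/4" "1/4"] v
      by (simp flip: assoc_mult_mat_vec[of _ d d _ d])
    also have "\<dots> = (?S *\<^sub>v v) \<bullet>c (?S *\<^sub>v v)"
      using v bin_ser_adjoint[OF H c Ha, of "1/4"] by (subst cscalar_adjoint[of _ d d]) (auto intro: mult_mat_vec_carrier[OF bin_ser_carrier])
    finally show ?thesis by (metis nsq_cscalar Re_complex_of_real nsq_nonneg)
  qed
  then have psd: "psd_mat d ?R"
    using bin_ser_adjoint[OF H c Ha] by (auto simp: psd_mat_def)
  show ?thesis unfolding msqrt_def dim
  proof (rule the_equality)
    show "psd_mat d ?R \<and> ?R * ?R = 1\<^sub>m d - H"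
      using psd bin_ser_mult[OF H c, of "1/2" "1/2"] bin_ser_1[OF Hc] by simp
  qed (use psd_mat_sqrt_unique[OF H c Ha] in blast)
qed

text \<open>Passing to the adjoint exchanges the two defect operators, so every fact about
  \<open>rhoR\<close> is one about \<open>rhoL\<close>.\<close>

lemma rhoR_conv_rhoL: "rhoR a = rhoL (mat_adjoint a)"
  by (simp add: rhoR_def rhoL_def)

lemma rhoL_bin_ser:
  assumes "norm_bd d c a" "c < 1"
  shows "rhoL a = bin_ser d (1/2) (mat_adjoint a * a)"
proof -
  have a: "a \<in> carrier_mat d d" using assms by (simp add: norm_bd_def)
  have "c * c < 1" using assms mult_strict_mono'[of c 1 c 1] by (auto simp: norm_bd_def)
  then have "msqrt (1\<^sub>m d - mat_adjoint a * a) = bin_ser d (1/2) (mat_adjoint a * a)"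
    by (rule msqrt_one_minus[OF norm_bd_gram[OF assms(1)] _ adjoint_gram[OF a]])
  then show ?thesis using a by (simp add: rhoL_def)
qed

lemma rhoL_props:
  assumes a: "a \<in> carrier_mat d d" "opnorm a < 1"
  shows "rhoL a \<in> carrier_mat d d" "mat_adjoint (rhoL a) = rhoL a"
    "rhoL a * rhoL a = 1\<^sub>m d - mat_adjoint a * a"
    "minv (rhoL a) \<in> carrier_mat d d" "rhoL a * minv (rhoL a) = 1\<^sub>m d" "minv (rhoL a) * rhoL a = 1\<^sub>m d"
    "a * rhoL a = rhoR a * a"
proof -
  obtain c where c: "0 \<le> c" "c < 1" "norm_bd d c a" using norm_bd_strict_of_opnorm[OF a] by blast
  let ?H = "mat_adjoint a * a" and ?H' = "a * mat_adjoint a"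
  have H: "norm_bd d (c * c) ?H" by (rule norm_bd_gram[OF c(3)])
  have H': "norm_bd d (c * c) ?H'" by (intro norm_bd_mult norm_bd_adjoint c)
  have cc: "c * c < 1" using c mult_strict_mono'[of c 1 c 1] by auto
  note L = rhoL_bin_ser[OF c(3,2)]
  have R: "rhoR a = bin_ser d (1/2) ?H'"
    using rhoL_bin_ser[OF norm_bd_adjoint[OF c(3)] c(2)] by (simp add: rhoR_conv_rhoL)
  have Hc: "?H \<in> carrier_mat d d" using a by (intro mult_carrier_mat) auto
  show "rhoL a \<in> carrier_mat d d" by (simp add: L)
  show "mat_adjoint (rhoL a) = rhoL a"
    unfolding L by (rule bin_ser_adjoint[OF H cc adjoint_gram[OF a(1)]])
  show "rhoL a * rhoL a = 1\<^sub>m d - ?H"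
    unfolding L using bin_ser_mult[OF H cc, of "1/2" "1/2"] bin_ser_1[OF Hc] by simp
  have inv: "rhoL a * bin_ser d (-1/2) ?H = 1\<^sub>m d"
    unfolding L using bin_ser_mult[OF H cc, of "1/2" "-1/2"] bin_ser_0[OF Hc] by simp
  have "minv (rhoL a) = bin_ser d (-1/2) ?H"
    by (rule minv_eqI[OF _ _ inv]) (simp_all add: L)
  then show "minv (rhoL a) \<in> carrier_mat d d" "rhoL a * minv (rhoL a) = 1\<^sub>m d" "minv (rhoL a) * rhoL a = 1\<^sub>m d"
    using inv mat_mult_left_right_inverse[OF _ _ inv] by (simp_all add: L)
  \<comment> \<open>Both sides are a a' a, a' the adjoint; the series with exponent 1/2 inherits the
    intertwining.\<close>
  have "a * ?H = ?H' * a" using a by (simp add: assoc_mult_mat[of _ d d _ d _ d])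
  then show "a * rhoL a = rhoR a * a"
    unfolding L R by (rule bin_ser_intertwine[OF H cc H' cc a(1)])
qed

lemma opnorm_adjoint_less':
  assumes "A \<in> carrier_mat d d" "opnorm A < 1"
  shows "opnorm (mat_adjoint A) < 1"
proof -
  obtain c where "0 \<le> c" "c < 1" "norm_bd d c A" using norm_bd_strict_of_opnorm[OF assms] by blast
  then have "opnorm (mat_adjoint A) \<le> sqrt c" "sqrt c < 1"
    using opnorm_le_of_nb norm_bd_adjoint by (blast, simp)
  then show ?thesis by linarith
qed

lemma rhoR_props:
  assumes a: "a \<in> carrier_mat d d" "opnorm a < 1"
  shows "rhoR a \<in> carrier_mat d d" "mat_adjoint (rhoR a) = rhoR a"
    "rhoR a * rhoR a = 1\<^sub>m d - a * mat_adjoint a"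
    "minv (rhoR a) \<in> carrier_mat d d" "rhoR a * minv (rhoR a) = 1\<^sub>m d" "minv (rhoR a) * rhoR a = 1\<^sub>m d"
    "mat_adjoint a * rhoR a = rhoL a * mat_adjoint a"
  using rhoL_props[of "mat_adjoint a" d] opnorm_adjoint_less'[OF a] a
  by (simp_all add: rhoR_conv_rhoL)

section \<open>Schur steps as unitary relations\<close>

lemma mat_eq_vecI:
  fixes A B :: "complex mat"
  assumes A: "A \<in> carrier_mat n m" and B: "B \<in> carrier_mat n m"
    and eq: "\<And>v. v \<in> carrier_vec m \<Longrightarrow> A *\<^sub>v v = B *\<^sub>v v"
  shows "A = B"
proof (rule eq_matI)
  fix i j assume "i < dim_row B" "j < dim_col B"
  then have ij: "i < n" "j < m" using B by auto
  have "(A *\<^sub>v unit_vec m j) $ i = (B *\<^sub>v unit_vec m j) $ i" by (simp add: eq)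
  then show "A $$ (i, j) = B $$ (i, j)"
    using ij A B by (simp add: scalar_prod_right_unit)
qed (use A B in auto)

lemma mat_adjoint_four_block:
  assumes "A \<in> carrier_mat n1 m1" "B \<in> carrier_mat n1 m2" "C \<in> carrier_mat n2 m1" "D \<in> carrier_mat n2 m2"
  shows "mat_adjoint (four_block_mat A B C D) =
    four_block_mat (mat_adjoint A) (mat_adjoint C) (mat_adjoint B) (mat_adjoint (D :: complex mat))"
  by (rule eq_matI) (use assms in auto)

lemma Theta_carrier:
  assumes "a \<in> carrier_mat d d" "opnorm a < 1"
  shows "Theta a \<in> carrier_mat (d + d) (d + d)"
  unfolding Theta_def using assms rhoL_props(1)[OF assms] rhoR_props(1)[OF assms] by auto

text \<open>The diagonal blocks of the product are 1 by the squares of the defect operators; the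
  off-diagonal ones cancel by the intertwining \<open>a * rhoL a = rhoR a * a\<close> and its
  counterpart for the adjoint.\<close>

lemma Theta_unitary:
  assumes a: "a \<in> carrier_mat d d" "opnorm a < 1"
  shows "mat_adjoint (Theta a) * Theta a = 1\<^sub>m (d + d)" "Theta a * mat_adjoint (Theta a) = 1\<^sub>m (d + d)"
proof -
  note L = rhoL_props[OF a] and R = rhoR_props[OF a]
  have adj: "mat_adjoint (Theta a) = four_block_mat a (rhoR a) (rhoL a) (- mat_adjoint a)"
    unfolding Theta_def using a L R by (subst mat_adjoint_four_block[of _ d d _ d _ d]) auto
  have "mat_adjoint (Theta a) * Theta a =
    four_block_mat (a * mat_adjoint a + rhoR a * rhoR a) (a * rhoL a + rhoR a * (- a))
      (rhoL a * mat_adjoint a + (- mat_adjoint a) * rhoR a) (rhoL a * rhoL a + (- mat_adjoint a) * (- a))"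
    unfolding adj unfolding Theta_def using a L(1) R(1) by (intro mult_four_block_mat) auto
  also have "a * mat_adjoint a + rhoR a * rhoR a = 1\<^sub>m d"
    unfolding R(3) using a by (intro eq_matI) auto
  also have "a * rhoL a + rhoR a * (- a) = 0\<^sub>m d d"
    unfolding L(7) using a R(1) by (intro eq_matI) auto
  also have "rhoL a * mat_adjoint a + (- mat_adjoint a) * rhoR a = 0\<^sub>m d d"
    using a R(1) L(1) by (subst R(7)[symmetric]) (intro eq_matI; auto)
  also have "rhoL a * rhoL a + (- mat_adjoint a) * (- a) = 1\<^sub>m d"
    unfolding L(3) using a by (intro eq_matI) auto
  also have "four_block_mat (1\<^sub>m d) (0\<^sub>m d d) (0\<^sub>m d d) (1\<^sub>m d) = (1\<^sub>m (d + d) :: complex mat)"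
    by (rule eq_matI) auto
  finally show 1: "mat_adjoint (Theta a) * Theta a = 1\<^sub>m (d + d)" .
  show "Theta a * mat_adjoint (Theta a) = 1\<^sub>m (d + d)"
    by (rule mat_mult_left_right_inverse[OF _ _ 1]) (use Theta_carrier[OF a] in auto)
qed

lemma Theta_vec:
  assumes a: "a \<in> carrier_mat d d" "opnorm a < 1" and v: "u \<in> carrier_vec d" "w \<in> carrier_vec d"
  shows "Theta a *\<^sub>v (u @\<^sub>v w) = (mat_adjoint a *\<^sub>v u + rhoL a *\<^sub>v w) @\<^sub>v (rhoR a *\<^sub>v u - a *\<^sub>v w)"
proof -
  have "- a *\<^sub>v w = - (a *\<^sub>v w)" using a v by (intro eq_vecI) auto
  then have "rhoR a *\<^sub>v u + - a *\<^sub>v w = rhoR a *\<^sub>v u - a *\<^sub>v w"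
    using a v rhoR_props(1)[OF a] by (intro eq_vecI) auto
  then show ?thesis
    unfolding Theta_def using a v rhoL_props(1)[OF a] rhoR_props(1)[OF a]
    by (subst four_block_mat_mult_vec[of _ d d _ d _ d]) auto
qed

text \<open>The source of every contraction and decay estimate that follows: unitarity of
  \<open>Theta a\<close>, read on two stacked blocks.\<close>

lemma Theta_energy:
  assumes a: "a \<in> carrier_mat d d" "opnorm a < 1" and v: "u \<in> carrier_vec d" "w \<in> carrier_vec d"
    and eq: "Theta a *\<^sub>v (u @\<^sub>v w) = u' @\<^sub>v w'"
  shows "nsq u' + nsq w' = nsq u + nsq w"
  using nsq_isometry[OF Theta_carrier[OF a] Theta_unitary(1)[OF a], of "u @\<^sub>v w"] v eq
  by (simp add: nsq_append)

text \<open>The relation between consecutive values \<open>g\<close>, \<open>g'\<close> of the Schur iterates at \<open>z\<close>: on the graph of \<open>g\<close>, the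
  unitary \<open>Theta a\<close> is closed up by \<open>z g'\<close>. For \<open>z \<noteq> 0\<close> it is equivalent to one step of the Schur algorithm, but
  unlike that step it yields an energy identity at once.\<close>

definition schur_link :: "nat \<Rightarrow> complex mat \<Rightarrow> complex \<Rightarrow> complex mat \<Rightarrow> complex mat \<Rightarrow> bool" where
  "schur_link d a z g g' \<longleftrightarrow> (\<forall>w\<in>carrier_vec d. \<exists>c\<in>carrier_vec d.
     Theta a *\<^sub>v ((g *\<^sub>v w) @\<^sub>v c) = w @\<^sub>v (z \<cdot>\<^sub>v (g' *\<^sub>v c)))"

lemma norm_bd_one_minus_inverse:
  assumes A: "norm_bd d c A" and c: "c < 1"
  shows "det (1\<^sub>m d - A) \<noteq> 0" "minv (1\<^sub>m d - A) \<in> carrier_mat d d"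
    "(1\<^sub>m d - A) * minv (1\<^sub>m d - A) = 1\<^sub>m d" "minv (1\<^sub>m d - A) * (1\<^sub>m d - A) = 1\<^sub>m d"
proof -
  have Ac: "1\<^sub>m d - A \<in> carrier_mat d d" using A by (auto simp: norm_bd_def)
  note inj = norm_bd_one_minus_inj[OF A c]
  show "det (1\<^sub>m d - A) \<noteq> 0" using mat_inverse_ex(1)[OF Ac inj] .
  obtain B where B: "B \<in> carrier_mat d d" "(1\<^sub>m d - A) * B = 1\<^sub>m d" "B * (1\<^sub>m d - A) = 1\<^sub>m d"
    using mat_inverse_ex(2)[OF Ac inj] by blast
  have "minv (1\<^sub>m d - A) = B" by (rule minv_eqI[OF Ac B(1,2)])
  then show "minv (1\<^sub>m d - A) \<in> carrier_mat d d"
    "(1\<^sub>m d - A) * minv (1\<^sub>m d - A) = 1\<^sub>m d" "minv (1\<^sub>m d - A) * (1\<^sub>m d - A) = 1\<^sub>m d"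
    using B by auto
qed

lemma mat_cancel_left:
  fixes A :: "complex mat"
  assumes "A \<in> carrier_mat n n" "B \<in> carrier_mat n n" "B * A = 1\<^sub>m n" "X \<in> carrier_mat n m"
  shows "B * (A * X) = X"
  using assms by (simp flip: assoc_mult_mat[of _ n n _ n _ m])

lemma mat_vec_cancel_left:
  fixes A :: "complex mat"
  assumes "A \<in> carrier_mat n n" "B \<in> carrier_mat n n" "B * A = 1\<^sub>m n" "x \<in> carrier_vec n"
  shows "B *\<^sub>v (A *\<^sub>v x) = x"
  by (metis assms assoc_mult_mat_vec one_mult_mat_vec)

lemma mat_swap_left:
  fixes A :: "complex mat"
  assumes "A \<in> carrier_mat n n" "B \<in> carrier_mat n n" "C \<in> carrier_mat n n" "D \<in> carrier_mat n n"
    "X \<in> carrier_mat n m" "A * B = C * D"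
  shows "A * (B * X) = C * (D * X)"
proof -
  have "A * (B * X) = (A * B) * X" using assms by (intro assoc_mult_mat[symmetric]) auto
  also have "\<dots> = C * (D * X)" unfolding assms(6) using assms by (intro assoc_mult_mat) auto
  finally show ?thesis .
qed

lemma rho_inv_intertwine:
  assumes a: "a \<in> carrier_mat d d" "opnorm a < 1"
  shows "a * minv (rhoL a) = minv (rhoR a) * a"
proof -
  note L = rhoL_props[OF a] and R = rhoR_props[OF a]
  have "minv (rhoR a) * a = minv (rhoR a) * (a * (rhoL a * minv (rhoL a)))"
    using a by (simp add: L(5))
  also have "\<dots> = minv (rhoR a) * ((a * rhoL a) * minv (rhoL a))"
    using a L(1,4) by (simp add: assoc_mult_mat[of _ d d _ d _ d])
  also have "\<dots> = minv (rhoR a) * (rhoR a * (a * minv (rhoL a)))"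
    unfolding L(7) using a L(1,4) R(1,4) by (simp add: assoc_mult_mat[of _ d d _ d _ d])
  also have "\<dots> = a * minv (rhoL a)"
    using a L(1,4) R(1,4,6) by (intro mat_cancel_left[of _ d _ _ d]) auto
  finally show ?thesis by simp
qed

lemma rho_inv_intertwine':
  assumes a: "a \<in> carrier_mat d d" "opnorm a < 1"
  shows "mat_adjoint a * minv (rhoR a) = minv (rhoL a) * mat_adjoint a"
  using rho_inv_intertwine[of "mat_adjoint a" d] opnorm_adjoint_less'[OF a] a
  by (simp add: rhoR_conv_rhoL)

text \<open>With a' the adjoint of a, the first component of the relation forces c to be rhoL^-1 (1
  - a' g) w; inserted into the second it yields the displayed identity. Unlike
  \<open>schur_step\<close>, the identity neither divides by z nor inverts 1 - a' g, so it survives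
  limits.\<close>

lemma schur_link_iff:
  assumes a: "a \<in> carrier_mat d d" "opnorm a < 1" and g: "g \<in> carrier_mat d d" and g': "g' \<in> carrier_mat d d"
  shows "schur_link d a z g g' \<longleftrightarrow>
    (z \<cdot>\<^sub>m g') * (minv (rhoL a) * (1\<^sub>m d - mat_adjoint a * g)) = minv (rhoR a) * (g - a)"
proof -
  note L = rhoL_props[OF a] and R = rhoR_props[OF a]
  define iL where "iL = minv (rhoL a)"
  define iR where "iR = minv (rhoR a)"
  define M where "M = 1\<^sub>m d - mat_adjoint a * g"
  note L' = L[folded iL_def] and R' = R[folded iR_def]
  have M: "M \<in> carrier_mat d d" using a g by (auto simp: M_def)
  note car = a(1) g g' L'(1,4) R'(1,4) M
  \<comment> \<open>\<open>rhoR a\<close> is written as rhoR^-1 (1 - a a'), and moving rhoL^-1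
    across a turns it into rhoR^-1; the terms with a a' g then cancel.\<close>
  have K: "rhoR a * g - a * (iL * M) = iR * (g - a)"
  proof -
    have "rhoR a * g = iR * (rhoR a * (rhoR a * g))"
      using car R'(6) by (intro mat_cancel_left[symmetric]) auto
    also have "rhoR a * (rhoR a * g) = (1\<^sub>m d - a * mat_adjoint a) * g"
      unfolding R'(3)[symmetric] using car by (intro assoc_mult_mat[symmetric]) auto
    also have "\<dots> = g - a * (mat_adjoint a * g)"
      using car by (simp add: minus_mult_distrib_mat[of _ d d _ _ d] assoc_mult_mat[of _ d d _ d _ d])
    finally have 1: "rhoR a * g = iR * (g - a * (mat_adjoint a * g))" .
    have "a * (iL * M) = iR * (a * M)"
      using car rho_inv_intertwine[OF a, folded iL_def iR_def] by (intro mat_swap_left[of _ d]) auto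
    also have "a * M = a - a * (mat_adjoint a * g)"
      unfolding M_def using car by (simp add: mult_minus_distrib_mat[of _ d d _ d])
    finally have 2: "a * (iL * M) = iR * (a - a * (mat_adjoint a * g))" .
    have "rhoR a * g - a * (iL * M) = iR * ((g - a * (mat_adjoint a * g)) - (a - a * (mat_adjoint a * g)))"
      unfolding 1 2 using car by (intro mult_minus_distrib_mat[symmetric]) auto
    also have "(g - a * (mat_adjoint a * g)) - (a - a * (mat_adjoint a * g)) = g - a"
      using car by (intro eq_matI) auto
    finally show ?thesis .
  qed
  \<comment> \<open>The forced choice of c satisfies the first component for every w; only the
    second one involves g'.\<close>
  have Theta_c: "Theta a *\<^sub>v ((g *\<^sub>v w) @\<^sub>v (iL *\<^sub>v (M *\<^sub>v w))) = w @\<^sub>v ((iR * (g - a)) *\<^sub>v w)"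
    if w: "w \<in> carrier_vec d" for w
  proof -
    have gw: "g *\<^sub>v w \<in> carrier_vec d" "M *\<^sub>v w \<in> carrier_vec d" "iL *\<^sub>v (M *\<^sub>v w) \<in> carrier_vec d"
      using car w by (auto intro!: mult_mat_vec_carrier[of _ d d])
    have Mw: "M *\<^sub>v w = w - mat_adjoint a *\<^sub>v (g *\<^sub>v w)"
      unfolding M_def using car w by (simp add: minus_mult_distrib_mat_vec[of _ d d] assoc_mult_mat_vec[of _ d d _ d])
    have "rhoL a *\<^sub>v (iL *\<^sub>v (M *\<^sub>v w)) = M *\<^sub>v w"
      using car gw L'(5) by (intro mat_vec_cancel_left[of _ d]) auto
    then have "mat_adjoint a *\<^sub>v (g *\<^sub>v w) + rhoL a *\<^sub>v (iL *\<^sub>v (M *\<^sub>v w)) = w"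
      unfolding Mw using car w gw by (intro eq_vecI) auto
    moreover have "rhoR a *\<^sub>v (g *\<^sub>v w) - a *\<^sub>v (iL *\<^sub>v (M *\<^sub>v w)) = (rhoR a * g - a * (iL * M)) *\<^sub>v w"
      using car w gw by (simp add: minus_mult_distrib_mat_vec[of _ d d] assoc_mult_mat_vec[of _ d d _ d])
    ultimately show ?thesis
      by (simp add: Theta_vec[OF a gw(1,3)] K)
  qed
  show ?thesis unfolding iL_def[symmetric] iR_def[symmetric] M_def[symmetric]
  proof
    assume lk: "schur_link d a z g g'"
    show "(z \<cdot>\<^sub>m g') * (iL * M) = iR * (g - a)"
    proof (rule mat_eq_vecI)
      fix w :: "complex vec" assume w: "w \<in> carrier_vec d"
      obtain c where c: "c \<in> carrier_vec d" "Theta a *\<^sub>v ((g *\<^sub>v w) @\<^sub>v c) = w @\<^sub>v (z \<cdot>\<^sub>v (g' *\<^sub>v c))"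
        using lk w by (auto simp: schur_link_def)
      have gw: "g *\<^sub>v w \<in> carrier_vec d" "M *\<^sub>v w \<in> carrier_vec d" "iL *\<^sub>v (M *\<^sub>v w) \<in> carrier_vec d"
        using car w by (auto intro!: mult_mat_vec_carrier[of _ d d])
      have "w = mat_adjoint a *\<^sub>v (g *\<^sub>v w) + rhoL a *\<^sub>v c"
        using c(2) unfolding Theta_vec[OF a gw(1) c(1)]
        by (subst (asm) append_vec_eq[of _ d]) (use w car c in auto)
      then have "rhoL a *\<^sub>v c = w - mat_adjoint a *\<^sub>v (g *\<^sub>v w)"
      proof -
        assume e: "w = mat_adjoint a *\<^sub>v (g *\<^sub>v w) + rhoL a *\<^sub>v c"
        show ?thesis
        proof (rule eq_vecI)
          fix i assume "i < dim_vec (w - mat_adjoint a *\<^sub>v (g *\<^sub>v w))"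
          then show "(rhoL a *\<^sub>v c) $ i = (w - mat_adjoint a *\<^sub>v (g *\<^sub>v w)) $ i"
            using arg_cong[OF e, of "\<lambda>x. x $ i"] car w c by simp
        qed (use car w in auto)
      qed
      also have "\<dots> = M *\<^sub>v w"
        unfolding M_def using car w by (simp add: minus_mult_distrib_mat_vec[of _ d d] assoc_mult_mat_vec[of _ d d _ d])
      finally have "iL *\<^sub>v (rhoL a *\<^sub>v c) = iL *\<^sub>v (M *\<^sub>v w)" by simp
      then have "c = iL *\<^sub>v (M *\<^sub>v w)"
        using car c(1) L'(6) by (simp add: mat_vec_cancel_left[of _ d] del: assoc_mult_mat_vec)
      with c(2) Theta_c[OF w] have "w @\<^sub>v (z \<cdot>\<^sub>v (g' *\<^sub>v (iL *\<^sub>v (M *\<^sub>v w)))) = w @\<^sub>v ((iR * (g - a)) *\<^sub>v w)" by simp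
      then show "(z \<cdot>\<^sub>m g') * (iL * M) *\<^sub>v w = iR * (g - a) *\<^sub>v w"
        using car w gw by (simp add: append_vec_eq[of _ d] assoc_mult_mat_vec[of _ d d _ d] smult_mat_vec[of _ d d])
    qed (use car in auto)
  next
    assume eq: "(z \<cdot>\<^sub>m g') * (iL * M) = iR * (g - a)"
    show "schur_link d a z g g'" unfolding schur_link_def
    proof (intro ballI bexI)
      fix w :: "complex vec" assume w: "w \<in> carrier_vec d"
      have gw: "g *\<^sub>v w \<in> carrier_vec d" "M *\<^sub>v w \<in> carrier_vec d" "iL *\<^sub>v (M *\<^sub>v w) \<in> carrier_vec d"
        using car w by (auto intro!: mult_mat_vec_carrier[of _ d d])
      have "(iR * (g - a)) *\<^sub>v w = z \<cdot>\<^sub>v (g' *\<^sub>v (iL *\<^sub>v (M *\<^sub>v w)))"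
        unfolding eq[symmetric] using car w gw by (simp add: assoc_mult_mat_vec[of _ d d _ d] smult_mat_vec[of _ d d])
      then show "Theta a *\<^sub>v ((g *\<^sub>v w) @\<^sub>v (iL *\<^sub>v (M *\<^sub>v w))) = w @\<^sub>v (z \<cdot>\<^sub>v (g' *\<^sub>v (iL *\<^sub>v (M *\<^sub>v w))))"
        using Theta_c[OF w] by simp
      show "iL *\<^sub>v (M *\<^sub>v w) \<in> carrier_vec d" by fact
    qed
  qed
qed

text \<open>As a is a strict contraction and \<open>g z\<close> a contraction, the matrix inverted
  in \<open>schur_step\<close> is indeed invertible, and with z nonzero the identity of
  \<open>schur_link_iff\<close> can be solved for g'.\<close>

lemma schur_step_iff_link:
  assumes a: "a \<in> carrier_mat d d" "opnorm a < 1" and g: "norm_bd d 1 (g z)" and g': "g' \<in> carrier_mat d d"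
    and z: "z \<noteq> 0"
  shows "g' = schur_step a g z \<longleftrightarrow> schur_link d a z (g z) g'"
proof -
  note L = rhoL_props[OF a] and R = rhoR_props[OF a]
  define M where "M = 1\<^sub>m d - mat_adjoint a * g z"
  obtain c where c: "0 \<le> c" "c < 1" "norm_bd d c a" using norm_bd_strict_of_opnorm[OF a] by blast
  have gc: "g z \<in> carrier_mat d d" using g by (simp add: norm_bd_def)
  have "norm_bd d c (mat_adjoint a * g z)" using norm_bd_mult[OF norm_bd_adjoint[OF c(3)] g] by simp
  note Mi = norm_bd_one_minus_inverse(2-4)[OF this c(2), folded M_def]
  have M: "M \<in> carrier_mat d d" using a gc by (auto simp: M_def)
  note car = a(1) gc g' L(1,4) R(1,4) M Mi(1)
  have gac: "g z - a \<in> carrier_mat d d" using car by auto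
  define X where "X = minv (rhoR a) * (g z - a)"
  have X: "X \<in> carrier_mat d d" using car gac by (auto simp: X_def)
  have s: "schur_step a g z = (1 / z) \<cdot>\<^sub>m (X * (minv M * rhoL a))"
    unfolding schur_step_def M_def[symmetric] X_def using a car gac M_def
    by (simp add: assoc_mult_mat[of _ d d _ d _ d])
  have W: "(minv M * rhoL a) * (minv (rhoL a) * M) = 1\<^sub>m d" "(minv (rhoL a) * M) * (minv M * rhoL a) = 1\<^sub>m d"
  proof -
    have "(minv M * rhoL a) * (minv (rhoL a) * M) = minv M * (rhoL a * (minv (rhoL a) * M))"
      using car by (simp add: assoc_mult_mat[of _ d d _ d _ d])
    also have "\<dots> = 1\<^sub>m d" using car L(5) Mi(3) by (simp add: mat_cancel_left[of _ d _ _ d])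
    finally show 1: "(minv M * rhoL a) * (minv (rhoL a) * M) = 1\<^sub>m d" .
    show "(minv (rhoL a) * M) * (minv M * rhoL a) = 1\<^sub>m d"
      by (rule mat_mult_left_right_inverse[OF _ _ 1]) (use car in auto)
  qed
  define P where "P = minv M * rhoL a"
  define Q where "Q = minv (rhoL a) * M"
  have PQ: "P \<in> carrier_mat d d" "Q \<in> carrier_mat d d" "P * Q = 1\<^sub>m d" "Q * P = 1\<^sub>m d"
    using W car by (auto simp: P_def Q_def)
  have zz: "(z \<cdot>\<^sub>m ((1 / z) \<cdot>\<^sub>m Y)) = Y" "((1 / z) \<cdot>\<^sub>m (z \<cdot>\<^sub>m Y)) = Y" for Y
    using z by (auto intro!: eq_matI)
  have "g' = (1 / z) \<cdot>\<^sub>m (X * P) \<longleftrightarrow> (z \<cdot>\<^sub>m g') * Q = X"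
  proof
    assume "g' = (1 / z) \<cdot>\<^sub>m (X * P)"
    then have "z \<cdot>\<^sub>m g' = X * P" using zz by simp
    then show "(z \<cdot>\<^sub>m g') * Q = X" using PQ X by (simp add: assoc_mult_mat[of _ d d _ d _ d])
  next
    assume "(z \<cdot>\<^sub>m g') * Q = X"
    then have "X * P = (z \<cdot>\<^sub>m g') * Q * P" by simp
    also have "\<dots> = (z \<cdot>\<^sub>m g') * (Q * P)" using PQ car by (intro assoc_mult_mat) auto
    also have "\<dots> = z \<cdot>\<^sub>m g'" using PQ car by simp
    finally show "g' = (1 / z) \<cdot>\<^sub>m (X * P)" using zz by simp
  qed
  then show ?thesis unfolding s schur_link_iff[OF a gc g'] P_def Q_def X_def M_def by simp
qed

text \<open>The Schur algorithm run backwards: the Moebius transformation that recovers an iterate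
  at z from the value h of the next one. It makes sense at z = 0 as well.\<close>

definition inv_step :: "nat \<Rightarrow> complex mat \<Rightarrow> complex \<Rightarrow> complex mat \<Rightarrow> complex mat" where
  "inv_step d a z h = minv (rhoR a) * (a + z \<cdot>\<^sub>m h) * (minv (1\<^sub>m d + z \<cdot>\<^sub>m (mat_adjoint a * h)) * rhoL a)"

text \<open>With a' the adjoint, z a' h is a strict contraction, so the denominator is invertible.
  That the result T is a contraction comes from the link, not from the formula: |w|^2 + |z h u|^2 =
  |T w|^2 + |u|^2 while |z h u| <= |u|.\<close>

lemma inv_step_props:
  assumes a: "a \<in> carrier_mat d d" "opnorm a < 1" and h: "norm_bd d 1 h" and z: "cmod z < 1"
  shows "schur_link d a z (inv_step d a z h) h" "norm_bd d 1 (inv_step d a z h)"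
    "det (1\<^sub>m d + z \<cdot>\<^sub>m (mat_adjoint a * h)) \<noteq> 0"
    "minv (1\<^sub>m d + z \<cdot>\<^sub>m (mat_adjoint a * h)) \<in> carrier_mat d d"
    "(1\<^sub>m d + z \<cdot>\<^sub>m (mat_adjoint a * h)) * minv (1\<^sub>m d + z \<cdot>\<^sub>m (mat_adjoint a * h)) = 1\<^sub>m d"
    "inv_step d a 0 h = a"
proof -
  note L = rhoL_props[OF a] and R = rhoR_props[OF a]
  define N where "N = 1\<^sub>m d + z \<cdot>\<^sub>m (mat_adjoint a * h)"
  obtain c where c: "0 \<le> c" "c < 1" "norm_bd d c a" using norm_bd_strict_of_opnorm[OF a] by blast
  have hc: "h \<in> carrier_mat d d" using h by (simp add: norm_bd_def)
  have nbz: "norm_bd d ((cmod z)\<^sup>2 * c) (- (z \<cdot>\<^sub>m (mat_adjoint a * h)))"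
    using norm_bd_mult[OF norm_bd_adjoint[OF c(3)] h] by (intro norm_bd_uminus norm_bd_smult) simp
  have "(cmod z)\<^sup>2 \<le> 1" using z by (simp add: abs_square_le_1)
  then have lt: "(cmod z)\<^sup>2 * c < 1"
    using c mult_right_mono[of "(cmod z)\<^sup>2" 1 c] by linarith
  have N_eq: "N = 1\<^sub>m d - (- (z \<cdot>\<^sub>m (mat_adjoint a * h)))"
    unfolding N_def using a hc by (intro eq_matI) auto
  note Ni = norm_bd_one_minus_inverse(1-4)[OF nbz lt, folded N_eq]
  then show "det (1\<^sub>m d + z \<cdot>\<^sub>m (mat_adjoint a * h)) \<noteq> 0"
    "minv (1\<^sub>m d + z \<cdot>\<^sub>m (mat_adjoint a * h)) \<in> carrier_mat d d"
    "(1\<^sub>m d + z \<cdot>\<^sub>m (mat_adjoint a * h)) * minv (1\<^sub>m d + z \<cdot>\<^sub>m (mat_adjoint a * h)) = 1\<^sub>m d"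
    by (simp_all add: N_def)
  have N: "N \<in> carrier_mat d d" using a hc by (auto simp: N_def)
  define T where "T = inv_step d a z h"
  define A where "A = a + z \<cdot>\<^sub>m h"
  have A: "A \<in> carrier_mat d d" using a hc by (auto simp: A_def)
  note car = a(1) hc L(1,4) R(1,4) N Ni(2) A
  have T_eq: "T = minv (rhoR a) * (A * (minv N * rhoL a))"
    unfolding T_def inv_step_def N_def[symmetric] A_def[symmetric] using car
    by (simp add: assoc_mult_mat[of _ d d _ d _ d])
  have T: "T \<in> carrier_mat d d" using car by (auto simp: T_eq)
  \<comment> \<open>This makes the first component of Theta return w: the terms a' a coming from A
    and from the square of \<open>rhoL a\<close> cancel, leaving 1 + z a' h.\<close>
  have id1: "mat_adjoint a * (minv (rhoR a) * A) + rhoL a = minv (rhoL a) * N"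
  proof -
    have "mat_adjoint a * (minv (rhoR a) * A) = minv (rhoL a) * (mat_adjoint a * A)"
      using car rho_inv_intertwine'[OF a] by (intro mat_swap_left[of _ d]) auto
    moreover have "rhoL a = minv (rhoL a) * (1\<^sub>m d - mat_adjoint a * a)"
      unfolding L(3)[symmetric] using car L(6) by (intro mat_cancel_left[symmetric]) auto
    ultimately have "mat_adjoint a * (minv (rhoR a) * A) + rhoL a =
       minv (rhoL a) * (mat_adjoint a * A) + minv (rhoL a) * (1\<^sub>m d - mat_adjoint a * a)" by simp
    also have "\<dots> = minv (rhoL a) * (mat_adjoint a * A + (1\<^sub>m d - mat_adjoint a * a))"
      using car by (intro mult_add_distrib_mat[symmetric]) auto
    also have "mat_adjoint a * A = mat_adjoint a * a + z \<cdot>\<^sub>m (mat_adjoint a * h)"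
      unfolding A_def using car by (simp add: mult_add_distrib_mat[of _ d d _ d] mult_smult_distrib[of _ d d _ d])
    also have "mat_adjoint a * a + z \<cdot>\<^sub>m (mat_adjoint a * h) + (1\<^sub>m d - mat_adjoint a * a) = N"
      unfolding N_def using car by (intro eq_matI) auto
    finally show ?thesis .
  qed
  have Theta_T: "Theta a *\<^sub>v ((T *\<^sub>v w) @\<^sub>v (minv N * rhoL a *\<^sub>v w)) = w @\<^sub>v (z \<cdot>\<^sub>v (h *\<^sub>v (minv N * rhoL a *\<^sub>v w)))"
    if w: "w \<in> carrier_vec d" for w
  proof -
    \<comment> \<open>The component c of the link for the input w.\<close>
    define u where "u = minv N * rhoL a *\<^sub>v w"
    have u: "u \<in> carrier_vec d" using car w by (auto simp: u_def)
    have Tw: "T *\<^sub>v w = minv (rhoR a) *\<^sub>v (A *\<^sub>v u)"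
      unfolding T_eq u_def using car w by (simp add: assoc_mult_mat_vec[of _ d d _ d])
    have "mat_adjoint a *\<^sub>v (T *\<^sub>v w) + rhoL a *\<^sub>v u = (mat_adjoint a * (minv (rhoR a) * A) + rhoL a) *\<^sub>v u"
      unfolding Tw using car u by (simp add: add_mult_distrib_mat_vec[of _ d d] assoc_mult_mat_vec[of _ d d _ d])
    also have "\<dots> = minv (rhoL a) *\<^sub>v (N *\<^sub>v u)"
      unfolding id1 using car u by (simp add: assoc_mult_mat_vec[of _ d d _ d])
    also have "N *\<^sub>v u = rhoL a *\<^sub>v w"
      unfolding u_def using car w Ni(3)
      by (subst assoc_mult_mat_vec[of _ d d _ d]) (auto intro!: mat_vec_cancel_left[of _ d] mult_mat_vec_carrier[of _ d d])
    also have "minv (rhoL a) *\<^sub>v (rhoL a *\<^sub>v w) = w"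
      using car w L(6) by (intro mat_vec_cancel_left[of _ d]) auto
    finally have e1: "mat_adjoint a *\<^sub>v (T *\<^sub>v w) + rhoL a *\<^sub>v u = w" .
    have "rhoR a *\<^sub>v (T *\<^sub>v w) = A *\<^sub>v u"
      unfolding Tw using car u R(5) by (intro mat_vec_cancel_left[of _ d]) (auto intro!: mult_mat_vec_carrier[of _ d d])
    also have "\<dots> = a *\<^sub>v u + z \<cdot>\<^sub>v (h *\<^sub>v u)"
      unfolding A_def using car u by (simp add: add_mult_distrib_mat_vec[of _ d d] smult_mat_vec[of _ d d])
    finally have e2: "rhoR a *\<^sub>v (T *\<^sub>v w) - a *\<^sub>v u = z \<cdot>\<^sub>v (h *\<^sub>v u)"
      using car u by (auto intro!: eq_vecI)
    show ?thesis unfolding u_def[symmetric]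
      using e1 e2 T w u by (subst Theta_vec[OF a]) auto
  qed
  have Nu: "minv N * rhoL a *\<^sub>v w \<in> carrier_vec d" if "w \<in> carrier_vec d" for w
    using car that by (intro mult_mat_vec_carrier) auto
  show "schur_link d a z (inv_step d a z h) h"
    unfolding schur_link_def T_def[symmetric] using Theta_T Nu by blast
  have "nsq (T *\<^sub>v w) \<le> 1 * nsq w" if w: "w \<in> carrier_vec d" for w
  proof -
    let ?u = "minv N * rhoL a *\<^sub>v w"
    have "nsq w + nsq (z \<cdot>\<^sub>v (h *\<^sub>v ?u)) = nsq (T *\<^sub>v w) + nsq ?u"
      using Theta_energy[OF a _ Nu[OF w] Theta_T[OF w]] T w by auto
    moreover have "nsq (z \<cdot>\<^sub>v (h *\<^sub>v ?u)) \<le> 1 * nsq ?u"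
      unfolding nsq_smult using \<open>(cmod z)\<^sup>2 \<le> 1\<close> norm_bd_vec[OF h Nu[OF w]] by (intro mult_mono) auto
    ultimately show ?thesis by simp
  qed
  then show "norm_bd d 1 (inv_step d a z h)" using T by (auto simp: norm_bd_def T_def)
  \<comment> \<open>At z = 0 the dependence on h disappears and the defect operators cancel by the
    intertwining.\<close>
  have "0 \<cdot>\<^sub>m X = 0\<^sub>m d d" if "X \<in> carrier_mat d d" for X :: "complex mat"
    using that by (intro eq_matI) auto
  then have "inv_step d a 0 h = minv (rhoR a) * a * (minv (1\<^sub>m d) * rhoL a)"
    unfolding inv_step_def using car by (simp add: right_add_zero_mat[of _ d d])
  also have "minv (1\<^sub>m d) = (1\<^sub>m d :: complex mat)" by (rule minv_eqI) auto
  also have "minv (rhoR a) * a * (1\<^sub>m d * rhoL a) = a"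
    using car L(6,7) R(6) rho_inv_intertwine[OF a]
    by (simp flip: rho_inv_intertwine[OF a] add: assoc_mult_mat[of _ d d _ d _ d])
  finally show "inv_step d a 0 h = a" .
qed

section \<open>Chains of Schur iterates\<close>

lemma append_vec_diff:
  fixes u u' v v' :: "complex vec"
  assumes "u \<in> carrier_vec n" "u' \<in> carrier_vec n" "v \<in> carrier_vec m" "v' \<in> carrier_vec m"
  shows "(u @\<^sub>v v) - (u' @\<^sub>v v') = (u - u') @\<^sub>v (v - v')"
  by (rule eq_vecI) (use assms in auto)

text \<open>By linearity the energy identity also controls how far apart two solutions are.\<close>

lemma Theta_diff_energy:
  assumes a: "a \<in> carrier_mat d d" "opnorm a < 1"
    and car: "u \<in> carrier_vec d" "c \<in> carrier_vec d" "w \<in> carrier_vec d" "x \<in> carrier_vec d"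
      "u' \<in> carrier_vec d" "c' \<in> carrier_vec d" "w' \<in> carrier_vec d" "x' \<in> carrier_vec d"
    and eq: "Theta a *\<^sub>v (u @\<^sub>v c) = w @\<^sub>v x" "Theta a *\<^sub>v (u' @\<^sub>v c') = w' @\<^sub>v x'"
  shows "nsq (w - w') + nsq (x - x') = nsq (u - u') + nsq (c - c')"
proof (rule Theta_energy[OF a])
  have "Theta a *\<^sub>v ((u @\<^sub>v c) - (u' @\<^sub>v c')) = (w @\<^sub>v x) - (w' @\<^sub>v x')"
    using car by (subst mult_minus_distrib_mat_vec[OF Theta_carrier[OF a]]) (auto simp: eq)
  then show "Theta a *\<^sub>v ((u - u') @\<^sub>v (c - c')) = (w - w') @\<^sub>v (x - x')"
    by (simp only: append_vec_diff[OF car(1,5,2,6)] append_vec_diff[OF car(3,7,4,8)])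
qed (use car in auto)

lemma cmod_diff_sq_le: "(cmod (x - y))\<^sup>2 \<le> 2 * (cmod x)\<^sup>2 + 2 * (cmod y)\<^sup>2"
proof -
  have "(cmod (x - y))\<^sup>2 \<le> (cmod x + cmod y)\<^sup>2"
    by (rule power_mono[OF norm_triangle_ineq4]) simp
  also have "\<dots> \<le> 2 * (cmod x)\<^sup>2 + 2 * (cmod y)\<^sup>2"
    using zero_le_power2[of "cmod x - cmod y"] by (simp add: power2_eq_square algebra_simps)
  finally show ?thesis .
qed

lemma nsq_diff_le:
  assumes "u \<in> carrier_vec n" "v \<in> carrier_vec n"
  shows "nsq (u - v) \<le> 2 * nsq u + 2 * nsq v"
proof -
  have dims: "dim_vec u = n" "dim_vec v = n" using assms by auto
  have "nsq (u - v) = (\<Sum>i<n. (cmod (u $ i - v $ i))\<^sup>2)" by (simp add: nsq_def dims)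
  also have "\<dots> \<le> (\<Sum>i<n. 2 * (cmod (u $ i))\<^sup>2 + 2 * (cmod (v $ i))\<^sup>2)" by (intro sum_mono cmod_diff_sq_le)
  also have "\<dots> = 2 * nsq u + 2 * nsq v" by (simp add: nsq_def dims sum.distrib sum_distrib_left)
  finally show ?thesis .
qed

lemma smult_diff_vec:
  fixes u v :: "complex vec"
  assumes "u \<in> carrier_vec n" "v \<in> carrier_vec n"
  shows "z \<cdot>\<^sub>v u - z \<cdot>\<^sub>v v = z \<cdot>\<^sub>v (u - v)"
  by (rule eq_vecI) (use assms in \<open>auto simp: algebra_simps\<close>)

text \<open>\<open>G m\<close> stands for the value of the m-th iterate at one fixed z; analyticity
  is left out. The finite length n lets the same notion serve whole sequences and truncated
  ones.\<close>

definition chain :: "nat \<Rightarrow> (nat \<Rightarrow> complex mat) \<Rightarrow> complex \<Rightarrow> nat \<Rightarrow> (nat \<Rightarrow> complex mat) \<Rightarrow> bool" where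
  "chain d a z n G \<longleftrightarrow> (\<forall>m<n. a m \<in> carrier_mat d d \<and> opnorm (a m) < 1 \<and> schur_link d (a m) z (G m) (G (Suc m))) \<and>
     (\<forall>m\<le>n. norm_bd d 1 (G m))"

text \<open>A signal w is sent down the cascade of links. The next input has to be z times
  \<open>C m\<close>: then the second component that leaves one link is G times the input of the
  next.\<close>

lemma chain_trajectory:
  assumes ch: "chain d a z n G" and w: "w \<in> carrier_vec d"
  obtains W C where "W 0 = w" "\<And>m. W m \<in> carrier_vec d" "\<And>m. C m \<in> carrier_vec d"
    "\<And>m. m < n \<Longrightarrow> Theta (a m) *\<^sub>v ((G m *\<^sub>v W m) @\<^sub>v C m) = W m @\<^sub>v (z \<cdot>\<^sub>v (G (Suc m) *\<^sub>v C m))"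
    "\<And>m. m < n \<Longrightarrow> W (Suc m) = z \<cdot>\<^sub>v C m"
proof -
  define ok where "ok m x c \<longleftrightarrow> c \<in> carrier_vec d \<and>
    Theta (a m) *\<^sub>v ((G m *\<^sub>v x) @\<^sub>v c) = x @\<^sub>v (z \<cdot>\<^sub>v (G (Suc m) *\<^sub>v c))" for m x c
  define f where "f m x = (SOME c. ok m x c)" for m x
  have f: "ok m x (f m x)" if "m < n" "x \<in> carrier_vec d" for m x
  proof -
    have "\<exists>c. ok m x c" using ch that unfolding chain_def schur_link_def ok_def by blast
    then show ?thesis unfolding f_def by (rule someI_ex)
  qed
  define W where "W = rec_nat w (\<lambda>m x. if m < n then z \<cdot>\<^sub>v f m x else x)"
  define C where "C m = (if m < n then f m (W m) else 0\<^sub>v d)" for m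
  have W: "W m \<in> carrier_vec d" for m
    by (induct m) (use w f in \<open>auto simp: W_def ok_def\<close>)
  show thesis
  proof (rule that[of W C])
    show "W 0 = w" by (simp add: W_def)
    show "W m \<in> carrier_vec d" for m by (rule W)
    show "C m \<in> carrier_vec d" for m using f[OF _ W] by (auto simp: C_def ok_def)
    show "Theta (a m) *\<^sub>v ((G m *\<^sub>v W m) @\<^sub>v C m) = W m @\<^sub>v (z \<cdot>\<^sub>v (G (Suc m) *\<^sub>v C m))" if "m < n" for m
      using f[OF that W] that by (auto simp: C_def ok_def)
    show "W (Suc m) = z \<cdot>\<^sub>v C m" if "m < n" for m
      using that by (simp add: C_def W_def)
  qed
qed

text \<open>The defect e = |W|^2 - |G W|^2 shrinks by |z|^2 at every link and dominates (1 - |z|^2)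
  |C|^2. As each input is z times the previous C, the inputs themselves decay geometrically.\<close>

lemma trajectory_decay:
  assumes ch: "chain d a z n G" and z: "cmod z < 1"
    and W: "\<And>m. W m \<in> carrier_vec d" "\<And>m. C m \<in> carrier_vec d"
    "\<And>m. m < n \<Longrightarrow> Theta (a m) *\<^sub>v ((G m *\<^sub>v W m) @\<^sub>v C m) = W m @\<^sub>v (z \<cdot>\<^sub>v (G (Suc m) *\<^sub>v C m))"
    "\<And>m. m < n \<Longrightarrow> W (Suc m) = z \<cdot>\<^sub>v C m"
  shows "nsq (G n *\<^sub>v W n) \<le> ((cmod z)\<^sup>2) ^ n / (1 - (cmod z)\<^sup>2) * nsq (W 0)"
proof -
  define r where "r = (cmod z)\<^sup>2"
  have r: "0 \<le> r" "r < 1" using z by (auto simp: r_def abs_square_less_1)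
  define e where "e m = nsq (W m) - nsq (G m *\<^sub>v W m)" for m
  have nbG: "norm_bd d 1 (G m)" if "m \<le> n" for m using ch that by (simp add: chain_def)
  have Gc: "G m *\<^sub>v W m \<in> carrier_vec d" "G (Suc m) *\<^sub>v C m \<in> carrier_vec d" if "m < n" for m
    using nbG[of m] nbG[of "Suc m"] that W by (auto simp: norm_bd_def)
  \<comment> \<open>The same defect seen from the other side of the link, by conservation of
    energy.\<close>
  have e_eq: "e m = nsq (C m) - r * nsq (G (Suc m) *\<^sub>v C m)" if m: "m < n" for m
  proof -
    have "nsq (W m) + nsq (z \<cdot>\<^sub>v (G (Suc m) *\<^sub>v C m)) = nsq (G m *\<^sub>v W m) + nsq (C m)"
      using ch m Gc[OF m] W by (intro Theta_energy[of "a m" d]) (auto simp: chain_def)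
    then show ?thesis by (simp add: e_def nsq_smult r_def)
  qed
  have e0: "e m \<ge> (1 - r) * nsq (C m)" if "m < n" for m
  proof -
    have "r * nsq (G (Suc m) *\<^sub>v C m) \<le> r * nsq (C m)"
      using norm_bd_vec[OF nbG[of "Suc m"] W(2)] that r by (intro mult_left_mono) auto
    then show ?thesis unfolding e_eq[OF that] by (simp add: algebra_simps)
  qed
  have eS: "e (Suc m) \<le> r * e m" if m: "m < n" for m
  proof -
    have "G (Suc m) *\<^sub>v W (Suc m) = z \<cdot>\<^sub>v (G (Suc m) *\<^sub>v C m)"
      unfolding W(4)[OF m] using nbG[of "Suc m"] m W by (intro mult_mat_vec) (auto simp: norm_bd_def)
    then have "e (Suc m) = r * (nsq (C m) - nsq (G (Suc m) *\<^sub>v C m))"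
      unfolding e_def W(4)[OF m] by (simp add: nsq_smult r_def algebra_simps)
    also have "\<dots> \<le> r * e m"
      unfolding e_eq[OF m] using r nsq_nonneg[of "G (Suc m) *\<^sub>v C m"]
      by (intro mult_left_mono) (auto simp: mult_left_le_one_le)
    finally show ?thesis .
  qed
  have em: "m \<le> n \<Longrightarrow> e m \<le> r ^ m * nsq (W 0)" for m
  proof (induct m)
    case 0
    then show ?case by (simp add: e_def)
  next
    case (Suc m)
    then have "e (Suc m) \<le> r * e m" using eS[of m] by simp
    also have "\<dots> \<le> r * (r ^ m * nsq (W 0))" using Suc r by (intro mult_left_mono) auto
    finally show ?case by simp
  qed
  \<comment> \<open>The bound comes from C at n - 1, hence the separate case n = 0, where 1 / (1 -
    r) >= 1 suffices.\<close>
  have "nsq (W n) \<le> r ^ n / (1 - r) * nsq (W 0)"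
  proof (cases n)
    case 0
    have "1 * nsq (W 0) \<le> 1 / (1 - r) * nsq (W 0)" using r by (intro mult_right_mono) auto
    then show ?thesis using 0 by simp
  next
    case (Suc m)
    then have m: "m < n" by simp
    have "(1 - r) * nsq (C m) \<le> r ^ m * nsq (W 0)" using e0[OF m] em[of m] m by simp
    then have "nsq (C m) \<le> r ^ m * nsq (W 0) / (1 - r)" using r by (simp add: field_simps)
    then have "r * nsq (C m) \<le> r * (r ^ m * nsq (W 0) / (1 - r))" using r by (intro mult_left_mono) auto
    then show ?thesis unfolding Suc W(4)[OF m] by (simp add: nsq_smult r_def)
  qed
  then show ?thesis using norm_bd_vec[OF nbG[of n] W(1)[of n]] by (simp add: r_def)
qed

text \<open>Two chains with the same parameters and the same input differ by a trajectory with zero input, whose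
  energy at the start is dominated by the energy at the end; the latter decays like \<open>cmod z ^ (2 * n)\<close>.\<close>

lemma chain_compare:
  assumes G: "chain d a z n G" and H: "chain d a z n H" and z: "cmod z < 1" and w: "w \<in> carrier_vec d"
  shows "nsq (G 0 *\<^sub>v w - H 0 *\<^sub>v w) \<le> 4 * (((cmod z)\<^sup>2) ^ n / (1 - (cmod z)\<^sup>2)) * nsq w"
proof -
  obtain W C where W: "W 0 = w" "\<And>m. W m \<in> carrier_vec d" "\<And>m. C m \<in> carrier_vec d"
    "\<And>m. m < n \<Longrightarrow> Theta (a m) *\<^sub>v ((G m *\<^sub>v W m) @\<^sub>v C m) = W m @\<^sub>v (z \<cdot>\<^sub>v (G (Suc m) *\<^sub>v C m))"
    "\<And>m. m < n \<Longrightarrow> W (Suc m) = z \<cdot>\<^sub>v C m"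
    using chain_trajectory[OF G w] by blast
  obtain X D where X: "X 0 = w" "\<And>m. X m \<in> carrier_vec d" "\<And>m. D m \<in> carrier_vec d"
    "\<And>m. m < n \<Longrightarrow> Theta (a m) *\<^sub>v ((H m *\<^sub>v X m) @\<^sub>v D m) = X m @\<^sub>v (z \<cdot>\<^sub>v (H (Suc m) *\<^sub>v D m))"
    "\<And>m. m < n \<Longrightarrow> X (Suc m) = z \<cdot>\<^sub>v D m"
    using chain_trajectory[OF H w] by blast
  define V U where "V m = G m *\<^sub>v W m" and "U m = H m *\<^sub>v X m" for m
  have car: "G m \<in> carrier_mat d d" "H m \<in> carrier_mat d d" if "m \<le> n" for m
    using G H that by (auto simp: chain_def norm_bd_def)
  have VU: "V m \<in> carrier_vec d" "U m \<in> carrier_vec d" if "m \<le> n" for m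
    using car[OF that] W X by (auto simp: V_def U_def)
  have z1: "(cmod z)\<^sup>2 \<le> 1" using z by (simp add: abs_square_le_1)
  \<comment> \<open>By conservation of energy for the differences and |z| < 1, the discrepancy of
    the outputs minus that of the inputs never decreases along the chain. At the start the inputs
    agree.\<close>
  have mono: "nsq (V m - U m) - nsq (W m - X m) \<le> nsq (V (Suc m) - U (Suc m)) - nsq (W (Suc m) - X (Suc m))"
    if m: "m < n" for m
  proof -
    have V: "V (Suc m) = z \<cdot>\<^sub>v (G (Suc m) *\<^sub>v C m)" "U (Suc m) = z \<cdot>\<^sub>v (H (Suc m) *\<^sub>v D m)"
      unfolding V_def U_def W(5)[OF m] X(5)[OF m] using car[of "Suc m"] m W X by (auto intro!: mult_mat_vec)
    have "nsq (W m - X m) + nsq (V (Suc m) - U (Suc m)) = nsq (V m - U m) + nsq (C m - D m)"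
      using G m VU[of m] VU[of "Suc m"] W(4)[OF m] X(4)[OF m] W(2,3) X(2,3)
      by (intro Theta_diff_energy[of "a m" d]) (auto simp: chain_def V[symmetric] V_def[of m, symmetric] U_def[of m, symmetric])
    moreover have "W (Suc m) - X (Suc m) = z \<cdot>\<^sub>v (C m - D m)"
      unfolding W(5)[OF m] X(5)[OF m] using W X by (intro smult_diff_vec)
    then have "nsq (W (Suc m) - X (Suc m)) \<le> nsq (C m - D m)"
      using z1 by (simp add: nsq_smult mult_left_le_one_le)
    ultimately show ?thesis by linarith
  qed
  have "m \<le> n \<Longrightarrow> nsq (V 0 - U 0) \<le> nsq (V m - U m) - nsq (W m - X m)" for m
  proof (induct m)
    case 0
    have "w - w = 0\<^sub>v d" using w by auto
    then show ?case by (simp add: W X)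
  next
    case (Suc m)
    then show ?case using mono[of m] by simp
  qed
  from this[of n] have "nsq (V 0 - U 0) \<le> nsq (V n - U n)" using nsq_nonneg[of "W n - X n"] by linarith
  \<comment> \<open>At the far end the two outputs are estimated separately; the factor 4 in the
    bound is 2 + 2.\<close>
  also have "\<dots> \<le> 2 * nsq (V n) + 2 * nsq (U n)" using VU[of n] by (intro nsq_diff_le[of _ d]) auto
  also have "\<dots> \<le> 2 * (((cmod z)\<^sup>2) ^ n / (1 - (cmod z)\<^sup>2) * nsq w) + 2 * (((cmod z)\<^sup>2) ^ n / (1 - (cmod z)\<^sup>2) * nsq w)"
    using trajectory_decay[OF G z W(2-5)] trajectory_decay[OF H z X(2-5)] unfolding V_def U_def W(1) X(1)
    by (intro add_mono mult_left_mono) auto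
  finally show ?thesis by (simp add: V_def U_def W X mult_ac)
qed

lemma chain_compare_entry:
  assumes G: "chain d a z n G" and H: "chain d a z n H" and z: "cmod z < 1" and ij: "i < d" "j < d"
  shows "(cmod (G 0 $$ (i, j) - H 0 $$ (i, j)))\<^sup>2 \<le> 4 * (((cmod z)\<^sup>2) ^ n / (1 - (cmod z)\<^sup>2))"
proof -
  have car: "G 0 \<in> carrier_mat d d" "H 0 \<in> carrier_mat d d" using G H by (auto simp: chain_def norm_bd_def)
  have "G 0 $$ (i, j) - H 0 $$ (i, j) = (G 0 *\<^sub>v unit_vec d j - H 0 *\<^sub>v unit_vec d j) $ i"
    using car ij by (simp add: scalar_prod_right_unit)
  then have "(cmod (G 0 $$ (i, j) - H 0 $$ (i, j)))\<^sup>2 \<le> nsq (G 0 *\<^sub>v unit_vec d j - H 0 *\<^sub>v unit_vec d j)"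
    using entry_le_nsq[of i "G 0 *\<^sub>v unit_vec d j - H 0 *\<^sub>v unit_vec d j"] car ij by simp
  also have "\<dots> \<le> 4 * (((cmod z)\<^sup>2) ^ n / (1 - (cmod z)\<^sup>2))"
    using chain_compare[OF G H z, of "unit_vec d j"] ij by (simp add: nsq_unit_vec)
  finally show ?thesis .
qed

text \<open>The comparison holds for every length n, and its bound tends to 0.\<close>

lemma chain_unique:
  assumes G: "\<And>n. chain d a z n G" and H: "\<And>n. chain d a z n H" and z: "cmod z < 1"
  shows "G 0 = H 0"
proof -
  have car: "G 0 \<in> carrier_mat d d" "H 0 \<in> carrier_mat d d" using G[of 0] H[of 0] by (auto simp: chain_def norm_bd_def)
  show ?thesis
  proof (rule eq_matI)
    fix i j assume "i < dim_row (H 0)" "j < dim_col (H 0)"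
    then have ij: "i < d" "j < d" using car by auto
    have z2: "(cmod z)\<^sup>2 < 1" using z by (auto simp: abs_square_less_1)
    then have "(\<lambda>n. ((cmod z)\<^sup>2) ^ n) \<longlonglongrightarrow> 0" by (intro LIMSEQ_power_zero) simp
    then have "(\<lambda>n. 4 * (((cmod z)\<^sup>2) ^ n / (1 - (cmod z)\<^sup>2))) \<longlonglongrightarrow> 4 * (0 / (1 - (cmod z)\<^sup>2))"
      using z2 by (intro tendsto_intros) auto
    then have "(cmod (G 0 $$ (i, j) - H 0 $$ (i, j)))\<^sup>2 \<le> 0"
      using chain_compare_entry[OF G H z ij] by (intro LIMSEQ_le_const) auto
    then show "G 0 $$ (i, j) = H 0 $$ (i, j)" by simp
  qed (use car in auto)
qed

section \<open>Matrix Schur functions with prescribed parameters\<close>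

definition hol_mat :: "nat \<Rightarrow> (complex \<Rightarrow> complex mat) \<Rightarrow> bool" where
  "hol_mat d g \<longleftrightarrow> (\<forall>i<d. \<forall>j<d. (\<lambda>z. g z $$ (i, j)) holomorphic_on ball 0 1)"

lemma schur_fun_iff: "schur_fun d g \<longleftrightarrow> (\<forall>z\<in>ball 0 1. norm_bd d 1 (g z)) \<and> hol_mat d g"
  unfolding schur_fun_def hol_mat_def using opnorm_le_1_iff norm_bd_carrier by blast

lemma hol_mat_cong:
  assumes "hol_mat d g" "\<And>z. z \<in> ball 0 1 \<Longrightarrow> h z = g z"
  shows "hol_mat d h"
  unfolding hol_mat_def
proof (intro allI impI)
  fix i j assume "i < d" "j < d"
  then have "(\<lambda>z. g z $$ (i, j)) holomorphic_on ball 0 1" using assms(1) by (auto simp: hol_mat_def)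
  then show "(\<lambda>z. h z $$ (i, j)) holomorphic_on ball 0 1"
    by (rule holomorphic_transform) (simp add: assms(2))
qed

lemma schur_fun_cong:
  assumes "schur_fun d g" "\<And>z. z \<in> ball 0 1 \<Longrightarrow> h z = g z"
  shows "schur_fun d h"
  using assms hol_mat_cong[of d g h] by (simp add: schur_fun_iff)

lemma hol_mat_const: "hol_mat d (\<lambda>_. A)"
  by (simp add: hol_mat_def)

lemma hol_mat_mult:
  assumes "hol_mat d g" "hol_mat d h" "\<And>z. z \<in> ball 0 1 \<Longrightarrow> g z \<in> carrier_mat d d"
    "\<And>z. z \<in> ball 0 1 \<Longrightarrow> h z \<in> carrier_mat d d"
  shows "hol_mat d (\<lambda>z. g z * h z)"
  unfolding hol_mat_def
proof (intro allI impI)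
  fix i j assume ij: "i < d" "j < d"
  have "(\<lambda>z. \<Sum>l<d. g z $$ (i, l) * h z $$ (l, j)) holomorphic_on ball 0 1"
    using assms(1,2) ij by (intro holomorphic_intros) (auto simp: hol_mat_def)
  then show "(\<lambda>z. (g z * h z) $$ (i, j)) holomorphic_on ball 0 1"
    by (rule holomorphic_transform) (use assms(3,4) ij in \<open>simp add: mult_mat_index[of _ d d _ d]\<close>)
qed

lemma hol_mat_add:
  assumes "hol_mat d g" "hol_mat d h" "\<And>z. z \<in> ball 0 1 \<Longrightarrow> g z \<in> carrier_mat d d"
    "\<And>z. z \<in> ball 0 1 \<Longrightarrow> h z \<in> carrier_mat d d"
  shows "hol_mat d (\<lambda>z. g z + h z)"
  unfolding hol_mat_def
proof (intro allI impI)
  fix i j assume ij: "i < d" "j < d"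
  have "(\<lambda>z. g z $$ (i, j) + h z $$ (i, j)) holomorphic_on ball 0 1"
    using assms(1,2) ij by (intro holomorphic_intros) (auto simp: hol_mat_def)
  then show "(\<lambda>z. (g z + h z) $$ (i, j)) holomorphic_on ball 0 1"
  proof (rule holomorphic_transform)
    fix z :: complex assume "z \<in> ball 0 1"
    from assms(4)[OF this] show "g z $$ (i, j) + h z $$ (i, j) = (g z + h z) $$ (i, j)"
      using ij by simp
  qed
qed

lemma hol_mat_smult:
  assumes "hol_mat d g" "\<And>z. z \<in> ball 0 1 \<Longrightarrow> g z \<in> carrier_mat d d"
  shows "hol_mat d (\<lambda>z. z \<cdot>\<^sub>m g z)"
  unfolding hol_mat_def
proof (intro allI impI)
  fix i j assume ij: "i < d" "j < d"
  have "(\<lambda>z. z * g z $$ (i, j)) holomorphic_on ball 0 1"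
    using assms(1) ij by (intro holomorphic_intros) (auto simp: hol_mat_def)
  then show "(\<lambda>z. (z \<cdot>\<^sub>m g z) $$ (i, j)) holomorphic_on ball 0 1"
  proof (rule holomorphic_transform)
    fix z :: complex assume "z \<in> ball 0 1"
    from assms(2)[OF this] show "z * g z $$ (i, j) = (z \<cdot>\<^sub>m g z) $$ (i, j)"
      using ij by simp
  qed
qed

text \<open>The Leibniz formula is a polynomial in the entries.\<close>

lemma hol_det:
  assumes g: "hol_mat d g" and car: "\<And>z. z \<in> ball 0 1 \<Longrightarrow> g z \<in> carrier_mat d d"
  shows "(\<lambda>z. det (g z)) holomorphic_on ball 0 1"
proof -
  have "(\<lambda>z. \<Sum>p | p permutes {0..<d}. of_int (sign p) * (\<Prod>i = 0..<d. g z $$ (i, p i))) holomorphic_on ball 0 1"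
  proof (intro holomorphic_intros)
    fix p i assume "p \<in> {p. p permutes {0..<d}}" "i \<in> {0..<d}"
    then have "i < d" "p i < d" using permutes_in_image[of p "{0..<d}" i] by auto
    then show "(\<lambda>z. g z $$ (i, p i)) holomorphic_on ball 0 1" using g by (simp add: hol_mat_def)
  qed
  then show ?thesis
  proof (rule holomorphic_transform)
    fix z :: complex assume "z \<in> ball 0 1"
    from car[OF this]
    show "(\<Sum>p | p permutes {0..<d}. of_int (sign p) * (\<Prod>i = 0..<d. g z $$ (i, p i))) = det (g z)"
      by (auto simp: det_def)
  qed
qed

text \<open>Cramer's rule: an entry of the inverse is a signed minor divided by the
  determinant.\<close>

lemma hol_mat_minv:
  assumes g: "hol_mat d g" and car: "\<And>z. z \<in> ball 0 1 \<Longrightarrow> g z \<in> carrier_mat d d"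
    and det: "\<And>z. z \<in> ball 0 1 \<Longrightarrow> det (g z) \<noteq> 0"
  shows "hol_mat d (\<lambda>z. minv (g z))"
  unfolding hol_mat_def
proof (intro allI impI)
  fix i j assume ij: "i < d" "j < d"
  have "(\<lambda>z. det (mat_delete (g z) j i)) holomorphic_on ball 0 1"
  proof (rule hol_det[of "d - 1"])
    show "mat_delete (g z) j i \<in> carrier_mat (d - 1) (d - 1)" if "z \<in> ball 0 1" for z
      using car[OF that] by (auto simp: mat_delete_def)
    show "hol_mat (d - 1) (\<lambda>z. mat_delete (g z) j i)"
      unfolding hol_mat_def
    proof (intro allI impI)
      fix k l assume kl: "k < d - 1" "l < d - 1"
      let ?k = "if k < j then k else Suc k" and ?l = "if l < i then l else Suc l"
      have "(\<lambda>z. g z $$ (?k, ?l)) holomorphic_on ball 0 1"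
        using g kl by (auto simp: hol_mat_def)
      then show "(\<lambda>z. mat_delete (g z) j i $$ (k, l)) holomorphic_on ball 0 1"
      proof (rule holomorphic_transform)
        fix z :: complex assume "z \<in> ball 0 1"
        from car[OF this] show "g z $$ (?k, ?l) = mat_delete (g z) j i $$ (k, l)"
          using kl by (auto simp: mat_delete_def)
      qed
    qed
  qed
  then have "(\<lambda>z. (-1) ^ (j + i) * det (mat_delete (g z) j i) / det (g z)) holomorphic_on ball 0 1"
    using det by (intro holomorphic_intros hol_det[OF g car]) auto
  then show "(\<lambda>z. minv (g z) $$ (i, j)) holomorphic_on ball 0 1"
  proof (rule holomorphic_transform)
    fix z :: complex assume z: "z \<in> ball 0 1"
    note adj = adj_mat[OF car[OF z]]
    have "minv (g z) = (1 / det (g z)) \<cdot>\<^sub>m adj_mat (g z)"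
    proof (rule minv_eqI[OF car[OF z]])
      show "g z * ((1 / det (g z)) \<cdot>\<^sub>m adj_mat (g z)) = 1\<^sub>m d"
        unfolding mult_smult_distrib[OF car[OF z] adj(1)] adj(2) using det[OF z]
        by (intro eq_matI) simp_all
    qed (use adj(1) in simp)
    then show "(-1) ^ (j + i) * det (mat_delete (g z) j i) / det (g z) = minv (g z) $$ (i, j)"
      using adj(1) ij car[OF z] by (auto simp: adj_mat_def cofactor_def)
  qed
qed

lemma schur_fun_inv_step:
  assumes a: "a \<in> carrier_mat d d" "opnorm a < 1" and h: "schur_fun d h"
  shows "schur_fun d (\<lambda>z. inv_step d a z (h z))"
proof -
  note L = rhoL_props[OF a] and R = rhoR_props[OF a]
  have norm_bd: "norm_bd d 1 (h z)" if "z \<in> ball 0 1" for z using h that by (simp add: schur_fun_iff)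
  have hh: "hol_mat d h" using h by (simp add: schur_fun_iff)
  have hc: "h z \<in> carrier_mat d d" if "z \<in> ball 0 1" for z using norm_bd[OF that] by (simp add: norm_bd_def)
  have ah: "hol_mat d (\<lambda>z. mat_adjoint a * h z)" using a hc
    by (intro hol_mat_mult hol_mat_const hh) auto
  have N: "hol_mat d (\<lambda>z. 1\<^sub>m d + z \<cdot>\<^sub>m (mat_adjoint a * h z))" using a hc
    by (intro hol_mat_add hol_mat_const hol_mat_smult ah) (auto intro!: mult_carrier_mat[of _ d d _ d])
  note S = inv_step_props[OF a norm_bd]
  have "hol_mat d (\<lambda>z. minv (1\<^sub>m d + z \<cdot>\<^sub>m (mat_adjoint a * h z)))"
    using a hc S(3) by (intro hol_mat_minv N) (auto intro!: mult_carrier_mat[of _ d d _ d])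
  then have "hol_mat d (\<lambda>z. minv (rhoR a) * (a + z \<cdot>\<^sub>m h z) * (minv (1\<^sub>m d + z \<cdot>\<^sub>m (mat_adjoint a * h z)) * rhoL a))"
    using a hc L(1) R(4) S(4)
    by (intro hol_mat_mult hol_mat_add hol_mat_smult hh hol_mat_const)
      (auto intro!: mult_carrier_mat[of _ d d _ d] add_carrier_mat)
  then show ?thesis unfolding schur_fun_iff inv_step_def[symmetric] using S(2) by auto
qed

section \<open>Finite Schur approximants\<close>

lemma schur_fun_const: "norm_bd d 1 A \<Longrightarrow> schur_fun d (\<lambda>_. A)"
  by (simp add: schur_fun_iff hol_mat_const)

text \<open>k backward steps through the parameters a m, ..., a (m + k - 1), starting from the
  constant e. The choice e = 1 gives the functions with finitely many parameters, e = 0 the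
  approximants for infinite sequences.\<close>

primrec schur_apx :: "nat \<Rightarrow> complex mat \<Rightarrow> (nat \<Rightarrow> complex mat) \<Rightarrow> nat \<Rightarrow> nat \<Rightarrow> complex \<Rightarrow> complex mat" where
  "schur_apx d e a 0 m z = e"
| "schur_apx d e a (Suc k) m z = inv_step d (a m) z (schur_apx d e a k (Suc m) z)"

lemma schur_apx_schur_fun:
  assumes e: "norm_bd d 1 e" and a: "\<And>i. m \<le> i \<Longrightarrow> i < m + k \<Longrightarrow> a i \<in> carrier_mat d d \<and> opnorm (a i) < 1"
  shows "schur_fun d (schur_apx d e a k m)"
  using a
proof (induct k arbitrary: m)
  case 0
  have "schur_apx d e a 0 m = (\<lambda>_. e)" by (simp add: fun_eq_iff)
  then show ?case using schur_fun_const[OF e] by simp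
next
  case (Suc k)
  have "schur_fun d (\<lambda>z. inv_step d (a m) z (schur_apx d e a k (Suc m) z))"
    using Suc.prems[of m] by (intro schur_fun_inv_step Suc.hyps Suc.prems) auto
  then show ?case by simp
qed

lemma schur_apx_nb:
  assumes "norm_bd d 1 e" "\<And>i. m \<le> i \<Longrightarrow> i < m + k \<Longrightarrow> a i \<in> carrier_mat d d \<and> opnorm (a i) < 1" "cmod z < 1"
  shows "norm_bd d 1 (schur_apx d e a k m z)"
  using schur_apx_schur_fun[OF assms(1,2)] assms(3) by (simp add: schur_fun_iff)

lemma schur_apx_chain:
  assumes e: "norm_bd d 1 e" and a: "\<And>i. m \<le> i \<Longrightarrow> i < m + k \<Longrightarrow> a i \<in> carrier_mat d d \<and> opnorm (a i) < 1"
    and z: "cmod z < 1" and n: "n \<le> k"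
  shows "chain d (\<lambda>i. a (m + i)) z n (\<lambda>i. schur_apx d e a (k - i) (m + i) z)"
  unfolding chain_def
proof (intro conjI allI impI)
  fix i assume i: "i < n"
  then show "a (m + i) \<in> carrier_mat d d" "opnorm (a (m + i)) < 1" using a[of "m + i"] n by auto
  then show "schur_link d (a (m + i)) z (schur_apx d e a (k - i) (m + i) z) (schur_apx d e a (k - Suc i) (m + Suc i) z)"
    using i n Suc_diff_Suc[of i k] z inv_step_props(1)[of "a (m + i)" d "schur_apx d e a (k - Suc i) (Suc (m + i)) z" z]
      schur_apx_nb[OF e, of "Suc (m + i)" "k - Suc i" a z] a by (auto simp flip: Suc_diff_Suc)
next
  fix i assume "i \<le> n"
  then show "norm_bd d 1 (schur_apx d e a (k - i) (m + i) z)" using n a by (intro schur_apx_nb e z) auto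
qed


text \<open>Two approximants of depth at least n have their first n parameters in common, which is
  all that the comparison of chains looks at.\<close>

lemma schur_apx_diff_entry:
  assumes e: "norm_bd d 1 e" and a: "\<And>i. m \<le> i \<Longrightarrow> a i \<in> carrier_mat d d \<and> opnorm (a i) < 1"
    and z: "cmod z < 1" and k: "n \<le> k" "n \<le> l" and ij: "i < d" "j < d"
  shows "(cmod (schur_apx d e a k m z $$ (i, j) - schur_apx d e a l m z $$ (i, j)))\<^sup>2 \<le> 4 * (((cmod z)\<^sup>2) ^ n / (1 - (cmod z)\<^sup>2))"
  using chain_compare_entry[OF schur_apx_chain[OF e _ z k(1), of m a] schur_apx_chain[OF e _ z k(2), of m a] z ij] a
  by simp

lemma schur_apx_uniformly_Cauchy:
  assumes e: "norm_bd d 1 e" and a: "\<And>i. m \<le> i \<Longrightarrow> a i \<in> carrier_mat d d \<and> opnorm (a i) < 1"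
    and r: "0 \<le> r" "r < 1" and ij: "i < d" "j < d"
  shows "uniformly_Cauchy_on (cball 0 r) (\<lambda>k z. schur_apx d e a k m z $$ (i, j))"
proof (rule uniformly_Cauchy_onI)
  fix \<epsilon> :: real assume \<epsilon>: "\<epsilon> > 0"
  have r2: "0 \<le> r\<^sup>2" "r\<^sup>2 < 1" using r by (auto simp: abs_square_less_1)
  have "(\<lambda>n. (r\<^sup>2) ^ n) \<longlonglongrightarrow> 0" using r2 by (intro LIMSEQ_power_zero) simp
  then have "(\<lambda>n. 4 * ((r\<^sup>2) ^ n / (1 - r\<^sup>2))) \<longlonglongrightarrow> 4 * (0 / (1 - r\<^sup>2))"
    using r2 by (intro tendsto_intros) auto
  then have "\<forall>\<^sub>F n in sequentially. 4 * ((r\<^sup>2) ^ n / (1 - r\<^sup>2)) < \<epsilon>\<^sup>2"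
    using \<epsilon> by (intro order_tendstoD) auto
  \<comment> \<open>The bound involves z only through |z| <= r, so a single n works on the whole
    closed disc.\<close>
  then obtain n where n: "4 * ((r\<^sup>2) ^ n / (1 - r\<^sup>2)) < \<epsilon>\<^sup>2"
    unfolding eventually_sequentially by blast
  have "dist (schur_apx d e a k m z $$ (i, j)) (schur_apx d e a l m z $$ (i, j)) < \<epsilon>"
    if "z \<in> cball 0 r" "n \<le> k" "n \<le> l" for z k l
  proof -
    have z: "cmod z \<le> r" "cmod z < 1" using that r by auto
    have z2: "(cmod z)\<^sup>2 \<le> r\<^sup>2" using z by (intro power_mono) auto
    have "(cmod (schur_apx d e a k m z $$ (i, j) - schur_apx d e a l m z $$ (i, j)))\<^sup>2 \<le> 4 * (((cmod z)\<^sup>2) ^ n / (1 - (cmod z)\<^sup>2))"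
      by (rule schur_apx_diff_entry[OF e a z(2) that(2,3) ij])
    also have "\<dots> \<le> 4 * ((r\<^sup>2) ^ n / (1 - r\<^sup>2))"
      using z2 r2 z r by (intro mult_left_mono frac_le power_mono) auto
    also have "\<dots> < \<epsilon>\<^sup>2" by (rule n)
    finally show ?thesis using \<epsilon> by (simp add: dist_norm power2_less_imp_less)
  qed
  then show "\<exists>M. \<forall>x\<in>cball 0 r. \<forall>k\<ge>M. \<forall>l\<ge>M. dist (schur_apx d e a k m x $$ (i, j)) (schur_apx d e a l m x $$ (i, j)) < \<epsilon>"
    by blast
qed

text \<open>Here m is the position in the parameter sequence, so consecutive m give consecutive
  Schur iterates.\<close>

definition schur_lim :: "nat \<Rightarrow> (nat \<Rightarrow> complex mat) \<Rightarrow> nat \<Rightarrow> complex \<Rightarrow> complex mat" where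
  "schur_lim d a m z = mat d d (\<lambda>(i, j). lim (\<lambda>k. schur_apx d (0\<^sub>m d d) a k m z $$ (i, j)))"

lemma norm_bd_zero: "0 \<le> c \<Longrightarrow> norm_bd d c (0\<^sub>m d d)"
proof -
  assume "0 \<le> c"
  moreover have "0\<^sub>m d d *\<^sub>v v = 0\<^sub>v d" if "v \<in> carrier_vec d" for v :: "complex vec"
    using that by (intro eq_vecI) auto
  ultimately show ?thesis by (simp add: norm_bd_def)
qed

section \<open>The Schur function of an infinite parameter sequence\<close>

context
  fixes d :: nat and a :: "nat \<Rightarrow> complex mat"
  assumes a: "\<And>i. a i \<in> carrier_mat d d \<and> opnorm (a i) < 1"
begin

lemma schur_lim_uniform:
  assumes r: "0 \<le> r" "r < 1" and ij: "i < d" "j < d"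
  shows "uniform_limit (cball 0 r) (\<lambda>k z. schur_apx d (0\<^sub>m d d) a k m z $$ (i, j)) (\<lambda>z. schur_lim d a m z $$ (i, j)) sequentially"
proof -
  have "uniformly_convergent_on (cball 0 r) (\<lambda>k z. schur_apx d (0\<^sub>m d d) a k m z $$ (i, j))"
    by (intro Cauchy_uniformly_convergent schur_apx_uniformly_Cauchy) (use a r ij in \<open>auto intro: norm_bd_zero\<close>)
  then show ?thesis using ij by (simp add: uniformly_convergent_uniform_limit_iff schur_lim_def)
qed

lemma schur_lim_tendsto:
  assumes z: "cmod z < 1" and ij: "i < d" "j < d"
  shows "(\<lambda>k. schur_apx d (0\<^sub>m d d) a k m z $$ (i, j)) \<longlonglongrightarrow> schur_lim d a m z $$ (i, j)"
  by (rule tendsto_uniform_limitI[OF schur_lim_uniform[of "cmod z"]]) (use z ij in auto)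

lemma schur_lim_carrier: "schur_lim d a m z \<in> carrier_mat d d"
  by (simp add: schur_lim_def)

lemma schur_lim_nb:
  assumes z: "cmod z < 1"
  shows "norm_bd d 1 (schur_lim d a m z)"
proof -
  have nbk: "norm_bd d 1 (schur_apx d (0\<^sub>m d d) a k m z)" for k
    using a z by (intro schur_apx_nb norm_bd_zero) auto
  have "nsq (schur_lim d a m z *\<^sub>v v) \<le> 1 * nsq v" if v: "v \<in> carrier_vec d" for v
  proof -
    have *: "nsq (A *\<^sub>v v) = (\<Sum>i<d. (cmod (\<Sum>j<d. A $$ (i, j) * v $ j))\<^sup>2)" if "A \<in> carrier_mat d d" for A
      using that v by (auto simp: nsq_def scalar_prod_def atLeast0LessThan intro!: sum.cong)
    have "(\<lambda>k. nsq (schur_apx d (0\<^sub>m d d) a k m z *\<^sub>v v)) \<longlonglongrightarrow> nsq (schur_lim d a m z *\<^sub>v v)"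
      unfolding *[OF norm_bd_carrier[OF nbk]] *[OF schur_lim_carrier]
      by (intro tendsto_intros schur_lim_tendsto[OF z]) auto
    then show ?thesis by (rule LIMSEQ_le_const2) (use norm_bd_vec[OF nbk v] in auto)
  qed
  then show ?thesis by (simp add: norm_bd_def schur_lim_carrier)
qed

lemma schur_lim_schur_fun: "schur_fun d (schur_lim d a m)"
  unfolding schur_fun_iff hol_mat_def
proof (intro conjI ballI allI impI)
  fix i j assume ij: "i < d" "j < d"
  show "(\<lambda>z. schur_lim d a m z $$ (i, j)) holomorphic_on ball 0 1"
  proof (rule holomorphic_uniform_sequence[OF open_ball])
    show "(\<lambda>z. schur_apx d (0\<^sub>m d d) a k m z $$ (i, j)) holomorphic_on ball 0 1" for k
      using schur_apx_schur_fun[of d "0\<^sub>m d d" m k a] a norm_bd_zero[of 1 d] ij by (auto simp: schur_fun_iff hol_mat_def)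
    fix x :: complex assume x: "x \<in> ball 0 1"
    \<comment> \<open>Half the distance to the unit circle: the closed disc around x then lies in a
      centred disc of radius below 1, where convergence is uniform.\<close>
    define \<delta> where "\<delta> = (1 - cmod x) / 2"
    have \<delta>: "\<delta> > 0" "cmod x + \<delta> < 1" using x by (auto simp: \<delta>_def field_simps)
    have sub: "cball x \<delta> \<subseteq> cball 0 (cmod x + \<delta>)"
    proof
      fix y assume "y \<in> cball x \<delta>"
      then show "y \<in> cball 0 (cmod x + \<delta>)"
        using norm_triangle_ineq[of x "y - x"] by (simp add: dist_norm norm_minus_commute)
    qed
    have "uniform_limit (cball x \<delta>) (\<lambda>k z. schur_apx d (0\<^sub>m d d) a k m z $$ (i, j)) (\<lambda>z. schur_lim d a m z $$ (i, j)) sequentially"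
      by (rule uniform_limit_on_subset[OF schur_lim_uniform sub]) (use \<delta> ij in auto)
    moreover have "cball x \<delta> \<subseteq> ball 0 1" using sub \<delta> by auto
    ultimately show "\<exists>da>0. cball x da \<subseteq> ball 0 1 \<and>
       uniform_limit (cball x da) (\<lambda>k z. schur_apx d (0\<^sub>m d d) a k m z $$ (i, j)) (\<lambda>z. schur_lim d a m z $$ (i, j)) sequentially"
      using \<delta> by blast
  qed
qed (use schur_lim_nb in auto)

text \<open>Every approximant of depth at least 1 already takes the value \<open>a m\<close> at
  0.\<close>

lemma schur_lim_0: "schur_lim d a m 0 = a m"
proof (rule eq_matI)
  fix i j assume "i < dim_row (a m)" "j < dim_col (a m)"
  then have ij: "i < d" "j < d" using a[of m] by auto
  have "(\<lambda>k. schur_apx d (0\<^sub>m d d) a (Suc k) m 0 $$ (i, j)) \<longlonglongrightarrow> schur_lim d a m 0 $$ (i, j)"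
    using schur_lim_tendsto[of 0 i j m] ij by (intro LIMSEQ_Suc) auto
  moreover have "schur_apx d (0\<^sub>m d d) a (Suc k) m 0 = a m" for k
    using a[of m] schur_apx_nb[of d "0\<^sub>m d d" "Suc m" k a 0] a norm_bd_zero[of 1 d]
    by (simp add: inv_step_props(6)[of "a m" d _ 0])
  ultimately have "(\<lambda>k. a m $$ (i, j)) \<longlonglongrightarrow> schur_lim d a m 0 $$ (i, j)" by simp
  then show "schur_lim d a m 0 $$ (i, j) = a m $$ (i, j)" by (rule LIMSEQ_unique) simp
qed (use a[of m] in \<open>auto simp: schur_lim_def\<close>)

text \<open>The existential form of a link is awkward under limits; the equivalent matrix identity
  of \<open>schur_link_iff\<close> is polynomial in the entries of both iterates and passes to the
  limit.\<close>

lemma schur_lim_link: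
  assumes z: "cmod z < 1"
  shows "schur_link d (a m) z (schur_lim d a m z) (schur_lim d a (Suc m) z)"
proof -
  have am: "a m \<in> carrier_mat d d" "opnorm (a m) < 1" using a[of m] by auto
  note L = rhoL_props[OF am] and R = rhoR_props[OF am]
  have nbk: "norm_bd d 1 (schur_apx d (0\<^sub>m d d) a k l z)" for k l
    using a z by (intro schur_apx_nb norm_bd_zero) auto
  note carA = norm_bd_carrier[OF nbk]
  let ?g = "\<lambda>k. schur_apx d (0\<^sub>m d d) a (Suc k) m z" and ?g' = "\<lambda>k. schur_apx d (0\<^sub>m d d) a k (Suc m) z"
  let ?iL = "minv (rhoL (a m))" and ?iR = "minv (rhoR (a m))"
  have "schur_link d (a m) z (?g k) (?g' k)" for k
    using inv_step_props(1)[OF am nbk z] by simp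
  then have eq: "(z \<cdot>\<^sub>m ?g' k) * (?iL * (1\<^sub>m d - mat_adjoint (a m) * ?g k)) = ?iR * (?g k - a m)" for k
    using schur_link_iff[OF am carA carA] by blast
  \<comment> \<open>Both sides are spelled out as finite sums of entries so that the limit rules
    apply.\<close>
  have idxl: "((z \<cdot>\<^sub>m H) * (?iL * (1\<^sub>m d - mat_adjoint (a m) * G))) $$ (i, j) =
      (\<Sum>p<d. z * H $$ (i, p) * (\<Sum>q<d. ?iL $$ (p, q) * (1\<^sub>m d $$ (q, j) - (\<Sum>r<d. mat_adjoint (a m) $$ (q, r) * G $$ (r, j)))))"
    if "i < d" "j < d" "H \<in> carrier_mat d d" "G \<in> carrier_mat d d" for H G i j
  proof -
    have M: "1\<^sub>m d - mat_adjoint (a m) * G \<in> carrier_mat d d" "mat_adjoint (a m) \<in> carrier_mat d d"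
      using that am by auto
    have e1: "(1\<^sub>m d - mat_adjoint (a m) * G) $$ (q, j) = 1\<^sub>m d $$ (q, j) - (\<Sum>r<d. mat_adjoint (a m) $$ (q, r) * G $$ (r, j))"
      if "q < d" for q
      using that \<open>j < d\<close> M(2) \<open>G \<in> carrier_mat d d\<close> am
      by (subst mult_mat_index[symmetric, of _ d d _ d]) auto
    have e2: "(?iL * (1\<^sub>m d - mat_adjoint (a m) * G)) $$ (p, j) = (\<Sum>q<d. ?iL $$ (p, q) * (1\<^sub>m d $$ (q, j) - (\<Sum>r<d. mat_adjoint (a m) $$ (q, r) * G $$ (r, j))))"
      if "p < d" for p
      unfolding mult_mat_index[OF L(4) M(1) that \<open>j < d\<close>] by (intro sum.cong refl) (simp add: e1)
    have zH: "z \<cdot>\<^sub>m H \<in> carrier_mat d d" using that by simp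
    have LM: "?iL * (1\<^sub>m d - mat_adjoint (a m) * G) \<in> carrier_mat d d" using L(4) M by auto
    show ?thesis unfolding mult_mat_index[OF zH LM that(1,2)]
      by (intro sum.cong refl) (use that in \<open>simp add: e2\<close>)
  qed
  have idxr: "(?iR * (G - a m)) $$ (i, j) = (\<Sum>p<d. ?iR $$ (i, p) * (G $$ (p, j) - a m $$ (p, j)))"
    if "i < d" "j < d" "G \<in> carrier_mat d d" for G i j
  proof -
    have "G - a m \<in> carrier_mat d d" using that am by auto
    from mult_mat_index[OF R(4) this that(1,2)] show ?thesis using that am by simp
  qed
  have "(z \<cdot>\<^sub>m schur_lim d a (Suc m) z) * (?iL * (1\<^sub>m d - mat_adjoint (a m) * schur_lim d a m z)) = ?iR * (schur_lim d a m z - a m)"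
  proof (rule eq_matI)
    fix i j assume "i < dim_row (?iR * (schur_lim d a m z - a m))" "j < dim_col (?iR * (schur_lim d a m z - a m))"
    then have ij: "i < d" "j < d" using am R(4) by auto
    \<comment> \<open>The approximant of depth k + 1 at m is linked to the one of depth k at m + 1,
      hence the shifted sequence.\<close>
    note limg = LIMSEQ_Suc[OF schur_lim_tendsto[OF z]] and limg' = schur_lim_tendsto[OF z]
    have "(\<lambda>k. ((z \<cdot>\<^sub>m ?g' k) * (?iL * (1\<^sub>m d - mat_adjoint (a m) * ?g k))) $$ (i, j)) \<longlonglongrightarrow>
       ((z \<cdot>\<^sub>m schur_lim d a (Suc m) z) * (?iL * (1\<^sub>m d - mat_adjoint (a m) * schur_lim d a m z))) $$ (i, j)"
      unfolding idxl[OF ij carA carA] idxl[OF ij schur_lim_carrier schur_lim_carrier]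
      by (intro tendsto_intros limg limg') (use ij in auto)
    moreover have "(\<lambda>k. (?iR * (?g k - a m)) $$ (i, j)) \<longlonglongrightarrow> (?iR * (schur_lim d a m z - a m)) $$ (i, j)"
      unfolding idxr[OF ij carA] idxr[OF ij schur_lim_carrier]
      by (intro tendsto_intros limg) (use ij in auto)
    ultimately show "((z \<cdot>\<^sub>m schur_lim d a (Suc m) z) * (?iL * (1\<^sub>m d - mat_adjoint (a m) * schur_lim d a m z))) $$ (i, j) =
       (?iR * (schur_lim d a m z - a m)) $$ (i, j)"
      unfolding eq by (rule LIMSEQ_unique)
  qed (use am R(4) schur_lim_carrier in auto)
  then show ?thesis unfolding schur_link_iff[OF am schur_lim_carrier schur_lim_carrier] .
qed

text \<open>Evaluates the definite description: the limit function has the required parameters, and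
  any competitor yields chains of every length at each point of the punctured disc, where
  \<open>chain_unique\<close> applies.\<close>

lemma schur_of_inf_chain:
  assumes z: "z \<in> ball 0 1 - {0}"
  shows "\<exists>G. G 0 = schur_of_inf d a z \<and> (\<forall>n. chain d a z n G)"
proof -
  \<comment> \<open>\<open>schur_of_inf\<close> fixes the value 0 outside the disc, which makes the
    function unique as a total one.\<close>
  define F where "F m z = (if z \<in> ball 0 1 then schur_lim d a m z else 0\<^sub>m d d)" for m z
  have F: "schur_fun d (F m)" for m
    by (rule schur_fun_cong[OF schur_lim_schur_fun[of m]]) (simp add: F_def)
  have Fa: "F m 0 = a m" for m
    by (simp add: F_def schur_lim_0)
  have Fstep: "F (Suc m) z = schur_step (a m) (F m) z" if "z \<in> ball 0 1 - {0}" for m z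
  proof -
    have nbF: "norm_bd d 1 (F l z)" for l using F that by (simp add: schur_fun_iff)
    have "schur_link d (a m) z (F m z) (F (Suc m) z)" using schur_lim_link[of z m] that by (simp add: F_def)
    then show ?thesis using schur_step_iff_link[of "a m" d "F m" z "F (Suc m) z"] a nbF norm_bd_carrier[OF nbF] that by auto
  qed
  have P: "(\<forall>z. z \<notin> ball 0 1 \<longrightarrow> F 0 z = 0\<^sub>m d d) \<and> schur_fun d (F 0) \<and> has_schur_params_inf d (F 0) a"
    using F Fstep a unfolding has_schur_params_inf_def
    by (auto simp: F_def schur_lim_0 intro!: exI[of _ F])
  have chainG: "chain d a z n (\<lambda>m. G m z)" if "z \<in> ball 0 1 - {0}"
     "\<forall>m. schur_fun d (G m) \<and> a m = G m 0 \<and> opnorm (a m) < 1 \<and> (\<forall>z\<in>ball 0 1 - {0}. G (Suc m) z = schur_step (a m) (G m) z)"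
   for G n z
  proof -
    have nbG: "norm_bd d 1 (G m z)" for m using that by (auto simp: schur_fun_iff)
    have "schur_link d (a m) z (G m z) (G (Suc m) z)" for m
      using schur_step_iff_link[of "a m" d "G m" z "G (Suc m) z"] a nbG norm_bd_carrier[OF nbG] that by auto
    then show ?thesis using a nbG by (simp add: chain_def)
  qed
  have "schur_of_inf d a = F 0"
    unfolding schur_of_inf_def
  proof (rule the_equality)
    show "(\<forall>z. z \<notin> ball 0 1 \<longrightarrow> F 0 z = 0\<^sub>m d d) \<and> schur_fun d (F 0) \<and> has_schur_params_inf d (F 0) a" by (rule P)
    fix g assume g: "(\<forall>z. z \<notin> ball 0 1 \<longrightarrow> g z = 0\<^sub>m d d) \<and> schur_fun d g \<and> has_schur_params_inf d g a"
    then obtain G where G: "G 0 = g"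
     "\<forall>m. schur_fun d (G m) \<and> a m = G m 0 \<and> opnorm (a m) < 1 \<and> (\<forall>z\<in>ball 0 1 - {0}. G (Suc m) z = schur_step (a m) (G m) z)"
      unfolding has_schur_params_inf_def by blast
    show "g = F 0"
    proof
      fix z :: complex
      consider "z \<notin> ball 0 1" | "z = 0" | "z \<in> ball 0 1 - {0}" by blast
      then show "g z = F 0 z"
      proof cases
        case 1 then show ?thesis using g by (simp add: F_def)
      next
        \<comment> \<open>At 0 the Schur step gives no information; the value there is the first
          parameter.\<close>
        case 2 then show ?thesis using G schur_lim_0[of 0] by (auto simp: F_def)
      next
        case 3
        have "chain d a z n (\<lambda>m. F m z)" for n
          by (rule chainG[OF 3]) (use F Fstep a in \<open>auto simp: Fa\<close>)
        then show ?thesis using chain_unique[of d a z "\<lambda>m. G m z" "\<lambda>m. F m z"] chainG[OF 3 G(2)] 3 G(1) by auto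
      qed
    qed
  qed
  moreover have "chain d a z n (\<lambda>m. F m z)" for n
    by (rule chainG[OF z]) (use F Fstep a in \<open>auto simp: Fa\<close>)
  ultimately show ?thesis by (intro exI[of _ "\<lambda>m. F m z"]) auto
qed

end


text \<open>For two candidates g and h with the same g' and the same w, the energy identity leaves
  |g w - h w|^2 = |z g' (c - c')|^2 - |c - c'|^2, which is at most 0. Thus a link can be solved
  uniquely for its left member.\<close>

lemma schur_link_determines:
  assumes a: "a \<in> carrier_mat d d" "opnorm a < 1" and g: "g \<in> carrier_mat d d" "h \<in> carrier_mat d d"
    and g': "norm_bd d 1 g'" and z: "cmod z < 1" and lk: "schur_link d a z g g'" "schur_link d a z h g'"
  shows "g = h"
proof (rule mat_eq_vecI[OF g])
  fix w :: "complex vec" assume w: "w \<in> carrier_vec d"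
  obtain c where c: "c \<in> carrier_vec d" "Theta a *\<^sub>v ((g *\<^sub>v w) @\<^sub>v c) = w @\<^sub>v (z \<cdot>\<^sub>v (g' *\<^sub>v c))"
    using lk(1) w by (auto simp: schur_link_def)
  obtain c' where c': "c' \<in> carrier_vec d" "Theta a *\<^sub>v ((h *\<^sub>v w) @\<^sub>v c') = w @\<^sub>v (z \<cdot>\<^sub>v (g' *\<^sub>v c'))"
    using lk(2) w by (auto simp: schur_link_def)
  have g'c: "g' \<in> carrier_mat d d" using g' by (simp add: norm_bd_def)
  have gw: "g *\<^sub>v w \<in> carrier_vec d" "h *\<^sub>v w \<in> carrier_vec d" "g' *\<^sub>v c \<in> carrier_vec d" "g' *\<^sub>v c' \<in> carrier_vec d"
    using g g'c w c c' by (auto intro: mult_mat_vec_carrier)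
  have z1: "(cmod z)\<^sup>2 \<le> 1" using z by (simp add: abs_square_le_1)
  have "nsq (w - w) + nsq (z \<cdot>\<^sub>v (g' *\<^sub>v c) - z \<cdot>\<^sub>v (g' *\<^sub>v c')) = nsq (g *\<^sub>v w - h *\<^sub>v w) + nsq (c - c')"
    by (intro Theta_diff_energy[OF a]) (use gw w c c' in auto)
  moreover have "w - w = 0\<^sub>v d" using w by auto
  moreover have "z \<cdot>\<^sub>v (g' *\<^sub>v c) - z \<cdot>\<^sub>v (g' *\<^sub>v c') = z \<cdot>\<^sub>v (g' *\<^sub>v (c - c'))"
    using gw g'c c c' by (simp add: smult_diff_vec[of _ d] mult_minus_distrib_mat_vec[of _ d d])
  moreover have "nsq (z \<cdot>\<^sub>v (g' *\<^sub>v (c - c'))) \<le> 1 * nsq (c - c')"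
    unfolding nsq_smult using z1 norm_bd_vec[OF g', of "c - c'"] c c' by (intro mult_mono) auto
  ultimately have "nsq (g *\<^sub>v w - h *\<^sub>v w) \<le> 0" by simp
  then have "nsq (g *\<^sub>v w - h *\<^sub>v w) = 0" using nsq_nonneg[of "g *\<^sub>v w - h *\<^sub>v w"] by linarith
  then have 0: "g *\<^sub>v w - h *\<^sub>v w = 0\<^sub>v d" by (intro nsq_eq_0) (use gw in auto)
  show "g *\<^sub>v w = h *\<^sub>v w"
  proof (rule eq_vecI)
    fix i assume "i < dim_vec (h *\<^sub>v w)"
    then show "(g *\<^sub>v w) $ i = (h *\<^sub>v w) $ i"
      using arg_cong[OF 0, of "\<lambda>v. v $ i"] gw g by (simp del: index_mult_mat_vec)
  qed (use g in auto)
qed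

text \<open>The finite algorithm prescribes its last iterate at the origin only. The diagonal
  entries attain their maximal modulus 1 there, so they are constant; a column of norm at most 1
  with diagonal entry 1 has no room for other entries.\<close>

lemma schur_fun_eq_one:
  assumes g: "schur_fun d g" and g0: "g 0 = 1\<^sub>m d" and z: "z \<in> ball 0 1"
  shows "g z = 1\<^sub>m d"
proof -
  have norm_bd: "norm_bd d 1 (g w)" if "w \<in> ball 0 1" for w using g that by (simp add: schur_fun_iff)
  have gc: "g z \<in> carrier_mat d d" using norm_bd[OF z] by (simp add: norm_bd_def)
  have diag: "g z $$ (j, j) = 1" if j: "j < d" for j
  proof -
    have "(\<lambda>z. g z $$ (j, j)) constant_on ball 0 1"
    proof (rule maximum_modulus_principle[where U = "ball 0 1" and \<xi> = 0])
      show "(\<lambda>z. g z $$ (j, j)) holomorphic_on ball 0 1" using g j by (simp add: schur_fun_iff hol_mat_def)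
      show "cmod (g w $$ (j, j)) \<le> cmod (g 0 $$ (j, j))" if "w \<in> ball 0 1" for w
        using norm_bd_entry[OF norm_bd[OF that] j j] j by (simp add: g0 abs_square_le_1)
    qed auto
    then obtain c where "\<And>w. w \<in> ball 0 1 \<Longrightarrow> g w $$ (j, j) = c" by (auto simp: constant_on_def)
    from this[OF z] this[of 0] show ?thesis using j by (simp add: g0)
  qed
  have off: "g z $$ (i, j) = 0" if ij: "i < d" "j < d" "i \<noteq> j" for i j
  proof -
    let ?v = "g z *\<^sub>v unit_vec d j"
    have v: "?v $ k = g z $$ (k, j)" if "k < d" for k
      using gc that ij by (simp add: scalar_prod_right_unit)
    have "(\<Sum>k\<in>{i, j}. (cmod (?v $ k))\<^sup>2) \<le> nsq ?v"
      unfolding nsq_def using gc ij by (intro sum_mono2) auto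
    also have "\<dots> \<le> 1" using norm_bd_vec[OF norm_bd[OF z], of "unit_vec d j"] ij by (simp add: nsq_unit_vec)
    finally show ?thesis using ij diag[of j] by (simp add: v)
  qed
  show ?thesis using gc diag off by (intro eq_matI) auto
qed

text \<open>Existence by running the algorithm backwards from 1; uniqueness by descending from the
  last iterate, which is constantly 1, since each link determines its left member.\<close>

lemma schur_of_fin_chain:
  assumes a: "\<And>i. i < M \<Longrightarrow> a i \<in> carrier_mat d d \<and> opnorm (a i) < 1"
    and z: "z \<in> ball 0 1 - {0}"
  shows "\<exists>G. G 0 = schur_of_fin d M a z \<and> chain d a z M G \<and> G M = 1\<^sub>m d"
proof -
  define F where "F m z = (if z \<in> ball 0 1 then schur_apx d (1\<^sub>m d) a (M - m) m z else 0\<^sub>m d d)" for m z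
  have Fs: "schur_fun d (F m)" if "m \<le> M" for m
    by (rule schur_fun_cong[OF schur_apx_schur_fun[OF norm_bd_one, of m "M - m" a]]) (use a that in \<open>auto simp: F_def\<close>)
  have FM: "F M z = 1\<^sub>m d" if "z \<in> ball 0 1" for z using that by (simp add: F_def)
  have chF: "chain d a z M (\<lambda>m. F m z)" if "z \<in> ball 0 1" for z
    using schur_apx_chain[OF norm_bd_one, of 0 M a d z M] a that by (simp add: F_def)
  have Fstep: "F (Suc m) z = schur_step (a m) (F m) z" if "z \<in> ball 0 1 - {0}" "m < M" for m z
    using chF[of z] that schur_step_iff_link[of "a m" d "F m" z "F (Suc m) z"] a[of m] norm_bd_carrier[of d 1 "F (Suc m) z"]
    by (auto simp: chain_def)
  have F0: "a m = F m 0" if "m < M" for m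
    using that a[of m] inv_step_props(6)[of "a m" d "schur_apx d (1\<^sub>m d) a (M - Suc m) (Suc m) 0" 0]
      schur_apx_nb[OF norm_bd_one[of d], of "Suc m" "M - Suc m" a 0] a
    by (simp add: F_def flip: Suc_diff_Suc)
  have P: "(\<forall>z. z \<notin> ball 0 1 \<longrightarrow> F 0 z = 0\<^sub>m d d) \<and> schur_fun d (F 0) \<and> has_schur_params_fin d (F 0) M a"
    using Fs Fstep a F0 FM[of 0] unfolding has_schur_params_fin_def
    by (auto simp: F_def[of 0] intro!: exI[of _ F])
  have "schur_of_fin d M a = F 0"
    unfolding schur_of_fin_def
  proof (rule the_equality)
    show "(\<forall>z. z \<notin> ball 0 1 \<longrightarrow> F 0 z = 0\<^sub>m d d) \<and> schur_fun d (F 0) \<and> has_schur_params_fin d (F 0) M a" by (rule P)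
    fix g assume g: "(\<forall>z. z \<notin> ball 0 1 \<longrightarrow> g z = 0\<^sub>m d d) \<and> schur_fun d g \<and> has_schur_params_fin d g M a"
    then obtain G where G: "G 0 = g" "\<forall>m\<le>M. schur_fun d (G m)"
     "\<forall>m<M. a m = G m 0 \<and> opnorm (a m) < 1 \<and> (\<forall>z\<in>ball 0 1 - {0}. G (Suc m) z = schur_step (a m) (G m) z)"
     "G M 0 = 1\<^sub>m d"
      unfolding has_schur_params_fin_def by blast
    have nbG: "norm_bd d 1 (G m z)" if "m \<le> M" "z \<in> ball 0 1" for m z using G(2) that by (simp add: schur_fun_iff)
    have GM: "G M z = 1\<^sub>m d" if "z \<in> ball 0 1" for z using schur_fun_eq_one[of d "G M" z] G(2,4) that by simp
    \<comment> \<open>Induction on the distance k from the end of the parameter sequence.\<close>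
    have eq: "k \<le> M \<Longrightarrow> G (M - k) z = F (M - k) z" if z: "z \<in> ball 0 1 - {0}" for z k
    proof (induct k)
      case 0
      then show ?case using GM FM z by simp
    next
      case (Suc k)
      define m where "m = M - Suc k"
      have m: "m < M" "Suc m = M - k" using Suc by (auto simp: m_def)
      have am: "a m \<in> carrier_mat d d" "opnorm (a m) < 1" using a[OF m(1)] by auto
      have nbm: "norm_bd d 1 (G m z)" "norm_bd d 1 (G (Suc m) z)" using nbG[of m z] nbG[of "Suc m" z] m(1) z by auto
      have "schur_link d (a m) z (G m z) (G (Suc m) z)"
        using schur_step_iff_link[OF am, of "G m" z "G (Suc m) z"] nbm norm_bd_carrier[OF nbm(2)] z G(3) m(1) by auto
      moreover have "schur_link d (a m) z (F m z) (F (Suc m) z)" using chF[of z] z m(1) by (simp add: chain_def)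
      moreover have "G (Suc m) z = F (Suc m) z" using Suc m by simp
      moreover have "F m z \<in> carrier_mat d d" using chF[of z] z m(1) by (simp add: chain_def norm_bd_def)
      ultimately have "G m z = F m z"
        using nbm norm_bd_carrier[OF nbm(1)] z by (intro schur_link_determines[OF am, of _ _ "F (Suc m) z"]) auto
      then show ?case by (simp add: m_def)
    qed
    show "g = F 0"
    proof
      fix z :: complex
      consider "z \<notin> ball 0 1" | "z = 0" | "z \<in> ball 0 1 - {0}" by blast
      then show "g z = F 0 z"
      proof cases
        case 1 then show ?thesis using g by (simp add: F_def)
      next
        case 2
        show ?thesis
        \<comment> \<open>Without parameters the value at 0 is the terminal 1 instead of a first
          parameter.\<close>
        proof (cases "M = 0")
          case True
          then show ?thesis using GM[of z] FM[of z] G(1) 2 by simp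
        next
          case False
          then have "G 0 0 = a 0" "F 0 0 = a 0" using G(3) F0[of 0] by auto
          then show ?thesis using G(1) 2 by simp
        qed
      next
        case 3
        then show ?thesis using eq[OF 3, of M] G(1) by simp
      qed
    qed
  qed
  then show ?thesis using chF[of z] FM[of z] z by (intro exI[of _ "\<lambda>m. F m z"]) auto
qed

text \<open>Puts the three index types into one form: membership in \<open>blocks K\<close> decides
  whether a link follows or the chain ends with 1. To the right, only the finite type has an
  end.\<close>

lemma f_iter_chain:
  assumes al: "\<forall>i\<in>alpha_idx K. \<alpha> i \<in> carrier_mat d d \<and> opnorm (\<alpha> i) < 1"
    and j: "j \<in> blocks K" and z: "z \<in> ball 0 1 - {0}"
  shows "\<exists>G. G 0 = f_iter d K \<alpha> j z \<and> (\<forall>m. j + int m \<in> blocks K \<longrightarrow> norm_bd d 1 (G m)) \<and>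
    (\<forall>m. j + int m \<in> blocks K \<longrightarrow> j + int m + 1 \<in> blocks K \<longrightarrow> schur_link d (\<alpha> (j + int m)) z (G m) (G (Suc m))) \<and>
    (\<forall>m. j + int m \<in> blocks K \<longrightarrow> j + int m + 1 \<notin> blocks K \<longrightarrow> G m = 1\<^sub>m d)"
proof (cases "\<exists>N. K = Fin N")
  case True
  then obtain N where K: "K = Fin N" by blast
  have jN: "0 \<le> j" "j \<le> int N" using j by (auto simp: K)
  obtain G where G: "G 0 = schur_of_fin d (nat (int N - j)) (\<lambda>m. \<alpha> (j + int m)) z"
    "chain d (\<lambda>m. \<alpha> (j + int m)) z (nat (int N - j)) G" "G (nat (int N - j)) = 1\<^sub>m d"
    using schur_of_fin_chain[of "nat (int N - j)" "\<lambda>m. \<alpha> (j + int m)" d z] al z jN by (auto simp: K)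
  have "G m = 1\<^sub>m d" if "j + int m \<in> blocks K" "j + int m + 1 \<notin> blocks K" for m
  proof -
    have "m = nat (int N - j)" using that jN by (auto simp: K)
    then show ?thesis using G(3) by simp
  qed
  then show ?thesis using G jN by (intro exI[of _ G]) (auto simp: K f_iter_def chain_def)
next
  case False
  then have fK: "f_iter d K \<alpha> j = schur_of_inf d (\<lambda>m. \<alpha> (j + int m))"
    and B: "j + int m \<in> alpha_idx K" "j + int m \<in> blocks K" "j + int m + 1 \<in> blocks K" for m
    using j by (cases K; auto simp: f_iter_def)+
  obtain G where G: "G 0 = f_iter d K \<alpha> j z" "\<And>n. chain d (\<lambda>m. \<alpha> (j + int m)) z n G"
    using schur_of_inf_chain[of "\<lambda>m. \<alpha> (j + int m)" d z] al B z by (auto simp: fK)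
  have "norm_bd d 1 (G m)" "schur_link d (\<alpha> (j + int m)) z (G m) (G (Suc m))" for m
    using G(2)[of "Suc m"] by (auto simp: chain_def)
  then show ?thesis using G(1) B by (intro exI[of _ G]) auto
qed

text \<open>The mirror image, counting blocks to the left of j. Here the semi-infinite type behaves
  like the finite one, since block 0 ends the chain.\<close>

lemma b_iter_chain:
  assumes al: "\<forall>i\<in>alpha_idx K. \<alpha> i \<in> carrier_mat d d \<and> opnorm (\<alpha> i) < 1"
    and j: "j \<in> blocks K" and z: "z \<in> ball 0 1 - {0}"
  shows "\<exists>G. G 0 = b_iter d K \<alpha> j z \<and> (\<forall>m. j - int m \<in> blocks K \<longrightarrow> norm_bd d 1 (G m)) \<and>
    (\<forall>m. j - int m \<in> blocks K \<longrightarrow> j - int m - 1 \<in> blocks K \<longrightarrow>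
       schur_link d (- mat_adjoint (\<alpha> (j - 1 - int m))) z (G m) (G (Suc m))) \<and>
    (\<forall>m. j - int m \<in> blocks K \<longrightarrow> j - int m - 1 \<notin> blocks K \<longrightarrow> G m = 1\<^sub>m d)"
proof (cases "K = Dbl")
  case False
  have j0: "0 \<le> j" using j False by (cases K) auto
  have bK: "b_iter d K \<alpha> j = schur_of_fin d (nat j) (\<lambda>m. - mat_adjoint (\<alpha> (j - 1 - int m)))"
    using False by (cases K) (auto simp: b_iter_def)
  have B: "j - int m \<in> blocks K \<longleftrightarrow> m \<le> nat j" "j - int m - 1 \<in> blocks K \<longleftrightarrow> m < nat j" for m
    using j False by (cases K; auto)+
  have "j - 1 - int i \<in> alpha_idx K" if "i < nat j" for i
    using j False that by (cases K) auto
  then have "- mat_adjoint (\<alpha> (j - 1 - int i)) \<in> carrier_mat d d \<and> opnorm (- mat_adjoint (\<alpha> (j - 1 - int i))) < 1" if "i < nat j" for i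
    using al opnorm_adjoint_less that by auto
  then obtain G where G: "G 0 = b_iter d K \<alpha> j z"
    "chain d (\<lambda>m. - mat_adjoint (\<alpha> (j - 1 - int m))) z (nat j) G" "G (nat j) = 1\<^sub>m d"
    using schur_of_fin_chain[of "nat j" "\<lambda>m. - mat_adjoint (\<alpha> (j - 1 - int m))" d z] z by (auto simp: bK)
  show ?thesis unfolding B using G by (intro exI[of _ G]) (auto simp: chain_def dest: le_neq_implies_less)
next
  case True
  have "- mat_adjoint (\<alpha> (j - 1 - int i)) \<in> carrier_mat d d \<and> opnorm (- mat_adjoint (\<alpha> (j - 1 - int i))) < 1" for i
    using al opnorm_adjoint_less True by auto
  then obtain G where G: "G 0 = b_iter d K \<alpha> j z" "\<And>n. chain d (\<lambda>m. - mat_adjoint (\<alpha> (j - 1 - int m))) z n G"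
    using schur_of_inf_chain[of "\<lambda>m. - mat_adjoint (\<alpha> (j - 1 - int m))" d z] z by (auto simp: True b_iter_def)
  have "norm_bd d 1 (G m)" "schur_link d (- mat_adjoint (\<alpha> (j - 1 - int m))) z (G m) (G (Suc m))" for m
    using G(2)[of "Suc m"] by (auto simp: chain_def)
  then show ?thesis using G(1) True by (intro exI[of _ G]) auto
qed

section \<open>Row-finite matrices and block-diagonal factors\<close>

text \<open>Under this condition the infinite sums in \<open>imv\<close> and \<open>imult\<close>
  are finite, so products act as compositions without any question of convergence.\<close>

definition row_finite :: "imat \<Rightarrow> bool" where
  "row_finite A \<longleftrightarrow> (\<forall>x. finite {w. A x w \<noteq> 0})"

lemma imv_sum:
  assumes "finite S" "{w. A x w \<noteq> 0} \<subseteq> S"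
  shows "imv A v x = (\<Sum>w\<in>S. A x w * v w)"
proof -
  have "imv A v x = infsum (\<lambda>w. A x w * v w) S"
    unfolding imv_def by (rule infsum_cong_neutral) (use assms(2) in auto)
  then show ?thesis using assms(1) by simp
qed

lemma imult_sum:
  assumes "finite S" "{w. A x w \<noteq> 0} \<subseteq> S"
  shows "imult A B x y = (\<Sum>w\<in>S. A x w * B w y)"
proof -
  have "imult A B x y = infsum (\<lambda>w. A x w * B w y) S"
    unfolding imult_def by (rule infsum_cong_neutral) (use assms(2) in auto)
  then show ?thesis using assms(1) by simp
qed

lemma row_finite_imult:
  assumes A: "row_finite A" and B: "row_finite B"
  shows "row_finite (imult A B)"
  unfolding row_finite_def
proof
  fix x
  let ?S = "{w. A x w \<noteq> 0}"
  have fS: "finite ?S" using A by (simp add: row_finite_def)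
  have "{y. imult A B x y \<noteq> 0} \<subseteq> (\<Union>w\<in>?S. {y. B w y \<noteq> 0})"
  proof
    fix y assume "y \<in> {y. imult A B x y \<noteq> 0}"
    then have "(\<Sum>w\<in>?S. A x w * B w y) \<noteq> 0" using imult_sum[of ?S A x, OF fS order_refl, of B y] by simp
    then obtain w where "w \<in> ?S" "A x w * B w y \<noteq> 0" by (meson sum.neutral)
    then show "y \<in> (\<Union>w\<in>?S. {y. B w y \<noteq> 0})" by auto
  qed
  then show "finite {y. imult A B x y \<noteq> 0}"
    by (rule finite_subset) (use fS B in \<open>auto simp: row_finite_def\<close>)
qed

lemma imv_imult:
  assumes A: "row_finite A" and B: "row_finite B"
  shows "imv (imult A B) v = imv A (imv B v)"
proof
  fix x
  let ?S = "{w. A x w \<noteq> 0}"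
  have fS: "finite ?S" using A by (simp add: row_finite_def)
  \<comment> \<open>All columns reached from row x by a path through A and B; one finite set serves
    every inner sum.\<close>
  define R where "R = (\<Union>w\<in>?S. {y. B w y \<noteq> 0})"
  have fR: "finite R" using fS B by (auto simp: R_def row_finite_def)
  have sub: "{y. imult A B x y \<noteq> 0} \<subseteq> R"
  proof
    fix y assume "y \<in> {y. imult A B x y \<noteq> 0}"
    then have "(\<Sum>w\<in>?S. A x w * B w y) \<noteq> 0" using imult_sum[of ?S A x, OF fS order_refl, of B y] by simp
    then obtain w where "w \<in> ?S" "A x w * B w y \<noteq> 0" by (meson sum.neutral)
    then show "y \<in> R" by (auto simp: R_def)
  qed
  have "imv (imult A B) v x = (\<Sum>y\<in>R. (\<Sum>w\<in>?S. A x w * B w y) * v y)"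
    by (simp add: imv_sum[of R "imult A B" x, OF fR sub] imult_sum[of ?S A x, OF fS order_refl])
  also have "\<dots> = (\<Sum>w\<in>?S. A x w * (\<Sum>y\<in>R. B w y * v y))"
    by (simp add: sum_distrib_left sum_distrib_right mult_ac) (rule sum.swap)
  also have "\<dots> = (\<Sum>w\<in>?S. A x w * imv B v w)"
  proof (rule sum.cong)
    fix w assume "w \<in> ?S"
    then have "{y. B w y \<noteq> 0} \<subseteq> R" by (auto simp: R_def)
    then show "A x w * (\<Sum>y\<in>R. B w y * v y) = A x w * imv B v w"
      by (simp add: imv_sum[where S = R, OF fR])
  qed simp
  also have "\<dots> = imv A (imv B v) x" by (rule imv_sum[of ?S A x, OF fS order_refl, symmetric])
  finally show "imv (imult A B) v x = imv A (imv B v) x" .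
qed

lemma imv_add_idX:
  assumes U: "row_finite U" and v: "\<And>i. i \<notin> X \<Longrightarrow> v i = 0"
  shows "imv (\<lambda>a b. U a b + c * idX X a b) v x = imv U v x + c * v x"
proof -
  let ?S = "insert x {w. U x w \<noteq> 0}"
  have fS: "finite ?S" using U by (simp add: row_finite_def)
  have "imv (\<lambda>a b. U a b + c * idX X a b) v x = (\<Sum>w\<in>?S. (U x w + c * idX X x w) * v w)"
    by (rule imv_sum[OF fS]) (auto simp: idX_def)
  also have "\<dots> = (\<Sum>w\<in>?S. U x w * v w) + (\<Sum>w\<in>?S. c * idX X x w * v w)"
    by (simp add: distrib_right sum.distrib)
  also have "(\<Sum>w\<in>?S. U x w * v w) = imv U v x"
    by (rule imv_sum[OF fS, symmetric]) auto
  also have "(\<Sum>w\<in>?S. c * idX X x w * v w) = (\<Sum>w\<in>?S. if w = x then c * v w else 0)"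
    using v by (intro sum.cong) (auto simp: idX_def)
  also have "\<dots> = c * v x" using fS by simp
  finally show ?thesis .
qed

lemma imv_diff:
  assumes U: "row_finite U"
  shows "imv U (\<lambda>i. v i - w i) x = imv U v x - imv U w x"
proof -
  have fS: "finite {w. U x w \<noteq> 0}" using U by (simp add: row_finite_def)
  show ?thesis unfolding imv_sum[of "{w. U x w \<noteq> 0}" U x, OF fS order_refl] by (simp add: right_diff_distrib sum_subtractf)
qed

lemma l2_diff:
  assumes "l2 X v" "l2 X w"
  shows "l2 X (\<lambda>i. v i - w i)"
proof -
  have "(\<lambda>i. 2 * (cmod (v i))\<^sup>2 + 2 * (cmod (w i))\<^sup>2) summable_on UNIV"
    using assms by (intro summable_on_add summable_on_cmult_right) (auto simp: l2_def)
  then have "(\<lambda>i. (cmod (v i - w i))\<^sup>2) summable_on UNIV"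
    by (rule summable_on_comparison_test) (auto intro: cmod_diff_sq_le)
  then show ?thesis using assms by (auto simp: l2_def)
qed

definition vext :: "int \<Rightarrow> nat \<Rightarrow> complex vec \<Rightarrow> int \<Rightarrow> complex" where
  "vext lo n x i = (if lo \<le> i \<and> i < lo + int n then x $ nat (i - lo) else 0)"

text \<open>If x = P U y and \<Phi> x = P y, then (U - z) y = (1 - z \<Phi>) x and P (U + z) y = (1
  + z \<Phi>) x, so F = (1 + z \<Phi>) (1 - z \<Phi>)^-1 and the Cayley transform in
  \<open>subspace_schur\<close> returns \<Phi>. Such a y is asked for every x; uniqueness of
  solutions also makes 1 - z \<Phi> injective.\<close>

lemma subspace_schur_eqI:
  assumes U: "row_finite U" and z: "z \<noteq> 0"
    and uniq: "\<And>y. l2 X y \<Longrightarrow> (\<And>i. imv U y i = z * y i) \<Longrightarrow> y = (\<lambda>_. 0)"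
    and \<Phi>: "\<Phi> \<in> carrier_mat n n"
    and ex: "\<And>x. x \<in> carrier_vec n \<Longrightarrow> \<exists>y. l2 X y \<and>
       (\<forall>i. imv U y i - z * y i = vext lo n (x - z \<cdot>\<^sub>v (\<Phi> *\<^sub>v x)) i) \<and> (\<forall>r<n. y (lo + int r) = (\<Phi> *\<^sub>v x) $ r)"
  shows "subspace_schur X U lo n z = \<Phi>"
proof -
  define N where "N = 1\<^sub>m n - z \<cdot>\<^sub>m \<Phi>"
  have N: "N \<in> carrier_mat n n" using \<Phi> by (auto simp: N_def)
  have Nv: "N *\<^sub>v x = x - z \<cdot>\<^sub>v (\<Phi> *\<^sub>v x)" if "x \<in> carrier_vec n" for x
    unfolding N_def using \<Phi> that by (subst minus_mult_distrib_mat_vec[of _ n n]) (auto simp: smult_mat_vec[of _ n n])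
  have Uy: "imv U y (lo + int r) = x $ r"
    if "\<forall>i. imv U y i - z * y i = vext lo n (x - z \<cdot>\<^sub>v (\<Phi> *\<^sub>v x)) i" "\<forall>r<n. y (lo + int r) = (\<Phi> *\<^sub>v x) $ r"
      "r < n" "x \<in> carrier_vec n" for x y r
  proof -
    have "imv U y (lo + int r) - z * y (lo + int r) = (x - z \<cdot>\<^sub>v (\<Phi> *\<^sub>v x)) $ r"
      using that(1,3) by (simp add: vext_def)
    also have "\<dots> = x $ r - z * (\<Phi> *\<^sub>v x) $ r" using that(3,4) \<Phi> by (simp del: index_mult_mat_vec)
    finally show ?thesis using that(2,3) by simp
  qed
  \<comment> \<open>If (1 - z \<Phi>) x = 0, the associated y solves U y = z y and vanishes, and
    with it x, the window part of U y.\<close>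
  have "x = 0\<^sub>v n" if x: "x \<in> carrier_vec n" and 0: "N *\<^sub>v x = 0\<^sub>v n" for x
  proof -
    obtain y where y: "l2 X y" "\<forall>i. imv U y i - z * y i = vext lo n (x - z \<cdot>\<^sub>v (\<Phi> *\<^sub>v x)) i" "\<forall>r<n. y (lo + int r) = (\<Phi> *\<^sub>v x) $ r"
      using ex[OF x] by blast
    have "imv U y i - z * y i = 0" for i using y(2) 0 by (auto simp: Nv[OF x, symmetric] vext_def nat_less_iff)
    then have "y = (\<lambda>_. 0)" using uniq[OF y(1)] by simp
    then show ?thesis using Uy[OF y(2,3) _ x] x by (intro eq_vecI) (auto simp: imv_def)
  qed
  then obtain Ni where Ni: "Ni \<in> carrier_mat n n" "N * Ni = 1\<^sub>m n" "Ni * N = 1\<^sub>m n"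
    using mat_inverse_ex(2)[OF N] by blast
  have F: "FS X U lo n z = (1\<^sub>m n + z \<cdot>\<^sub>m \<Phi>) * Ni"
  proof (rule eq_matI)
    fix r c assume "r < dim_row ((1\<^sub>m n + z \<cdot>\<^sub>m \<Phi>) * Ni)" "c < dim_col ((1\<^sub>m n + z \<cdot>\<^sub>m \<Phi>) * Ni)"
    then have rc: "r < n" "c < n" using \<Phi> Ni by auto
    \<comment> \<open>This x solves (1 - z \<Phi>) x = e_c, so its y is the column of the resolvent
      at the c-th basis vector of the window.\<close>
    define x where "x = Ni *\<^sub>v unit_vec n c"
    have x: "x \<in> carrier_vec n" using Ni by (auto simp: x_def)
    obtain y where y: "l2 X y" "\<forall>i. imv U y i - z * y i = vext lo n (x - z \<cdot>\<^sub>v (\<Phi> *\<^sub>v x)) i" "\<forall>r<n. y (lo + int r) = (\<Phi> *\<^sub>v x) $ r"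
      using ex[OF x] by blast
    have Nx: "N *\<^sub>v x = unit_vec n c" unfolding x_def
      using Ni N by (intro mat_vec_cancel_left[of _ n]) auto
    have supp: "i \<notin> X \<Longrightarrow> u i = 0" if "l2 X u" for u i using that by (simp add: l2_def)
    have Uz: "imv (\<lambda>a b. U a b - z * idX X a b) u i = imv U u i - z * u i" if "l2 X u" for u i
      using imv_add_idX[OF U supp[OF that], where c = "- z" and x = i] by simp
    have ev: "vext lo n (unit_vec n c) = evec (lo + int c)"
      using rc by (auto simp: vext_def evec_def fun_eq_iff unit_vec_def)
    have "(THE y. l2 X y \<and> imv (\<lambda>a b. U a b - z * idX X a b) y = evec (lo + int c)) = y"
    proof (rule the_equality)
      show 1: "l2 X y \<and> imv (\<lambda>a b. U a b - z * idX X a b) y = evec (lo + int c)"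
        using y(1,2) Nx by (simp add: fun_eq_iff Uz Nv[OF x, symmetric] ev)
      fix u assume u: "l2 X u \<and> imv (\<lambda>a b. U a b - z * idX X a b) u = evec (lo + int c)"
      have "imv U u i - z * u i = imv U y i - z * y i" for i
        using u 1 Uz[of u i] Uz[of y i] by (simp add: fun_eq_iff)
      then have "imv U (\<lambda>i. u i - y i) i = z * (u i - y i)" for i
        unfolding imv_diff[OF U] by (simp add: algebra_simps)
      then have "(\<lambda>i. u i - y i) = (\<lambda>_. 0)" using uniq[OF l2_diff] u y(1) by blast
      then show "u = y" by (simp add: fun_eq_iff)
    qed
    then have "FS X U lo n z $$ (r, c) = imv U y (lo + int r) + z * y (lo + int r)"
      using rc imv_add_idX[OF U supp[OF y(1)], where c = z and x = "lo + int r"] by (simp add: FS_def Let_def)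
    also have "\<dots> = x $ r + z * (\<Phi> *\<^sub>v x) $ r" using Uy[OF y(2,3) rc(1) x] y(3) rc by simp
    also have "\<dots> = ((1\<^sub>m n + z \<cdot>\<^sub>m \<Phi>) *\<^sub>v x) $ r"
    proof -
      have "(1\<^sub>m n + z \<cdot>\<^sub>m \<Phi>) *\<^sub>v x = x + z \<cdot>\<^sub>v (\<Phi> *\<^sub>v x)"
        using \<Phi> x by (subst add_mult_distrib_mat_vec[of _ n n]) (auto simp: smult_mat_vec[of _ n n])
      then show ?thesis using rc \<Phi> x by (simp del: index_mult_mat_vec)
    qed
    also have "(1\<^sub>m n + z \<cdot>\<^sub>m \<Phi>) *\<^sub>v x = ((1\<^sub>m n + z \<cdot>\<^sub>m \<Phi>) * Ni) *\<^sub>v unit_vec n c"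
      unfolding x_def using \<Phi> Ni by (intro assoc_mult_mat_vec[symmetric]) auto
    also have "\<dots> $ r = ((1\<^sub>m n + z \<cdot>\<^sub>m \<Phi>) * Ni) $$ (r, c)"
      using \<Phi> Ni rc by (simp add: scalar_prod_right_unit del: assoc_mult_mat_vec)
    finally show "FS X U lo n z $$ (r, c) = ((1\<^sub>m n + z \<cdot>\<^sub>m \<Phi>) * Ni) $$ (r, c)" .
  qed (use \<Phi> Ni in \<open>auto simp: FS_def\<close>)
  \<comment> \<open>F + 1 = 2 (1 - z \<Phi>)^-1, and below F - 1 = 2 z \<Phi> (1 - z \<Phi>)^-1;
    their quotient is z \<Phi>.\<close>
  have two: "FS X U lo n z + 1\<^sub>m n = (2::complex) \<cdot>\<^sub>m Ni"
  proof -
    have "FS X U lo n z + 1\<^sub>m n = (1\<^sub>m n + z \<cdot>\<^sub>m \<Phi>) * Ni + N * Ni" by (simp add: F Ni)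
    also have "\<dots> = ((1\<^sub>m n + z \<cdot>\<^sub>m \<Phi>) + N) * Ni" using \<Phi> N Ni by (intro add_mult_distrib_mat[symmetric]) auto
    also have "(1\<^sub>m n + z \<cdot>\<^sub>m \<Phi>) + N = (2::complex) \<cdot>\<^sub>m 1\<^sub>m n" unfolding N_def using \<Phi> by (intro eq_matI) auto
    also have "(2 \<cdot>\<^sub>m 1\<^sub>m n) * Ni = (2::complex) \<cdot>\<^sub>m Ni" using Ni by (subst mult_smult_assoc_mat[of _ n n _ n]) auto
    finally show ?thesis .
  qed
  have "FS X U lo n z - 1\<^sub>m n = (1\<^sub>m n + z \<cdot>\<^sub>m \<Phi>) * Ni - N * Ni" by (simp add: F Ni)
  also have "\<dots> = ((1\<^sub>m n + z \<cdot>\<^sub>m \<Phi>) - N) * Ni" using \<Phi> N Ni by (intro minus_mult_distrib_mat[symmetric]) auto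
  also have "(1\<^sub>m n + z \<cdot>\<^sub>m \<Phi>) - N = (2 * z) \<cdot>\<^sub>m \<Phi>" unfolding N_def using \<Phi> by (intro eq_matI) auto
  finally have m1: "FS X U lo n z - 1\<^sub>m n = ((2 * z) \<cdot>\<^sub>m \<Phi>) * Ni" .
  have "minv (2 \<cdot>\<^sub>m Ni) = (1/2) \<cdot>\<^sub>m N"
  proof (rule minv_eqI[of _ n])
    have "(2 \<cdot>\<^sub>m Ni) * ((1/2) \<cdot>\<^sub>m N) = 2 \<cdot>\<^sub>m (Ni * ((1/2) \<cdot>\<^sub>m N))"
      using N Ni by (intro mult_smult_assoc_mat[of _ n n _ n]) auto
    also have "Ni * ((1/2) \<cdot>\<^sub>m N) = (1/2) \<cdot>\<^sub>m 1\<^sub>m n"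
      using N Ni by (subst mult_smult_distrib[of _ n n _ n]) auto
    finally show "(2 \<cdot>\<^sub>m Ni) * ((1/2) \<cdot>\<^sub>m N) = 1\<^sub>m n" by (auto intro!: eq_matI)
  qed (use N Ni in auto)
  then have "(FS X U lo n z - 1\<^sub>m n) * minv (FS X U lo n z + 1\<^sub>m n) = (((2 * z) \<cdot>\<^sub>m \<Phi>) * Ni) * ((1/2) \<cdot>\<^sub>m N)"
    by (simp add: m1 two)
  also have "\<dots> = ((2 * z) \<cdot>\<^sub>m \<Phi>) * (Ni * ((1/2) \<cdot>\<^sub>m N))"
    using \<Phi> N Ni by (intro assoc_mult_mat) auto
  also have "Ni * ((1/2) \<cdot>\<^sub>m N) = (1/2) \<cdot>\<^sub>m 1\<^sub>m n"
    using N Ni by (subst mult_smult_distrib[of _ n n _ n]) auto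
  also have "((2 * z) \<cdot>\<^sub>m \<Phi>) * ((1/2) \<cdot>\<^sub>m 1\<^sub>m n) = z \<cdot>\<^sub>m \<Phi>"
    using \<Phi> by (subst mult_smult_distrib[of _ n n _ n]) (auto intro!: eq_matI)
  finally show ?thesis unfolding subspace_schur_def using z \<Phi> by (auto intro!: eq_matI)
qed


text \<open>With \<open>s = 0\<close> blocks are paired as \<open>(2m, 2m+1)\<close>, with \<open>s = 1\<close> as \<open>(2m-1, 2m)\<close>.\<close>

definition pair_start :: "int \<Rightarrow> int \<Rightarrow> int" where
  "pair_start s p = 2 * ((p + s) div 2) - s"

lemma pair_start_eq: "pair_start s p = (if even (p + s) then p else p - 1)"
  unfolding pair_start_def by presburger

text \<open>\<open>cmv_factor\<close> with arbitrary matrices \<open>T t\<close> in place of the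
  Theta blocks, so that the adjoints of the factors have the same shape.\<close>

definition pair_op :: "nat \<Rightarrow> (int \<Rightarrow> complex mat) \<Rightarrow> int set \<Rightarrow> int \<Rightarrow> imat" where
  "pair_op d T B s x y =
    (let p = x div int d; q = y div int d; t = pair_start s p in
     if p \<notin> B \<or> q \<notin> B then 0
     else if pair_start s q = t \<and> t \<in> B \<and> t + 1 \<in> B
       then T t $$ (nat (x - t * int d), nat (y - t * int d))
     else if x = y then 1 else 0)"

lemma cmv_factor_pair_op: "cmv_factor d a B s = pair_op d (\<lambda>t. Theta (a t)) B s"
  by (intro HOL.ext) (simp only: cmv_factor_def pair_op_def pair_start_def Let_def)

lemma pair_div:
  assumes "i < d + d"
  shows "(t * int d + int i) div int d = (if i < d then t else t + 1)"
proof (cases "i < d")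
  case True
  then show ?thesis by (simp add: div_add1_eq)
next
  case False
  then have e: "t * int d + int i = (t + 1) * int d + int (i - d)" using assms by (simp add: algebra_simps)
  have "((t + 1) * int d + int (i - d)) div int d = t + 1" using assms False by (subst div_mult_self3) auto
  then show ?thesis unfolding e using False by simp
qed

lemma div_in_pair:
  assumes d: "d > 0" and "w div int d = t \<or> w div int d = t + 1"
  obtains k where "k < d + d" "w = t * int d + int k"
proof -
  have m: "w = (w div int d) * int d + w mod int d" "0 \<le> w mod int d" "w mod int d < int d"
    using d by auto
  define k where "k = nat (w - t * int d)"
  have "0 \<le> w - t * int d \<and> w - t * int d < int d + int d"
    using assms(2)
  proof
    assume e: "w div int d = t"
    show ?thesis using m(2,3) m(1)[unfolded e] by linarith
  next
    assume e: "w div int d = t + 1"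
    have "(t + 1) * int d = t * int d + int d" by (simp add: algebra_simps)
    then show ?thesis using m(2,3) m(1)[unfolded e] by linarith
  qed
  then have "k < d + d" "w = t * int d + int k" by (auto simp: k_def)
  then show thesis by (rule that)
qed

lemma imv_pair_op_pair:
  assumes d: "d > 0" and t: "t \<in> B" "t + 1 \<in> B" "even (t + s)" and i: "i < d + d"
  shows "imv (pair_op d T B s) v (t * int d + int i) = (\<Sum>k<d + d. T t $$ (i, k) * v (t * int d + int k))"
proof -
  let ?x = "t * int d + int i"
  let ?f = "\<lambda>k. t * int d + int k"
  have pb: "?f k div int d \<in> B" "pair_start s (?f k div int d) = t" if "k < d + d" for k
    unfolding pair_div[OF that] pair_start_eq using t by (cases "k < d"; simp)+
  have F: "pair_op d T B s ?x (?f k) = T t $$ (i, k)" if "k < d + d" for k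
    unfolding pair_op_def Let_def pb(2)[OF i] pb(2)[OF that] using pb(1)[OF i] pb(1)[OF that] t(1,2) by simp
  have sub: "{w. pair_op d T B s ?x w \<noteq> 0} \<subseteq> ?f ` {..<d + d}"
  proof
    fix w assume "w \<in> {w. pair_op d T B s ?x w \<noteq> 0}"
    then have w: "pair_op d T B s ?x w \<noteq> 0" by simp
    have xd: "?x div int d = t \<or> ?x div int d = t + 1" unfolding pair_div[OF i] by simp
    have "pair_start s (?x div int d) = t" by (rule pb(2)[OF i])
    then have "pair_start s (w div int d) = t \<or> w = ?x"
      using w by (auto simp: pair_op_def Let_def split: if_splits)
    then have "w div int d = t \<or> w div int d = t + 1"
      using xd by (auto simp: pair_start_eq split: if_splits)
    then obtain k where "k < d + d" "w = ?f k" using div_in_pair[OF d] by blast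
    then show "w \<in> ?f ` {..<d + d}" by auto
  qed
  have "imv (pair_op d T B s) v ?x = (\<Sum>w\<in>?f ` {..<d + d}. pair_op d T B s ?x w * v w)"
    by (rule imv_sum[of "?f ` {..<d + d}" "pair_op d T B s" ?x, OF _ sub]) simp
  also have "\<dots> = (\<Sum>k<d + d. pair_op d T B s ?x (?f k) * v (?f k))"
    by (subst sum.reindex) (auto simp: inj_on_def)
  also have "\<dots> = (\<Sum>k<d + d. T t $$ (i, k) * v (?f k))"
    by (intro sum.cong) (auto simp: F)
  finally show ?thesis .
qed

lemma imv_pair_op_single:
  assumes p: "x div int d \<in> B" "\<not> (pair_start s (x div int d) \<in> B \<and> pair_start s (x div int d) + 1 \<in> B)"
  shows "imv (pair_op d T B s) v x = v x"
proof -
  have sub: "{w. pair_op d T B s x w \<noteq> 0} \<subseteq> {x}"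
    using p by (auto simp: pair_op_def Let_def split: if_splits)
  have "pair_op d T B s x x = 1" using p by (auto simp: pair_op_def Let_def)
  then show ?thesis by (subst imv_sum[of "{x}" "pair_op d T B s" x, OF _ sub]) auto
qed

lemma imv_pair_op_out: "x div int d \<notin> B \<Longrightarrow> imv (pair_op d T B s) v x = 0"
  by (subst imv_sum[of "{}"]) (auto simp: pair_op_def Let_def)

lemma row_finite_pair_op:
  assumes d: "d > 0"
  shows "row_finite (pair_op d T B s)"
  unfolding row_finite_def
proof
  fix x
  let ?t = "pair_start s (x div int d)"
  have "{w. pair_op d T B s x w \<noteq> 0} \<subseteq> insert x ((\<lambda>k. ?t * int d + int k) ` {..<d + d})"
  proof
    fix w assume "w \<in> {w. pair_op d T B s x w \<noteq> 0}"
    then have "pair_start s (w div int d) = ?t \<or> w = x"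
      by (auto simp: pair_op_def Let_def split: if_splits)
    then show "w \<in> insert x ((\<lambda>k. ?t * int d + int k) ` {..<d + d})"
    proof
      assume "pair_start s (w div int d) = ?t"
      then have "w div int d = ?t \<or> w div int d = ?t + 1" by (auto simp: pair_start_eq[of s "w div int d"] split: if_splits)
      then obtain k where "k < d + d" "w = ?t * int d + int k" using div_in_pair[OF d] by blast
      then show ?thesis by auto
    qed simp
  qed
  then show "finite {w. pair_op d T B s x w \<noteq> 0}" by (rule finite_subset) simp
qed

section \<open>Vectors as families of blocks\<close>

definition blk :: "nat \<Rightarrow> (int \<Rightarrow> complex) \<Rightarrow> int \<Rightarrow> complex vec" where
  "blk d v p = Matrix.vec d (\<lambda>i. v (p * int d + int i))"

definition of_blks :: "nat \<Rightarrow> int set \<Rightarrow> (int \<Rightarrow> complex vec) \<Rightarrow> int \<Rightarrow> complex" where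
  "of_blks d B V x = (if x div int d \<in> B then V (x div int d) $ nat (x mod int d) else 0)"

lemma blk_carrier [simp]: "blk d v p \<in> carrier_vec d"
  by (simp add: blk_def)

lemma blk_append:
  "Matrix.vec (d + d) (\<lambda>i. v (t * int d + int i)) = blk d v t @\<^sub>v blk d v (t + 1)"
proof (rule eq_vecI)
  fix i assume "i < dim_vec (blk d v t @\<^sub>v blk d v (t + 1))"
  then show "Matrix.vec (d + d) (\<lambda>i. v (t * int d + int i)) $ i = (blk d v t @\<^sub>v blk d v (t + 1)) $ i"
    by (auto simp: blk_def algebra_simps)
qed (simp add: blk_def)

lemma blk_of_blks:
  assumes "d > 0" "p \<in> B" "V p \<in> carrier_vec d"
  shows "blk d (of_blks d B V) p = V p"
proof (rule eq_vecI)
  fix i assume "i < dim_vec (V p)"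
  then have i: "i < d" using assms by simp
  have "(p * int d + int i) div int d = p" "(p * int d + int i) mod int d = int i"
    using pair_div[of i d p] i by (auto simp: mod_add_eq)
  then show "blk d (of_blks d B V) p $ i = V p $ i" using i assms by (simp add: blk_def of_blks_def)
qed (use assms in \<open>auto simp: blk_def\<close>)

lemma blk_eqI:
  assumes d: "d > 0" and "\<And>p. p \<in> B \<Longrightarrow> blk d v p = blk d u p"
    and "\<And>x. x div int d \<notin> B \<Longrightarrow> v x = u x"
  shows "v = u"
proof
  fix x
  show "v x = u x"
  proof (cases "x div int d \<in> B")
    case True
    have x: "(x div int d) * int d + int (nat (x mod int d)) = x" "nat (x mod int d) < d"
      using d by (auto simp: nat_less_iff)
    have "blk d v (x div int d) $ nat (x mod int d) = blk d u (x div int d) $ nat (x mod int d)"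
      using assms(2)[OF True] by simp
    then show ?thesis using x by (simp add: blk_def)
  qed (use assms(3) in blast)
qed

text \<open>Blockwise form of \<open>U = F V\<close> for the block-diagonal factor \<open>F\<close>; a block without partner in \<open>B\<close> is fixed.\<close>

definition factor_rel :: "(int \<Rightarrow> complex mat) \<Rightarrow> int set \<Rightarrow> int \<Rightarrow> (int \<Rightarrow> complex vec) \<Rightarrow> (int \<Rightarrow> complex vec) \<Rightarrow> bool" where
  "factor_rel T B s V U \<longleftrightarrow> (\<forall>p\<in>B.
     (even (p + s) \<longrightarrow> p + 1 \<in> B \<longrightarrow> T p *\<^sub>v (V p @\<^sub>v V (p + 1)) = U p @\<^sub>v U (p + 1)) \<and>
     (even (p + s) \<longrightarrow> p + 1 \<notin> B \<longrightarrow> U p = V p) \<and>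
     (odd (p + s) \<longrightarrow> p - 1 \<notin> B \<longrightarrow> U p = V p))"

lemma factor_rel_imv:
  assumes d: "d > 0" and T: "\<And>t. t \<in> B \<Longrightarrow> t + 1 \<in> B \<Longrightarrow> T t \<in> carrier_mat (d + d) (d + d)"
  shows "factor_rel T B s (blk d v) (blk d (imv (pair_op d T B s) v))"
  unfolding factor_rel_def
proof (intro ballI conjI impI)
  fix p assume p: "p \<in> B"
  { assume e: "even (p + s)" "p + 1 \<in> B"
    show "T p *\<^sub>v (blk d v p @\<^sub>v blk d v (p + 1)) = blk d (imv (pair_op d T B s) v) p @\<^sub>v blk d (imv (pair_op d T B s) v) (p + 1)"
      unfolding blk_append[symmetric]
    proof (rule eq_vecI)
      fix i assume "i < dim_vec (Matrix.vec (d + d) (\<lambda>i. imv (pair_op d T B s) v (p * int d + int i)))"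
      then have i: "i < d + d" by simp
      show "(T p *\<^sub>v Matrix.vec (d + d) (\<lambda>i. v (p * int d + int i))) $ i =
        Matrix.vec (d + d) (\<lambda>i. imv (pair_op d T B s) v (p * int d + int i)) $ i"
        using i T[OF p e(2)] by (simp add: imv_pair_op_pair[OF d p e(2,1) i] scalar_prod_def atLeast0LessThan)
    qed (use T[OF p e(2)] in auto) }
  have single: "blk d (imv (pair_op d T B s) v) p = blk d v p" if "\<not> (pair_start s p \<in> B \<and> pair_start s p + 1 \<in> B)"
  proof (rule eq_vecI)
    fix i assume "i < dim_vec (blk d v p)"
    then have i: "i < d" by (simp add: blk_def)
    then have "(p * int d + int i) div int d = p" using pair_div[of i d p] by simp
    then show "blk d (imv (pair_op d T B s) v) p $ i = blk d v p $ i"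
      using i p that by (simp add: blk_def imv_pair_op_single)
  qed (simp add: blk_def)
  show "blk d (imv (pair_op d T B s) v) p = blk d v p" if "even (p + s)" "p + 1 \<notin> B"
    by (rule single) (use that in \<open>simp add: pair_start_eq\<close>)
  show "blk d (imv (pair_op d T B s) v) p = blk d v p" if "odd (p + s)" "p - 1 \<notin> B"
    by (rule single) (use that in \<open>simp add: pair_start_eq\<close>)
qed

text \<open>Each block lies in exactly one pair or has no partner, so V fixes U. A pair is split
  into its two components by the known length d.\<close>

lemma factor_rel_unique:
  assumes "factor_rel T B s V U" "factor_rel T B s V U'" "p \<in> B"
    "\<And>p. p \<in> B \<Longrightarrow> U p \<in> carrier_vec d" "\<And>p. p \<in> B \<Longrightarrow> U' p \<in> carrier_vec d"
  shows "U p = U' p"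
proof (cases "even (p + s)")
  case True
  show ?thesis
  proof (cases "p + 1 \<in> B")
    case p1: True
    have "T p *\<^sub>v (V p @\<^sub>v V (p + 1)) = U p @\<^sub>v U (p + 1)" "T p *\<^sub>v (V p @\<^sub>v V (p + 1)) = U' p @\<^sub>v U' (p + 1)"
      using assms(1,2,3) True p1 by (simp_all add: factor_rel_def)
    then have "U p @\<^sub>v U (p + 1) = U' p @\<^sub>v U' (p + 1)" by simp
    then show ?thesis using append_vec_eq[OF assms(4)[OF assms(3)] assms(5)[OF assms(3)]] by blast
  qed (use assms True in \<open>auto simp: factor_rel_def\<close>)
next
  case False
  show ?thesis
  proof (cases "p - 1 \<in> B")
    case p1: True
    have "even (p - 1 + s)" using False by presburger
    then have "T (p - 1) *\<^sub>v (V (p - 1) @\<^sub>v V (p - 1 + 1)) = U (p - 1) @\<^sub>v U (p - 1 + 1)"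
      "T (p - 1) *\<^sub>v (V (p - 1) @\<^sub>v V (p - 1 + 1)) = U' (p - 1) @\<^sub>v U' (p - 1 + 1)"
      using assms(1,2)[unfolded factor_rel_def, rule_format, OF p1] assms(3) by simp_all
    then have "U (p - 1) @\<^sub>v U (p - 1 + 1) = U' (p - 1) @\<^sub>v U' (p - 1 + 1)" by simp
    then show ?thesis using append_vec_eq[OF assms(4)[OF p1] assms(5)[OF p1]] by simp
  qed (use assms False in \<open>auto simp: factor_rel_def\<close>)
qed

lemma factor_rel_cong:
  assumes "factor_rel T B s V U" "\<And>p. p \<in> B \<Longrightarrow> V p = V' p" "\<And>p. p \<in> B \<Longrightarrow> U p = U' p"
  shows "factor_rel T B s V' U'"
  unfolding factor_rel_def
proof (intro ballI conjI impI)
  fix p assume p: "p \<in> B"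
  note fr = assms(1)[unfolded factor_rel_def, rule_format, OF p]
  show "T p *\<^sub>v (V' p @\<^sub>v V' (p + 1)) = U' p @\<^sub>v U' (p + 1)" if "even (p + s)" "p + 1 \<in> B"
    using fr that assms(2,3)[OF p] assms(2,3)[OF that(2)] by simp
  show "U' p = V' p" if "even (p + s)" "p + 1 \<notin> B" using fr that assms(2,3)[OF p] by simp
  show "U' p = V' p" if "odd (p + s)" "p - 1 \<notin> B" using fr that assms(2,3)[OF p] by simp
qed

text \<open>Lets the infinite matrix be applied to a vector assembled from blocks by checking the
  pairs only.\<close>

lemma imv_of_blks:
  assumes d: "d > 0" and T: "\<And>t. t \<in> B \<Longrightarrow> t + 1 \<in> B \<Longrightarrow> T t \<in> carrier_mat (d + d) (d + d)"
    and VU: "\<And>p. p \<in> B \<Longrightarrow> V p \<in> carrier_vec d" "\<And>p. p \<in> B \<Longrightarrow> U p \<in> carrier_vec d"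
    and fr: "factor_rel T B s V U"
  shows "imv (pair_op d T B s) (of_blks d B V) = of_blks d B U"
proof (rule blk_eqI[OF d, where B = B])
  fix p assume p: "p \<in> B"
  have "factor_rel T B s V (blk d (imv (pair_op d T B s) (of_blks d B V)))"
    by (rule factor_rel_cong[OF factor_rel_imv[OF d T]]) (simp_all add: blk_of_blks d VU)
  from factor_rel_unique[OF this fr p, of d] VU(2) show "blk d (imv (pair_op d T B s) (of_blks d B V)) p = blk d (of_blks d B U) p"
    by (simp add: blk_of_blks d VU p)
qed (auto simp: imv_pair_op_out of_blks_def)


section \<open>Sums over the integers grouped into cells of equal length\<close>

lemma cells_image:
  assumes L: "L > 0" and C: "finite C"
  shows "(\<Sum>c\<in>C. \<Sum>i<L. f (c * int L + off + int i)) = sum f ((\<lambda>(c, i). c * int L + off + int i) ` (C \<times> {..<L}))"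
proof -
  have div: "(c * int L + int i) div int L = c" if "i < L" for c i
    using that by (simp add: div_add1_eq)
  have "inj_on (\<lambda>(c, i). c * int L + off + int i) (C \<times> {..<L})"
  proof (rule inj_onI, clarify)
    fix c i c' i' assume ii: "i < L" "i' < L" "c * int L + off + int i = c' * int L + off + int i'"
    then have "c * int L + int i = c' * int L + int i'" by simp
    with div[OF ii(1), of c] div[OF ii(2), of c'] have "c = c'" by simp
    then show "c = c' \<and> i = i'" using ii by simp
  qed
  then show ?thesis by (subst sum.reindex) (auto simp: sum.cartesian_product o_def split_def)
qed

lemma sum_le_cells:
  fixes f :: "int \<Rightarrow> real"
  assumes L: "L > 0" and A: "finite A" and f: "\<And>x. 0 \<le> f x"
  shows "sum f A \<le> (\<Sum>c\<in>(\<lambda>x. (x - off) div int L) ` A. \<Sum>i<L. f (c * int L + off + int i))"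
proof -
  let ?C = "(\<lambda>x. (x - off) div int L) ` A"
  have "A \<subseteq> (\<lambda>(c, i). c * int L + off + int i) ` (?C \<times> {..<L})"
  proof
    fix x assume x: "x \<in> A"
    have "x = ((x - off) div int L) * int L + off + int (nat ((x - off) mod int L))"
      using L div_mult_mod_eq[of "x - off" "int L"] by simp
    moreover have "nat ((x - off) mod int L) < L" using L by (simp add: nat_less_iff)
    ultimately show "x \<in> (\<lambda>(c, i). c * int L + off + int i) ` (?C \<times> {..<L})" using x by force
  qed
  then show ?thesis unfolding cells_image[OF L finite_imageI[OF A]]
    using A f by (intro sum_mono2) auto
qed

lemma cells_le_infsum:
  fixes f :: "int \<Rightarrow> real"
  assumes L: "L > 0" and C: "finite C" and f: "\<And>x. 0 \<le> f x" "f summable_on UNIV"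
  shows "(\<Sum>c\<in>C. \<Sum>i<L. f (c * int L + off + int i)) \<le> infsum f UNIV"
  unfolding cells_image[OF L C] by (rule finite_sum_le_infsum) (use f C in auto)

lemma summable_infsum_bound:
  fixes f :: "int \<Rightarrow> real"
  assumes "\<And>x. 0 \<le> f x" "\<And>A. finite A \<Longrightarrow> sum f A \<le> C"
  shows "f summable_on UNIV" "infsum f UNIV \<le> C"
proof -
  show s: "f summable_on UNIV"
    by (rule nonneg_bdd_above_summable_on) (use assms in \<open>auto intro!: bdd_aboveI\<close>)
  show "infsum f UNIV \<le> C" by (rule infsum_le_finite_sums[OF s]) (use assms in auto)
qed

text \<open>Every finite set is covered by finitely many cells, and on each cell f and g have the
  same sum. Applied in both directions it yields equality of the infinite sums.\<close>

lemma cells_infsum_le: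
  fixes f g :: "int \<Rightarrow> real"
  assumes L: "L > 0" and f: "\<And>x. 0 \<le> f x" and g: "\<And>x. 0 \<le> g x" "g summable_on UNIV"
    and eq: "\<And>c. (\<Sum>i<L. f (c * int L + off + int i)) = (\<Sum>i<L. g (c * int L + off + int i))"
  shows "f summable_on UNIV" "infsum f UNIV \<le> infsum g UNIV"
proof -
  have "sum f A \<le> infsum g UNIV" if A: "finite A" for A
  proof -
    have "sum f A \<le> (\<Sum>c\<in>(\<lambda>x. (x - off) div int L) ` A. \<Sum>i<L. f (c * int L + off + int i))"
      by (rule sum_le_cells[OF L A f])
    also have "\<dots> \<le> infsum g UNIV" unfolding eq by (rule cells_le_infsum[OF L finite_imageI[OF A] g])
    finally show ?thesis .
  qed
  from summable_infsum_bound[of f, OF f this]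
  show "f summable_on UNIV" "infsum f UNIV \<le> infsum g UNIV" by auto
qed

definition l2sq :: "(int \<Rightarrow> complex) \<Rightarrow> real" where
  "l2sq v = infsum (\<lambda>i. (cmod (v i))\<^sup>2) UNIV"

text \<open>The integers are cut into cells of 2 d indices, each a pair of neighbouring blocks of
  type s. On a cell the factor is an isometry, or it fixes the blocks in B while both vectors vanish
  on the others; so energy is preserved cell by cell.\<close>

lemma pair_op_isometry:
  assumes d: "d > 0" and T: "\<And>t. t \<in> B \<Longrightarrow> t + 1 \<in> B \<Longrightarrow> T t \<in> carrier_mat (d + d) (d + d) \<and> mat_adjoint (T t) * T t = 1\<^sub>m (d + d)"
    and v: "l2 {x. x div int d \<in> B} v"
  shows "l2 {x. x div int d \<in> B} (imv (pair_op d T B s) v)" "l2sq (imv (pair_op d T B s) v) = l2sq v"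
proof -
  let ?u = "imv (pair_op d T B s) v"
  have L: "d + d > 0" using d by simp
  have v0: "v x = 0" if "x div int d \<notin> B" for x using v that by (simp add: l2_def)
  have cell: "(\<Sum>i<d + d. (cmod (?u (c * int (d + d) + - s * int d + int i)))\<^sup>2) =
     (\<Sum>i<d + d. (cmod (v (c * int (d + d) + - s * int d + int i)))\<^sup>2)" for c
  proof -
    \<comment> \<open>The first block of the cell; the offset - s d makes it run through the starts
      of the pairs of type s.\<close>
    define t where "t = 2 * c - s"
    have e: "c * int (d + d) + - s * int d = t * int d" by (simp add: t_def algebra_simps)
    have te: "even (t + s)" by (simp add: t_def)
    show ?thesis unfolding e
    proof (cases "t \<in> B \<and> t + 1 \<in> B")
      case True
      let ?w = "Matrix.vec (d + d) (\<lambda>i. v (t * int d + int i))"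
      have Tt: "T t \<in> carrier_mat (d + d) (d + d)" using T[of t] True by blast
      have "?u (t * int d + int i) = (T t *\<^sub>v ?w) $ i" if "i < d + d" for i
        using that True Tt by (simp add: imv_pair_op_pair[OF d _ _ te that] scalar_prod_def atLeast0LessThan)
      then have "(\<Sum>i<d + d. (cmod (?u (t * int d + int i)))\<^sup>2) = (\<Sum>i<d + d. (cmod ((T t *\<^sub>v ?w) $ i))\<^sup>2)"
        by (intro sum.cong) auto
      also have "\<dots> = nsq (T t *\<^sub>v ?w)" using Tt by (simp add: nsq_def del: index_mult_mat_vec)
      also have "\<dots> = nsq ?w" using T[of t] True by (intro nsq_isometry[of _ "d + d" "d + d"]) auto
      also have "\<dots> = (\<Sum>i<d + d. (cmod (v (t * int d + int i)))\<^sup>2)" by (simp add: nsq_def)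
      finally show "(\<Sum>i<d + d. (cmod (?u (t * int d + int i)))\<^sup>2) = (\<Sum>i<d + d. (cmod (v (t * int d + int i)))\<^sup>2)" .
    next
      case False
      have "?u (t * int d + int i) = v (t * int d + int i)" if i: "i < d + d" for i
      proof (cases "(t * int d + int i) div int d \<in> B")
        case True
        have "pair_start s ((t * int d + int i) div int d) = t"
          unfolding pair_div[OF i] pair_start_eq using te by (cases "i < d"; simp)
        then show ?thesis using True False by (intro imv_pair_op_single) auto
      qed (simp add: imv_pair_op_out v0)
      then show "(\<Sum>i<d + d. (cmod (?u (t * int d + int i)))\<^sup>2) = (\<Sum>i<d + d. (cmod (v (t * int d + int i)))\<^sup>2)"
        by (intro sum.cong) auto
    qed
  qed
  have sv: "(\<lambda>i. (cmod (v i))\<^sup>2) summable_on UNIV" using v by (simp add: l2_def)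
  note 1 = cells_infsum_le[where f = "\<lambda>i. (cmod (?u i))\<^sup>2" and g = "\<lambda>i. (cmod (v i))\<^sup>2", OF L _ _ sv cell]
  have su: "(\<lambda>i. (cmod (?u i))\<^sup>2) summable_on UNIV" by (rule 1) auto
  have "l2sq ?u \<le> l2sq v" unfolding l2sq_def by (rule 1(2)) auto
  moreover have "l2sq v \<le> l2sq ?u" unfolding l2sq_def
    by (rule cells_infsum_le(2)[where f = "\<lambda>i. (cmod (v i))\<^sup>2" and g = "\<lambda>i. (cmod (?u i))\<^sup>2", OF L _ _ su cell[symmetric]]) auto
  ultimately show "l2sq ?u = l2sq v" by simp
  show "l2 {x. x div int d \<in> B} ?u" unfolding l2_def
  proof (intro conjI allI impI)
    show "?u i = 0" if "i \<notin> {x. x div int d \<in> B}" for i by (rule imv_pair_op_out) (use that in simp)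
  qed (rule su)
qed

text \<open>A product of two isometries has no eigenvalue inside the disc: |y|^2 = |z|^2
  |y|^2.\<close>

lemma pair_op_eigen_unique:
  assumes d: "d > 0" and T: "\<And>t. t \<in> B \<Longrightarrow> t + 1 \<in> B \<Longrightarrow> T t \<in> carrier_mat (d + d) (d + d) \<and> mat_adjoint (T t) * T t = 1\<^sub>m (d + d)"
    and z: "cmod z < 1" and y: "l2 {x. x div int d \<in> B} y"
    and eq: "\<And>i. imv (imult (pair_op d T B s) (pair_op d T B s')) y i = z * y i"
  shows "y = (\<lambda>_. 0)"
proof -
  have i1: "l2 {x. x div int d \<in> B} (imv (pair_op d T B s') y)" "l2sq (imv (pair_op d T B s') y) = l2sq y"
    by (rule pair_op_isometry[OF d _ y]; rule T; assumption)+
  have i2: "l2sq (imv (pair_op d T B s) (imv (pair_op d T B s') y)) = l2sq (imv (pair_op d T B s') y)"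
    by (rule pair_op_isometry(2)[OF d _ i1(1)]; rule T; assumption)
  have "imv (pair_op d T B s) (imv (pair_op d T B s') y) = (\<lambda>i. z * y i)"
    using eq by (simp add: fun_eq_iff imv_imult row_finite_pair_op d)
  then have "l2sq (\<lambda>i. z * y i) = l2sq y" using i1(2) i2 by simp
  moreover have "l2sq (\<lambda>i. z * y i) = (cmod z)\<^sup>2 * l2sq y"
    unfolding l2sq_def by (simp add: norm_mult power_mult_distrib infsum_cmult_right')
  ultimately have "(1 - (cmod z)\<^sup>2) * l2sq y = 0" by (simp add: algebra_simps)
  moreover have "(cmod z)\<^sup>2 < 1" using z by (auto simp: abs_square_less_1)
  ultimately have 0: "l2sq y = 0" by simp
  have "(cmod (y i))\<^sup>2 = 0" for i
    by (rule nonneg_infsum_le_0D[where A = UNIV and f = "\<lambda>i. (cmod (y i))\<^sup>2"]) (use 0 y in \<open>auto simp: l2sq_def l2_def\<close>)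
  then show ?thesis by (auto simp: fun_eq_iff)
qed

lemma l2_of_blks:
  assumes d: "d > 0" and V: "\<And>p. p \<in> B \<Longrightarrow> V p \<in> carrier_vec d"
    and C: "\<And>P. finite P \<Longrightarrow> P \<subseteq> B \<Longrightarrow> (\<Sum>p\<in>P. nsq (V p)) \<le> C"
  shows "l2 {x. x div int d \<in> B} (of_blks d B V)"
proof -
  let ?f = "\<lambda>x. (cmod (of_blks d B V x))\<^sup>2"
  have cell: "(\<Sum>i<d. ?f (c * int d + 0 + int i)) = (if c \<in> B then nsq (V c) else 0)" for c
  proof -
    have "(c * int d + int i) div int d = c" "(c * int d + int i) mod int d = int i" if "i < d" for i
      using that pair_div[of i d c] by (auto simp: mod_add_eq)
    then have "?f (c * int d + 0 + int i) = (if c \<in> B then (cmod (V c $ i))\<^sup>2 else 0)" if "i < d" for i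
      using that by (simp add: of_blks_def)
    then show ?thesis using V[of c] by (auto simp: nsq_def intro!: sum.cong)
  qed
  have "sum ?f A \<le> C" if A: "finite A" for A
  proof -
    let ?P = "(\<lambda>x. (x - 0) div int d) ` A"
    have "sum ?f A \<le> (\<Sum>c\<in>?P. \<Sum>i<d. ?f (c * int d + 0 + int i))"
      by (rule sum_le_cells[OF d A]) simp
    also have "\<dots> = (\<Sum>c\<in>?P \<inter> B. nsq (V c))" unfolding cell
      using A by (simp add: sum.If_cases)
    also have "\<dots> \<le> C" by (rule C) (use A in auto)
    finally show ?thesis .
  qed
  then have "?f summable_on UNIV" by (rule summable_infsum_bound(1)[rotated]) auto
  then show ?thesis by (auto simp: l2_def of_blks_def)
qed

section \<open>Solutions on a half-line\<close>

text \<open>Blocks at distance \<open>m\<close> from an end of the window, for \<open>V = M Y\<close> and \<open>U = L V\<close> with \<open>U = z Y\<close> outside the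
  window. The flag \<open>e\<close> says which of the two factors couples the window to the half-line.\<close>

definition half_line_sol :: "nat \<Rightarrow> (nat \<Rightarrow> bool) \<Rightarrow> (nat \<Rightarrow> complex mat) \<Rightarrow> complex \<Rightarrow> complex mat \<Rightarrow> bool \<Rightarrow> complex vec \<Rightarrow>
    (nat \<Rightarrow> complex vec) \<Rightarrow> (nat \<Rightarrow> complex vec) \<Rightarrow> (nat \<Rightarrow> complex vec) \<Rightarrow> real \<Rightarrow> bool" where
  "half_line_sol d P a z g e r0 Y V U C \<longleftrightarrow>
    (if e then U 0 = r0 \<and> V 0 = g *\<^sub>v r0 else V 0 = r0 \<and> Y 0 = g *\<^sub>v r0) \<and>
    (\<forall>m. P m \<longrightarrow> Y m \<in> carrier_vec d \<and> V m \<in> carrier_vec d \<and> U m \<in> carrier_vec d) \<and>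
    (\<forall>m. P (Suc m) \<longrightarrow> U (Suc m) = z \<cdot>\<^sub>v Y (Suc m)) \<and>
    (\<forall>m. (even m \<longleftrightarrow> e) \<longrightarrow> P (Suc m) \<longrightarrow> Theta (a m) *\<^sub>v (V m @\<^sub>v V (Suc m)) = U m @\<^sub>v U (Suc m)) \<and>
    (\<forall>m. (even m \<longleftrightarrow> \<not> e) \<longrightarrow> P (Suc m) \<longrightarrow> Theta (a m) *\<^sub>v (Y m @\<^sub>v Y (Suc m)) = V m @\<^sub>v V (Suc m)) \<and>
    (\<forall>m. (even m \<longleftrightarrow> e) \<longrightarrow> P m \<longrightarrow> \<not> P (Suc m) \<longrightarrow> U m = V m) \<and>
    (\<forall>m. (even m \<longleftrightarrow> \<not> e) \<longrightarrow> P m \<longrightarrow> \<not> P (Suc m) \<longrightarrow> V m = Y m) \<and>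
    (\<forall>n. P n \<longrightarrow> (\<Sum>m=1..n. nsq (Y m)) \<le> C)"

lemma half_line_solD:
  assumes "half_line_sol d P a z g e r0 Y V U C"
  shows "e \<Longrightarrow> U 0 = r0 \<and> V 0 = g *\<^sub>v r0"
    "\<not> e \<Longrightarrow> V 0 = r0 \<and> Y 0 = g *\<^sub>v r0"
    "P m \<Longrightarrow> Y m \<in> carrier_vec d \<and> V m \<in> carrier_vec d \<and> U m \<in> carrier_vec d"
    "P (Suc m) \<Longrightarrow> U (Suc m) = z \<cdot>\<^sub>v Y (Suc m)"
    "(even m \<longleftrightarrow> e) \<Longrightarrow> P (Suc m) \<Longrightarrow> Theta (a m) *\<^sub>v (V m @\<^sub>v V (Suc m)) = U m @\<^sub>v U (Suc m)"
    "(even m \<longleftrightarrow> \<not> e) \<Longrightarrow> P (Suc m) \<Longrightarrow> Theta (a m) *\<^sub>v (Y m @\<^sub>v Y (Suc m)) = V m @\<^sub>v V (Suc m)"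
    "(even m \<longleftrightarrow> e) \<Longrightarrow> P m \<Longrightarrow> \<not> P (Suc m) \<Longrightarrow> U m = V m"
    "(even m \<longleftrightarrow> \<not> e) \<Longrightarrow> P m \<Longrightarrow> \<not> P (Suc m) \<Longrightarrow> V m = Y m"
    "P n \<Longrightarrow> (\<Sum>m=1..n. nsq (Y m)) \<le> C"
  using assms by (simp_all add: half_line_sol_def)

text \<open>\<open>R m\<close> is the datum entering block m: it is \<open>U m\<close> where the
  outer factor couples m to m + 1 and \<open>V m\<close> where the inner one does; G times the datum
  is \<open>V m\<close> or \<open>Y m\<close> respectively. A link supplies the next block as c, and
  z is inserted only after a link of the inner factor, the next datum then being U = z Y. The
  energies telescope, which bounds the sums of |Y|^2.\<close>

lemma half_line:
  fixes a :: "nat \<Rightarrow> complex mat" and P :: "nat \<Rightarrow> bool"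
  assumes P: "\<And>m. P (Suc m) \<Longrightarrow> P m"
    and a: "\<And>m. P (Suc m) \<Longrightarrow> a m \<in> carrier_mat d d \<and> opnorm (a m) < 1"
    and nbG: "\<And>m. P m \<Longrightarrow> norm_bd d 1 (G m)"
    and lk: "\<And>m. P (Suc m) \<Longrightarrow> schur_link d (a m) z (G m) (G (Suc m))"
    and G1: "\<And>m. P m \<Longrightarrow> \<not> P (Suc m) \<Longrightarrow> G m = 1\<^sub>m d"
    and z: "cmod z < 1" and r0: "r0 \<in> carrier_vec d"
  shows "\<exists>Y V U C. half_line_sol d P a z (G 0) e r0 Y V U C"
proof -
  define f where "f m x = (if P (Suc m) then (SOME c. c \<in> carrier_vec d \<and>
    Theta (a m) *\<^sub>v ((G m *\<^sub>v x) @\<^sub>v c) = x @\<^sub>v (z \<cdot>\<^sub>v (G (Suc m) *\<^sub>v c))) else 0\<^sub>v d)" for m x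
  have f: "f m x \<in> carrier_vec d" "P (Suc m) \<Longrightarrow> Theta (a m) *\<^sub>v ((G m *\<^sub>v x) @\<^sub>v f m x) = x @\<^sub>v (z \<cdot>\<^sub>v (G (Suc m) *\<^sub>v f m x))"
    if "x \<in> carrier_vec d" for m x
  proof -
    have "\<exists>c. c \<in> carrier_vec d \<and> Theta (a m) *\<^sub>v ((G m *\<^sub>v x) @\<^sub>v c) = x @\<^sub>v (z \<cdot>\<^sub>v (G (Suc m) *\<^sub>v c))" if "P (Suc m)"
      using lk[OF that] \<open>x \<in> carrier_vec d\<close> unfolding schur_link_def by blast
    from someI_ex[OF this] show "f m x \<in> carrier_vec d"
      "P (Suc m) \<Longrightarrow> Theta (a m) *\<^sub>v ((G m *\<^sub>v x) @\<^sub>v f m x) = x @\<^sub>v (z \<cdot>\<^sub>v (G (Suc m) *\<^sub>v f m x))"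
      by (auto simp: f_def)
  qed
  \<comment> \<open>True where the outer factor, taking V to U, couples the blocks m and m + 1; the
    types alternate.\<close>
  define ty where "ty m = (even m \<longleftrightarrow> e)" for m :: nat
  have tyS: "ty (Suc m) \<longleftrightarrow> \<not> ty m" for m by (auto simp: ty_def)
  define R where "R = rec_nat r0 (\<lambda>m x. if ty m then f m x else z \<cdot>\<^sub>v f m x)"
  have R0: "R 0 = r0" and RS: "R (Suc m) = (if ty m then f m (R m) else z \<cdot>\<^sub>v f m (R m))" for m
    by (simp_all add: R_def)
  have R: "R m \<in> carrier_vec d" for m
    by (induct m) (use r0 f in \<open>auto simp: R0 RS\<close>)
  define c where "c m = f m (R m)" for m
  have c: "c m \<in> carrier_vec d" for m using f[OF R] by (simp add: c_def)
  have ceq: "Theta (a m) *\<^sub>v ((G m *\<^sub>v R m) @\<^sub>v c m) = R m @\<^sub>v (z \<cdot>\<^sub>v (G (Suc m) *\<^sub>v c m))" if "P (Suc m)" for m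
    using f(2)[OF R that] by (simp add: c_def)
  have RSc: "R (Suc m) = (if ty m then c m else z \<cdot>\<^sub>v c m)" for m by (simp add: RS c_def)
  define V where "V m = (if ty m then G m *\<^sub>v R m else R m)" for m
  \<comment> \<open>If \<open>ty 0\<close> holds, Y at block 0 belongs to the window and the
    half-line says nothing about it; the zero vector is a placeholder, and the sums below start at
    1.\<close>
  define Y where "Y m = (if ty m then (case m of 0 \<Rightarrow> 0\<^sub>v d | Suc k \<Rightarrow> c k) else G m *\<^sub>v R m)" for m
  define U where "U m = (if ty m then R m else z \<cdot>\<^sub>v (G m *\<^sub>v R m))" for m
  have Gc: "G m \<in> carrier_mat d d" if "P m" for m using nbG[OF that] by (simp add: norm_bd_def)
  have GR: "G m *\<^sub>v R m \<in> carrier_vec d" "G m *\<^sub>v x \<in> carrier_vec d" if "P m" "x \<in> carrier_vec d" for m x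
    using Gc[OF that(1)] that(2) R by (auto intro: mult_mat_vec_carrier)
  have Gz: "G m *\<^sub>v (z \<cdot>\<^sub>v x) = z \<cdot>\<^sub>v (G m *\<^sub>v x)" if "P m" "x \<in> carrier_vec d" for m x
    using Gc[OF that(1)] that(2) by (intro mult_mat_vec)
  have YS: "Y (Suc m) = (if ty m then G (Suc m) *\<^sub>v c m else c m)" for m
    by (simp add: Y_def tyS RSc)
  have VS: "V (Suc m) = (if ty m then c m else z \<cdot>\<^sub>v (G (Suc m) *\<^sub>v c m))" if "P (Suc m)" for m
    by (simp add: V_def tyS RSc Gz[OF that c])
  have US: "U (Suc m) = (if ty m then z \<cdot>\<^sub>v (G (Suc m) *\<^sub>v c m) else z \<cdot>\<^sub>v c m)" for m
    by (simp add: U_def tyS RSc)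
  have r2: "(cmod z)\<^sup>2 < 1" using z by (auto simp: abs_square_less_1)
  define en where "en m = nsq (R m) - nsq (G m *\<^sub>v R m)" for m
  \<comment> \<open>For both types the loss of \<open>en\<close> is exactly (1 - |z|^2) times the
    energy of the new block.\<close>
  have step: "(1 - (cmod z)\<^sup>2) * nsq (Y (Suc m)) = en m - en (Suc m)" if Pm: "P (Suc m)" for m
  proof -
    have "nsq (R m) + nsq (z \<cdot>\<^sub>v (G (Suc m) *\<^sub>v c m)) = nsq (G m *\<^sub>v R m) + nsq (c m)"
      using a[OF Pm] GR(1)[OF P[OF Pm] R] c ceq[OF Pm] by (intro Theta_energy[of "a m" d]) auto
    then have "en m = nsq (c m) - (cmod z)\<^sup>2 * nsq (G (Suc m) *\<^sub>v c m)"
      by (simp add: en_def nsq_smult)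
    then show ?thesis
      by (simp add: en_def YS RSc Gz[OF Pm c] nsq_smult algebra_simps)
  qed
  have en0: "0 \<le> en m" if "P m" for m
    using norm_bd_vec[OF nbG[OF that] R[of m]] by (simp add: en_def)
  have sumY: "P n \<Longrightarrow> (1 - (cmod z)\<^sup>2) * (\<Sum>m=1..n. nsq (Y m)) = en 0 - en n" for n
  proof (induct n)
    case (Suc n)
    have "(\<Sum>m=1..Suc n. nsq (Y m)) = (\<Sum>m=1..n. nsq (Y m)) + nsq (Y (Suc n))" by simp
    then show ?case using Suc P[OF Suc(2)] step[OF Suc(2)] by (simp add: distrib_left)
  qed simp
  have bound: "(\<Sum>m=1..n. nsq (Y m)) \<le> en 0 / (1 - (cmod z)\<^sup>2)" if "P n" for n
    using sumY[OF that] en0[OF that] r2 by (simp add: pos_le_divide_eq mult.commute)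
  have init: "if e then U 0 = r0 \<and> V 0 = G 0 *\<^sub>v r0 else V 0 = r0 \<and> Y 0 = G 0 *\<^sub>v r0"
    by (simp add: U_def V_def Y_def ty_def R0)
  have car: "Y m \<in> carrier_vec d \<and> V m \<in> carrier_vec d \<and> U m \<in> carrier_vec d" if "P m" for m
    using GR(1)[OF that R] R c by (auto simp: Y_def V_def U_def split: nat.split)
  have uz: "U (Suc m) = z \<cdot>\<^sub>v Y (Suc m)" for m by (simp add: US YS)
  have t1: "Theta (a m) *\<^sub>v (V m @\<^sub>v V (Suc m)) = U m @\<^sub>v U (Suc m)" if "ty m" "P (Suc m)" for m
    using that ceq[OF that(2)] by (simp add: VS[OF that(2)] US) (simp add: V_def U_def)
  have t2: "Theta (a m) *\<^sub>v (Y m @\<^sub>v Y (Suc m)) = V m @\<^sub>v V (Suc m)" if "\<not> ty m" "P (Suc m)" for m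
    using that ceq[OF that(2)] by (simp add: VS[OF that(2)] YS) (simp add: V_def Y_def)
  \<comment> \<open>At the last block there is no partner and the factor acts as the identity; the
    terminal value \<open>G m\<close> = 1 says just that.\<close>
  have e1: "U m = V m" if "ty m" "P m" "\<not> P (Suc m)" for m
    using that G1[OF that(2,3)] R by (simp add: U_def V_def)
  have e2: "V m = Y m" if "\<not> ty m" "P m" "\<not> P (Suc m)" for m
    using that G1[OF that(2,3)] R by (simp add: V_def Y_def)
  show ?thesis
    apply (rule exI[of _ Y], rule exI[of _ V], rule exI[of _ U], rule exI[of _ "en 0 / (1 - (cmod z)\<^sup>2)"])
    unfolding half_line_sol_def
    apply (intro conjI allI impI)
    subgoal by (rule init)
    subgoal using car by blast
    subgoal using car by blast
    subgoal using car by blast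
    subgoal by (rule uz)
    subgoal by (rule t1) (simp_all add: ty_def)
    subgoal by (rule t2) (simp_all add: ty_def)
    subgoal by (rule e1) (simp_all add: ty_def)
    subgoal by (rule e2) (simp_all add: ty_def)
    subgoal by (rule bound)
    done
qed

text \<open>The defect operators of -a' (a' the adjoint of a) are those of a exchanged, so Theta of
  -a' is \<open>Theta a\<close> with its block rows and block columns in reversed order.\<close>

lemma Theta_flip:
  assumes a: "a \<in> carrier_mat d d" "opnorm a < 1"
    and car: "u \<in> carrier_vec d" "w \<in> carrier_vec d" "u' \<in> carrier_vec d" "w' \<in> carrier_vec d"
    and eq: "Theta (- mat_adjoint a) *\<^sub>v (u @\<^sub>v w) = u' @\<^sub>v w'"
  shows "Theta a *\<^sub>v (w @\<^sub>v u) = w' @\<^sub>v u'"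
proof -
  have b: "- mat_adjoint a \<in> carrier_mat d d" "opnorm (- mat_adjoint a) < 1"
    using a opnorm_adjoint_less[OF a] by auto
  have neg: "- (- X) = X" for X :: "complex mat" by (intro eq_matI) auto
  have mm: "(- X) * (- Y) = X * Y" if "X \<in> carrier_mat d d" "Y \<in> carrier_mat d d" for X Y :: "complex mat"
    using that by (intro eq_matI) (auto simp: scalar_prod_def)
  have L: "rhoL (- mat_adjoint a) = rhoR a" "rhoR (- mat_adjoint a) = rhoL a"
    unfolding rhoL_def rhoR_def using a by (simp_all add: neg mm)
  have mv: "(- X) *\<^sub>v v = - (X *\<^sub>v v)" if "X \<in> carrier_mat d d" "v \<in> carrier_vec d" for X :: "complex mat" and v
    using that by (intro eq_vecI) auto
  note A = rhoL_props(1)[OF a] rhoR_props(1)[OF a]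
  have e: "(- a *\<^sub>v u + rhoR a *\<^sub>v w) @\<^sub>v (rhoL a *\<^sub>v u - - mat_adjoint a *\<^sub>v w) = u' @\<^sub>v w'"
    using Theta_vec[OF b car(1,2)] eq by (simp add: L neg)
  have e1: "- a *\<^sub>v u + rhoR a *\<^sub>v w = u'" and e2: "rhoL a *\<^sub>v u - - mat_adjoint a *\<^sub>v w = w'"
    using e append_vec_eq[of "- a *\<^sub>v u + rhoR a *\<^sub>v w" d u'] a A car by auto
  have "mat_adjoint a *\<^sub>v w + rhoL a *\<^sub>v u = w'"
    unfolding e2[symmetric] using a A car by (subst mv) (auto intro!: eq_vecI)
  moreover have "rhoR a *\<^sub>v w - a *\<^sub>v u = u'"
    unfolding e1[symmetric] using a A car by (subst mv) (auto intro!: eq_vecI)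
  ultimately show ?thesis by (simp add: Theta_vec[OF a car(2,1)])
qed

text \<open>The families l and r are indexed by the distance from j and from k. Their members at
  distance 0 never enter: the window c supplies the blocks j and k.\<close>

definition glue :: "int \<Rightarrow> int \<Rightarrow> (nat \<Rightarrow> 'a) \<Rightarrow> (int \<Rightarrow> 'a) \<Rightarrow> (nat \<Rightarrow> 'a) \<Rightarrow> int \<Rightarrow> 'a" where
  "glue j k l c r p = (if k < p then r (nat (p - k)) else if p < j then l (nat (j - p)) else c p)"

text \<open>Window and half-line meet in one equation only at an edge crossed by a pair of type s;
  agreement of the members at distance 0 with the window is asked for exactly there.\<close>

lemma factor_rel_glue:
  fixes A B :: "int \<Rightarrow> complex vec"
  assumes conv: "j \<in> I" "k \<in> I" "j \<le> k" "\<And>a b p. a \<in> I \<Longrightarrow> b \<in> I \<Longrightarrow> a \<le> p \<Longrightarrow> p \<le> b \<Longrightarrow> p \<in> I"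
    and r1: "\<And>m. even (k + int m + s) \<Longrightarrow> k + int m + 1 \<in> I \<Longrightarrow> T (k + int m) *\<^sub>v (Ar m @\<^sub>v Ar (Suc m)) = Br m @\<^sub>v Br (Suc m)"
    and r2: "\<And>m. even (k + int m + s) \<Longrightarrow> k + int m \<in> I \<Longrightarrow> k + int m + 1 \<notin> I \<Longrightarrow> Br m = Ar m"
    and l1: "\<And>m. even (j - 1 - int m + s) \<Longrightarrow> j - 1 - int m \<in> I \<Longrightarrow> T (j - 1 - int m) *\<^sub>v (Al (Suc m) @\<^sub>v Al m) = Bl (Suc m) @\<^sub>v Bl m"
    and l2: "\<And>m. even (j - 1 - int m + s) \<Longrightarrow> j - int m \<in> I \<Longrightarrow> j - 1 - int m \<notin> I \<Longrightarrow> Bl m = Al m"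
    and c: "\<And>p. j \<le> p \<Longrightarrow> p < k \<Longrightarrow> even (p + s) \<Longrightarrow> T p *\<^sub>v (A p @\<^sub>v A (p + 1)) = B p @\<^sub>v B (p + 1)"
    and mr: "even (k + s) \<Longrightarrow> Ar 0 = A k \<and> Br 0 = B k"
    and ml: "even (j - 1 + s) \<Longrightarrow> Al 0 = A j \<and> Bl 0 = B j"
  shows "factor_rel T I s (glue j k Al A Ar) (glue j k Bl B Br)"
  unfolding factor_rel_def
proof (intro ballI conjI impI)
  fix p assume p: "p \<in> I"
  { assume e: "even (p + s)" "p + 1 \<in> I"
    \<comment> \<open>The pair (p, p + 1) lies right of k, starts at k, lies in the window, lies
      left of j, or ends at j.\<close>
    consider "k < p" | "p = k" | "j \<le> p" "p < k" | "p + 1 < j" | "p + 1 = j" by linarith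
    then show "T p *\<^sub>v (glue j k Al A Ar p @\<^sub>v glue j k Al A Ar (p + 1)) = glue j k Bl B Br p @\<^sub>v glue j k Bl B Br (p + 1)"
    proof cases
      case 1
      define m where "m = nat (p - k)"
      have m: "p = k + int m" "nat (p + 1 - k) = Suc m" "nat (p - k) = m" using 1 by (auto simp: m_def)
      show ?thesis using r1[of m] e 1 m by (simp add: glue_def)
    next
      case 2
      then show ?thesis using r1[of 0] e mr conv(3) by (simp add: glue_def)
    next
      case 3
      then show ?thesis using c[of p] e by (simp add: glue_def)
    next
      case 4
      define m where "m = nat (j - p - 1)"
      have m: "p = j - 1 - int m" "nat (j - p) = Suc m" "nat (j - (p + 1)) = m" using 4 by (auto simp: m_def)
      show ?thesis using l1[of m] e(1) p 4 m conv(3) by (simp add: glue_def)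
    next
      case 5
      have m: "p = j - 1" using 5 by simp
      show ?thesis using l1[of 0] e(1) p ml conv(3) by (simp add: glue_def m)
    qed }
  { assume e: "even (p + s)" "p + 1 \<notin> I"
    \<comment> \<open>The blocks form an interval, so one without right neighbour cannot lie before
      k.\<close>
    have "k \<le> p" using conv(4)[OF p conv(2), of "p + 1"] e(2) by linarith
    then consider "k < p" | "p = k" by linarith
    then show "glue j k Bl B Br p = glue j k Al A Ar p"
    proof cases
      case 1
      define m where "m = nat (p - k)"
      have m: "p = k + int m" "nat (p - k) = m" using 1 by (auto simp: m_def)
      show ?thesis using r2[of m] e 1 m p by (simp add: glue_def)
    next
      case 2
      then show ?thesis using r2[of 0] e mr conv(3) p by (simp add: glue_def)
    qed }
  { assume e: "odd (p + s)" "p - 1 \<notin> I"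
    have "p \<le> j" using conv(4)[OF conv(1) p, of "p - 1"] e(2) by linarith
    define m where "m = nat (j - p)"
    have m: "p = j - int m" using \<open>p \<le> j\<close> by (auto simp: m_def)
    have e': "even (j - 1 - int m + s)" using e(1) unfolding m by presburger
    show "glue j k Bl B Br p = glue j k Al A Ar p"
    proof (cases "p = j")
      case True
      then have "m = 0" using m by simp
      then show ?thesis using l2[of 0] e e' ml conv(3) p True by (simp add: glue_def)
    next
      case False
      have "p - 1 = j - 1 - int m" using m by simp
      then have "j - 1 - int m \<notin> I" using e(2) by metis
      moreover have "j - int m \<in> I" using p by (simp only: m)
      ultimately have "Bl m = Al m" using l2[of m] e' by blast
      then show ?thesis using m False \<open>p \<le> j\<close> conv(3) by (simp add: glue_def)
    qed }
qed

section \<open>Truncated block CMV matrices\<close>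

lemma imult_shift:
  "imult (\<lambda>x y. A (x + c) (y + c)) (\<lambda>x y. B (x + c) (y + c)) x y = imult A B (x + c) (y + c)"
proof -
  have "bij_betw (\<lambda>w. w + c) UNIV (UNIV :: int set)"
    by (rule bij_betwI[of _ _ _ "\<lambda>w. w - c"]) auto
  from infsum_reindex_bij_betw[OF this, of "\<lambda>w. A (x + c) w * B w (y + c)"]
  show ?thesis by (simp add: imult_def)
qed

text \<open>Moving the origin to block j exchanges the two types of pairing precisely when j is odd;
  this is the origin of the exchange for odd j in \<open>truncC\<close> and
  \<open>truncCh\<close>.\<close>

lemma cmv_factor_shift:
  assumes d: "d > 0" and e: "even (j + s + s')" and jk: "j \<le> k"
  shows "cmv_factor d (\<lambda>i. \<alpha> (j + i)) {0..int (nat (k - j))} s' x y =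
    pair_op d (\<lambda>t. Theta (\<alpha> t)) {j..k} s (x + j * int d) (y + j * int d)"
proof -
  have div: "(x + j * int d) div int d = x div int d + j" for x using d by simp
  have pair_start: "pair_start s (p + j) = pair_start s' p + j" for p
  proof -
    have "even (p + j + s) \<longleftrightarrow> even (p + s')" using e by presburger
    then show ?thesis by (simp only: pair_start_eq) simp
  qed
  have mem: "p + j \<in> {j..k} \<longleftrightarrow> p \<in> {0..int (nat (k - j))}" for p using jk by auto
  have mem1: "p + j + 1 \<in> {j..k} \<longleftrightarrow> p + 1 \<in> {0..int (nat (k - j))}" for p using jk by auto
  have idx: "x + j * int d - (t + j) * int d = x - t * int d" for x t by (simp add: algebra_simps)
  show ?thesis
    unfolding cmv_factor_pair_op pair_op_def Let_def div pair_start mem mem1 idx add_right_cancel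
    by (simp only: add.commute[of _ j])
qed

text \<open>Both truncations in the coordinates of the full lattice: there s = 0 always means C and
  s = 1 its companion, whatever the parity of j.\<close>

definition trunc :: "nat \<Rightarrow> (int \<Rightarrow> complex mat) \<Rightarrow> int \<Rightarrow> int \<Rightarrow> int \<Rightarrow> complex mat" where
  "trunc d \<alpha> j k s = mat ((nat (k - j) + 1) * d) ((nat (k - j) + 1) * d) (\<lambda>(x, y).
     imult (pair_op d (\<lambda>t. Theta (\<alpha> t)) {j..k} s) (pair_op d (\<lambda>t. Theta (\<alpha> t)) {j..k} (1 - s))
       (j * int d + int x) (j * int d + int y))"

lemma cmv_prod_shift:
  assumes d: "d > 0" and jk: "j \<le> k" and e: "even (j + s1 + s1')" "even (j + s2 + s2')"
  shows "imult (cmv_factor d (\<lambda>i. \<alpha> (j + i)) {0..int (nat (k - j))} s1') (cmv_factor d (\<lambda>i. \<alpha> (j + i)) {0..int (nat (k - j))} s2') x y =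
    imult (pair_op d (\<lambda>t. Theta (\<alpha> t)) {j..k} s1) (pair_op d (\<lambda>t. Theta (\<alpha> t)) {j..k} s2) (j * int d + x) (j * int d + y)"
proof -
  have 1: "cmv_factor d (\<lambda>i. \<alpha> (j + i)) {0..int (nat (k - j))} s1' = (\<lambda>x y. pair_op d (\<lambda>t. Theta (\<alpha> t)) {j..k} s1 (x + j * int d) (y + j * int d))"
    by (intro HOL.ext cmv_factor_shift[OF d e(1) jk])
  have 2: "cmv_factor d (\<lambda>i. \<alpha> (j + i)) {0..int (nat (k - j))} s2' = (\<lambda>x y. pair_op d (\<lambda>t. Theta (\<alpha> t)) {j..k} s2 (x + j * int d) (y + j * int d))"
    by (intro HOL.ext cmv_factor_shift[OF d e(2) jk])
  show ?thesis unfolding 1 2 by (simp add: imult_shift add.commute)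
qed

lemma truncC_trunc:
  assumes d: "d > 0" and jk: "j \<le> k"
  shows "truncC d \<alpha> j k = trunc d \<alpha> j k 0" "truncCh d \<alpha> j k = trunc d \<alpha> j k 1"
proof -
  show "truncC d \<alpha> j k = trunc d \<alpha> j k 0"
  proof (cases "even j")
    case True
    have eq: "imult (cmv_factor d (\<lambda>i. \<alpha> (j + i)) {0..int (nat (k - j))} 0) (cmv_factor d (\<lambda>i. \<alpha> (j + i)) {0..int (nat (k - j))} 1) x y =
      imult (pair_op d (\<lambda>t. Theta (\<alpha> t)) {j..k} 0) (pair_op d (\<lambda>t. Theta (\<alpha> t)) {j..k} (1 - 0)) (j * int d + x) (j * int d + y)" for x y
      by (rule cmv_prod_shift[OF d jk]) (use True in simp_all)
    show ?thesis
      unfolding truncC_def cmvC_fin_def cmvC_def cmvL_def cmvM_def trunc_def blocks.simps eq using True by simp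
  next
    case False
    have eq: "imult (cmv_factor d (\<lambda>i. \<alpha> (j + i)) {0..int (nat (k - j))} 1) (cmv_factor d (\<lambda>i. \<alpha> (j + i)) {0..int (nat (k - j))} 0) x y =
      imult (pair_op d (\<lambda>t. Theta (\<alpha> t)) {j..k} 0) (pair_op d (\<lambda>t. Theta (\<alpha> t)) {j..k} (1 - 0)) (j * int d + x) (j * int d + y)" for x y
      by (rule cmv_prod_shift[OF d jk]) (use False in simp_all)
    show ?thesis
      unfolding truncC_def cmvCh_fin_def cmvCh_def cmvL_def cmvM_def trunc_def blocks.simps eq using False by simp
  qed
  show "truncCh d \<alpha> j k = trunc d \<alpha> j k 1"
  proof (cases "even j")
    case True
    have eq: "imult (cmv_factor d (\<lambda>i. \<alpha> (j + i)) {0..int (nat (k - j))} 1) (cmv_factor d (\<lambda>i. \<alpha> (j + i)) {0..int (nat (k - j))} 0) x y =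
      imult (pair_op d (\<lambda>t. Theta (\<alpha> t)) {j..k} 1) (pair_op d (\<lambda>t. Theta (\<alpha> t)) {j..k} (1 - 1)) (j * int d + x) (j * int d + y)" for x y
      by (rule cmv_prod_shift[OF d jk]) (use True in simp_all)
    show ?thesis
      unfolding truncCh_def cmvCh_fin_def cmvCh_def cmvL_def cmvM_def trunc_def blocks.simps eq using True by simp
  next
    case False
    have eq: "imult (cmv_factor d (\<lambda>i. \<alpha> (j + i)) {0..int (nat (k - j))} 0) (cmv_factor d (\<lambda>i. \<alpha> (j + i)) {0..int (nat (k - j))} 1) x y =
      imult (pair_op d (\<lambda>t. Theta (\<alpha> t)) {j..k} 1) (pair_op d (\<lambda>t. Theta (\<alpha> t)) {j..k} (1 - 1)) (j * int d + x) (j * int d + y)" for x y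
      by (rule cmv_prod_shift[OF d jk]) (use False in simp_all)
    show ?thesis
      unfolding truncCh_def cmvC_fin_def cmvC_def cmvL_def cmvM_def trunc_def blocks.simps eq using False by simp
  qed
qed

lemma pair_op_adjoint:
  assumes d: "d > 0" and T: "\<And>t. t \<in> B \<Longrightarrow> t + 1 \<in> B \<Longrightarrow> T t \<in> carrier_mat (d + d) (d + d)"
  shows "cnj (pair_op d T B s y x) = pair_op d (\<lambda>t. mat_adjoint (T t)) B s x y"
proof -
  have "mat_adjoint (T t) $$ (nat (x - t * int d), nat (y - t * int d)) = cnj (T t $$ (nat (y - t * int d), nat (x - t * int d)))"
    if "t \<in> B" "t + 1 \<in> B" "pair_start s (x div int d) = t" "pair_start s (y div int d) = t" for t
  proof -
    have xd: "x div int d = t \<or> x div int d = t + 1" "y div int d = t \<or> y div int d = t + 1"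
      using that(3,4) by (auto simp: pair_start_eq split: if_splits)
    obtain a where a: "a < d + d" "x = t * int d + int a" by (rule div_in_pair[OF d xd(1)])
    obtain b where b: "b < d + d" "y = t * int d + int b" by (rule div_in_pair[OF d xd(2)])
    show ?thesis using a b T[OF that(1,2)] by simp
  qed
  then show ?thesis by (auto simp: pair_op_def Let_def)
qed

lemma imult_adjoint:
  assumes "\<And>x y. cnj (A y x) = A' x y" "\<And>x y. cnj (B y x) = B' x y"
  shows "cnj (imult A B y x) = imult B' A' x y"
  unfolding imult_def by (simp add: assms mult.commute flip: infsum_cnj)

lemma imv_vext: "imv A (vext lo n w) x = (\<Sum>c<n. A x (lo + int c) * w $ c)"
proof -
  let ?f = "\<lambda>c. lo + int c"
  have "imv A (vext lo n w) x = infsum (\<lambda>y. A x y * vext lo n w y) (?f ` {..<n})"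
    unfolding imv_def
  proof (rule infsum_cong_neutral)
    fix y assume "y \<in> UNIV - ?f ` {..<n}"
    then have "\<not> (lo \<le> y \<and> y < lo + int n)"
    proof -
      assume y: "y \<in> UNIV - ?f ` {..<n}"
      have "y = ?f (nat (y - lo)) \<and> nat (y - lo) < n" if "lo \<le> y \<and> y < lo + int n" using that by auto
      then show ?thesis using y by blast
    qed
    then show "A x y * vext lo n w y = 0" by (auto simp: vext_def)
  qed auto
  also have "\<dots> = (\<Sum>y\<in>?f ` {..<n}. A x y * vext lo n w y)" by simp
  also have "\<dots> = (\<Sum>c<n. A x (?f c) * vext lo n w (?f c))"
    by (subst sum.reindex) (auto simp: inj_on_def)
  also have "\<dots> = (\<Sum>c<n. A x (lo + int c) * w $ c)"
    by (intro sum.cong) (auto simp: vext_def)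
  finally show ?thesis .
qed

text \<open>Taking adjoints reverses the order of the factors, so the one of type s acts first, on
  the window vector extended by zero.\<close>

lemma trunc_adjoint_vec:
  assumes d: "d > 0" and T: "\<And>t. t \<in> {j..k} \<Longrightarrow> t + 1 \<in> {j..k} \<Longrightarrow> Theta (\<alpha> t) \<in> carrier_mat (d + d) (d + d)"
    and n: "n = (nat (k - j) + 1) * d" and w: "w \<in> carrier_vec n"
  shows "mat_adjoint (trunc d \<alpha> j k s) *\<^sub>v w = Matrix.vec n (\<lambda>r.
     imv (pair_op d (\<lambda>t. mat_adjoint (Theta (\<alpha> t))) {j..k} (1 - s))
       (imv (pair_op d (\<lambda>t. mat_adjoint (Theta (\<alpha> t))) {j..k} s) (vext (j * int d) n w)) (j * int d + int r))"
proof (rule eq_vecI)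
  let ?T = "\<lambda>t. Theta (\<alpha> t)" and ?J = "{j..k}"
  let ?Td = "\<lambda>t. mat_adjoint (?T t)"
  fix r assume "r < dim_vec (Matrix.vec n (\<lambda>r. imv (pair_op d ?Td ?J (1 - s)) (imv (pair_op d ?Td ?J s) (vext (j * int d) n w)) (j * int d + int r)))"
  then have r: "r < n" by simp
  have ca: "cnj (pair_op d ?T ?J s y x) = pair_op d ?Td ?J s x y" for s x y
    by (rule pair_op_adjoint[OF d]) (rule T; assumption)
  have im: "cnj (imult (pair_op d ?T ?J s) (pair_op d ?T ?J (1 - s)) y x) = imult (pair_op d ?Td ?J (1 - s)) (pair_op d ?Td ?J s) x y" for x y
    by (rule imult_adjoint) (rule ca)+
  have "cnj (trunc d \<alpha> j k s $$ (c, r)) = imult (pair_op d ?Td ?J (1 - s)) (pair_op d ?Td ?J s) (j * int d + int r) (j * int d + int c)"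
    if "c < n" for c
    using that r n im[of "j * int d + int c" "j * int d + int r"] by (simp add: trunc_def)
  then have "(mat_adjoint (trunc d \<alpha> j k s) *\<^sub>v w) $ r =
    (\<Sum>c<n. imult (pair_op d ?Td ?J (1 - s)) (pair_op d ?Td ?J s) (j * int d + int r) (j * int d + int c) * w $ c)"
    using w r n by (simp add: trunc_def scalar_prod_def atLeast0LessThan)
  also have "\<dots> = imv (imult (pair_op d ?Td ?J (1 - s)) (pair_op d ?Td ?J s)) (vext (j * int d) n w) (j * int d + int r)"
    by (rule imv_vext[symmetric])
  also have "\<dots> = imv (pair_op d ?Td ?J (1 - s)) (imv (pair_op d ?Td ?J s) (vext (j * int d) n w)) (j * int d + int r)"
    by (simp add: imv_imult row_finite_pair_op d)
  finally show "(mat_adjoint (trunc d \<alpha> j k s) *\<^sub>v w) $ r = Matrix.vec n (\<lambda>r. imv (pair_op d ?Td ?J (1 - s)) (imv (pair_op d ?Td ?J s) (vext (j * int d) n w)) (j * int d + int r)) $ r"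
    using r by simp
qed (simp add: trunc_def n)

text \<open>Unpaired blocks are fixed in either direction, and on pairs T undoes T'. With T' the
  adjoint of a unitary T, this turns the adjoint truncation into forward equations.\<close>

lemma factor_rel_inverse:
  assumes fr: "factor_rel T' B s X V" and TT: "\<And>t. t \<in> B \<Longrightarrow> t + 1 \<in> B \<Longrightarrow>
      T t \<in> carrier_mat (d + d) (d + d) \<and> T' t \<in> carrier_mat (d + d) (d + d) \<and> T t * T' t = 1\<^sub>m (d + d)"
    and X: "\<And>p. p \<in> B \<Longrightarrow> X p \<in> carrier_vec d"
  shows "factor_rel T B s V X"
  unfolding factor_rel_def
proof (intro ballI conjI impI)
  fix p assume p: "p \<in> B"
  note fr = fr[unfolded factor_rel_def, rule_format, OF p]
  show "T p *\<^sub>v (V p @\<^sub>v V (p + 1)) = X p @\<^sub>v X (p + 1)" if "even (p + s)" "p + 1 \<in> B"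
  proof -
    have c: "X p @\<^sub>v X (p + 1) \<in> carrier_vec (d + d)" using X[OF p] X[OF that(2)] by auto
    have "T p *\<^sub>v (V p @\<^sub>v V (p + 1)) = T p *\<^sub>v (T' p *\<^sub>v (X p @\<^sub>v X (p + 1)))"
      using fr that by simp
    also have "\<dots> = X p @\<^sub>v X (p + 1)"
      using TT[OF p that(2)] c by (intro mat_vec_cancel_left[of _ "d + d"]) auto
    finally show ?thesis .
  qed
  show "X p = V p" if "even (p + s)" "p + 1 \<notin> B" using fr that by simp
  show "X p = V p" if "odd (p + s)" "p - 1 \<notin> B" using fr that by simp
qed

section \<open>Block-diagonal matrices acting on the edge blocks\<close>

lemma bdiag_vec:
  assumes P: "P \<in> carrier_mat a a" and Q: "Q \<in> carrier_mat c c" and w: "w \<in> carrier_vec (a + c)" and i: "i < a + c"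
  shows "(bdiag P Q *\<^sub>v w) $ i = (if i < a then (P *\<^sub>v Matrix.vec a (\<lambda>i. w $ i)) $ i
     else (Q *\<^sub>v Matrix.vec c (\<lambda>i. w $ (a + i))) $ (i - a))"
proof -
  let ?u = "Matrix.vec a (\<lambda>i. w $ i)" and ?v = "Matrix.vec c (\<lambda>i. w $ (a + i))"
  have ww: "w = ?u @\<^sub>v ?v" using w by (intro eq_vecI) auto
  have 0: "0\<^sub>m a c *\<^sub>v ?v = 0\<^sub>v a" "0\<^sub>m c a *\<^sub>v ?u = 0\<^sub>v c" by (auto intro!: eq_vecI)
  have "bdiag P Q *\<^sub>v (?u @\<^sub>v ?v) = (P *\<^sub>v ?u + 0\<^sub>m a c *\<^sub>v ?v) @\<^sub>v (0\<^sub>m c a *\<^sub>v ?u + Q *\<^sub>v ?v)"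
    unfolding bdiag_def using P Q by (subst four_block_mat_mult_vec[of _ a a _ c _ c]) auto
  also have "\<dots> = (P *\<^sub>v ?u) @\<^sub>v (Q *\<^sub>v ?v)" unfolding 0 using P Q by auto
  finally have "bdiag P Q *\<^sub>v w = (P *\<^sub>v ?u) @\<^sub>v (Q *\<^sub>v ?v)" using ww by simp
  then show ?thesis using P Q i by (auto simp del: index_mult_mat_vec)
qed

lemma bdiag_carrier:
  "P \<in> carrier_mat a a \<Longrightarrow> Q \<in> carrier_mat c c \<Longrightarrow> bdiag P Q \<in> carrier_mat (a + c) (a + c)"
  unfolding bdiag_def by auto

text \<open>b sits at j if type s pairs j - 1 with j, and f at k if it pairs k with k + 1. For j = k
  the parities exclude each other, so the order of the cases is immaterial.\<close>

definition edge_mat :: "nat \<Rightarrow> int \<Rightarrow> int \<Rightarrow> complex mat \<Rightarrow> complex mat \<Rightarrow> int \<Rightarrow> int \<Rightarrow> complex mat" where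
  "edge_mat d j k b f s p = (if p = j \<and> even (j - 1 + s) then b else if p = k \<and> even (k + s) then f else 1\<^sub>m d)"

text \<open>Characterises the \<open>bdiag\<close> shapes of the theorem, and the identity, by their
  action on blocks, so that one proof covers all combinations of parities.\<close>

definition acts_on_edges :: "nat \<Rightarrow> int \<Rightarrow> int \<Rightarrow> complex mat \<Rightarrow> complex mat \<Rightarrow> int \<Rightarrow> complex mat \<Rightarrow> bool" where
  "acts_on_edges d j k b f s D \<longleftrightarrow> D \<in> carrier_mat ((nat (k - j) + 1) * d) ((nat (k - j) + 1) * d) \<and>
     (\<forall>x\<in>carrier_vec ((nat (k - j) + 1) * d). \<forall>q\<le>nat (k - j).
        Matrix.vec d (\<lambda>i. (D *\<^sub>v x) $ (q * d + i)) = edge_mat d j k b f s (j + int q) *\<^sub>v Matrix.vec d (\<lambda>i. x $ (q * d + i)))"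

lemma acts_on_edges_one:
  assumes "odd (j - 1 + s)" "odd (k + s)"
  shows "acts_on_edges d j k b f s (1\<^sub>m ((nat (k - j) + 1) * d))"
  using assms by (auto simp: acts_on_edges_def edge_mat_def)

lemma block_index: "q \<le> M \<Longrightarrow> i < d \<Longrightarrow> q * d + i < (M + 1) * (d::nat)"
proof -
  assume "q \<le> M" "i < d"
  then have "q * d + i < q * d + d" "q * d \<le> M * d" by (simp, intro mult_le_mono1)
  then have "q * d + i < M * d + d" by linarith
  then show ?thesis by simp
qed

lemma acts_on_edges_b:
  assumes jk: "j \<le> k" and e: "even (j - 1 + s)" "odd (k + s)" and b: "b \<in> carrier_mat d d"
  shows "acts_on_edges d j k b f s (bdiag b (1\<^sub>m (nat (k - j) * d)))"
proof -
  let ?M = "nat (k - j)"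
  have n: "(?M + 1) * d = d + ?M * d" by simp
  have "Matrix.vec d (\<lambda>i. (bdiag b (1\<^sub>m (?M * d)) *\<^sub>v x) $ (q * d + i)) = edge_mat d j k b f s (j + int q) *\<^sub>v Matrix.vec d (\<lambda>i. x $ (q * d + i))"
    if x: "x \<in> carrier_vec (d + ?M * d)" and q: "q \<le> ?M" for x q
  proof (rule eq_vecI)
    fix i assume "i < dim_vec (edge_mat d j k b f s (j + int q) *\<^sub>v Matrix.vec d (\<lambda>i. x $ (q * d + i)))"
    then have i: "i < d" using b e by (auto simp: edge_mat_def split: if_splits)
    note bl = bdiag_vec[OF b one_carrier_mat x, of "q * d + i"]
    have lt: "q * d + i < d + ?M * d" using block_index[OF q i] by simp
    show "Matrix.vec d (\<lambda>i. (bdiag b (1\<^sub>m (?M * d)) *\<^sub>v x) $ (q * d + i)) $ i = (edge_mat d j k b f s (j + int q) *\<^sub>v Matrix.vec d (\<lambda>i. x $ (q * d + i))) $ i"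
    proof (cases "q = 0")
      case True
      then show ?thesis using i e bl lt by (simp add: edge_mat_def del: index_mult_mat_vec)
    next
      case False
      then have ge: "\<not> q * d + i < d" by (cases q) auto
      then have "(bdiag b (1\<^sub>m (?M * d)) *\<^sub>v x) $ (q * d + i) = x $ (q * d + i)"
        using bl[OF lt] lt by (simp del: index_mult_mat_vec)
      then show ?thesis using i e False by (simp add: edge_mat_def del: index_mult_mat_vec)
    qed
  qed (use b e in \<open>auto simp: edge_mat_def\<close>)
  then show ?thesis using bdiag_carrier[OF b one_carrier_mat, of "?M * d"] unfolding acts_on_edges_def n by blast
qed

lemma acts_on_edges_f:
  assumes jk: "j \<le> k" and e: "odd (j - 1 + s)" "even (k + s)" and f: "f \<in> carrier_mat d d"
  shows "acts_on_edges d j k b f s (bdiag (1\<^sub>m (nat (k - j) * d)) f)"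
proof -
  let ?M = "nat (k - j)"
  have n: "(?M + 1) * d = ?M * d + d" by simp
  have "Matrix.vec d (\<lambda>i. (bdiag (1\<^sub>m (?M * d)) f *\<^sub>v x) $ (q * d + i)) = edge_mat d j k b f s (j + int q) *\<^sub>v Matrix.vec d (\<lambda>i. x $ (q * d + i))"
    if x: "x \<in> carrier_vec (?M * d + d)" and q: "q \<le> ?M" for x q
  proof (rule eq_vecI)
    fix i assume "i < dim_vec (edge_mat d j k b f s (j + int q) *\<^sub>v Matrix.vec d (\<lambda>i. x $ (q * d + i)))"
    then have i: "i < d" using f e by (auto simp: edge_mat_def split: if_splits)
    note bl = bdiag_vec[OF one_carrier_mat f x, of "q * d + i"]
    have lt: "q * d + i < ?M * d + d" using block_index[OF q i] by simp
    show "Matrix.vec d (\<lambda>i. (bdiag (1\<^sub>m (?M * d)) f *\<^sub>v x) $ (q * d + i)) $ i = (edge_mat d j k b f s (j + int q) *\<^sub>v Matrix.vec d (\<lambda>i. x $ (q * d + i))) $ i"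
    proof (cases "q = ?M")
      case True
      then show ?thesis using i e bl lt jk by (simp add: edge_mat_def del: index_mult_mat_vec)
    next
      case False
      then have "q \<le> ?M - 1" "?M \<ge> 1" using q by auto
      then have l: "q * d + i < ?M * d" using block_index[of q "?M - 1" i d] i by simp
      then have "(bdiag (1\<^sub>m (?M * d)) f *\<^sub>v x) $ (q * d + i) = x $ (q * d + i)"
        using bl[OF lt] lt by (simp del: index_mult_mat_vec)
      moreover have "j + int q \<noteq> k" using False by auto
      ultimately show ?thesis using i e by (simp add: edge_mat_def del: index_mult_mat_vec)
    qed
  qed (use f e in \<open>auto simp: edge_mat_def\<close>)
  then show ?thesis using bdiag_carrier[OF one_carrier_mat f, of "?M * d"] unfolding acts_on_edges_def n by blast
qed

text \<open>Both edges are cut by the same factor only if j and k differ in parity, so j < k, and k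
  - j - 1 blocks remain in the middle.\<close>

lemma acts_on_edges_bf:
  assumes jk: "j < k" and e: "even (j - 1 + s)" "even (k + s)" and b: "b \<in> carrier_mat d d" and f: "f \<in> carrier_mat d d"
  shows "acts_on_edges d j k b f s (bdiag (bdiag b (1\<^sub>m ((nat (k - j) - 1) * d))) f)"
proof -
  let ?M = "nat (k - j)" and ?I = "1\<^sub>m ((nat (k - j) - 1) * d) :: complex mat"
  have M: "?M \<ge> 1" using jk by simp
  have dM: "d + (?M - 1) * d = ?M * d" using M by (cases ?M) auto
  then have bi: "bdiag b ?I \<in> carrier_mat (?M * d) (?M * d)"
    using bdiag_carrier[OF b one_carrier_mat, of "(?M - 1) * d"] by simp
  have n: "(?M + 1) * d = ?M * d + d" by simp
  have "Matrix.vec d (\<lambda>i. (bdiag (bdiag b ?I) f *\<^sub>v x) $ (q * d + i)) = edge_mat d j k b f s (j + int q) *\<^sub>v Matrix.vec d (\<lambda>i. x $ (q * d + i))"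
    if x: "x \<in> carrier_vec (?M * d + d)" and q: "q \<le> ?M" for x q
  proof (rule eq_vecI)
    fix i assume "i < dim_vec (edge_mat d j k b f s (j + int q) *\<^sub>v Matrix.vec d (\<lambda>i. x $ (q * d + i)))"
    then have i: "i < d" using b f e by (auto simp: edge_mat_def split: if_splits)
    note bl = bdiag_vec[OF bi f x, of "q * d + i"]
    have lt: "q * d + i < ?M * d + d" using block_index[OF q i] by simp
    show "Matrix.vec d (\<lambda>i. (bdiag (bdiag b ?I) f *\<^sub>v x) $ (q * d + i)) $ i = (edge_mat d j k b f s (j + int q) *\<^sub>v Matrix.vec d (\<lambda>i. x $ (q * d + i))) $ i"
    proof (cases "q = ?M")
      case True
      then show ?thesis using i e bl lt jk by (simp add: edge_mat_def del: index_mult_mat_vec)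
    next
      case False
      then have "q \<le> ?M - 1" using q by auto
      then have l: "q * d + i < ?M * d" using block_index[of q "?M - 1" i d] i M by simp
      have qk: "j + int q \<noteq> k" using False by auto
      \<comment> \<open>The vector without its last block, on which the inner \<open>bdiag\<close>
        acts.\<close>
      define x' where "x' = Matrix.vec (?M * d) (\<lambda>i. x $ i)"
      have e1: "(bdiag (bdiag b ?I) f *\<^sub>v x) $ (q * d + i) = (bdiag b ?I *\<^sub>v x') $ (q * d + i)"
        using bl[OF lt] l by (simp add: x'_def del: index_mult_mat_vec)
      have x': "x' \<in> carrier_vec (d + (?M - 1) * d)" unfolding dM by (simp add: x'_def)
      note bl2 = bdiag_vec[OF b one_carrier_mat x', of "q * d + i", unfolded dM, OF l]
      show ?thesis
      proof (cases "q = 0")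
        case True
        have dle: "d \<le> ?M * d" using dM by linarith
        have "x' $ i = x $ i" if "i < d" for i
          using less_le_trans[OF that dle] by (simp add: x'_def)
        then have "Matrix.vec d (\<lambda>i. x' $ i) = Matrix.vec d (\<lambda>i. x $ i)"
          by (intro eq_vecI) simp_all
        then show ?thesis using True i e bl2 e1 by (simp add: edge_mat_def del: index_mult_mat_vec)
      next
        case False
        then have ge: "\<not> q * d + i < d" by (cases q) auto
        have lt2: "q * d + i - d < (?M - 1) * d" using l ge dM by linarith
        have "(bdiag b ?I *\<^sub>v x') $ (q * d + i) = x' $ (q * d + i)"
          using bl2 ge lt2 by (simp del: index_mult_mat_vec)
        also have "\<dots> = x $ (q * d + i)" using l by (simp add: x'_def)
        finally show ?thesis using i e False qk e1 by (simp add: edge_mat_def del: index_mult_mat_vec)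
      qed
    qed
  qed (use b f e in \<open>auto simp: edge_mat_def\<close>)
  then show ?thesis using bdiag_carrier[OF bi f] unfolding acts_on_edges_def n by blast
qed

section \<open>Schur functions of block CMV matrices\<close>

lemma alpha_idx_iff: "i \<in> alpha_idx K \<longleftrightarrow> i \<in> blocks K \<and> i + 1 \<in> blocks K"
  by (cases K) auto

lemma blocks_convex: "a \<in> blocks K \<Longrightarrow> b \<in> blocks K \<Longrightarrow> a \<le> p \<Longrightarrow> p \<le> b \<Longrightarrow> p \<in> blocks K"
  by (cases K) auto

lemma blk_vext:
  assumes p: "j \<le> p" "p \<le> k"
  shows "blk d (vext (j * int d) ((nat (k - j) + 1) * d) x) p = Matrix.vec d (\<lambda>i. x $ (nat (p - j) * d + i))"
proof (rule eq_vecI)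
  fix i assume "i < dim_vec (Matrix.vec d (\<lambda>i. x $ (nat (p - j) * d + i)))"
  then have i: "i < d" by simp
  define q where "q = nat (p - j)"
  have q: "p = j + int q" "q \<le> nat (k - j)" using p by (auto simp: q_def)
  have e: "p * int d + int i = j * int d + int (q * d + i)" by (simp add: q algebra_simps)
  have "q * d + i < (nat (k - j) + 1) * d" by (rule block_index[OF q(2) i])
  then have "vext (j * int d) ((nat (k - j) + 1) * d) x (j * int d + int (q * d + i)) = x $ (q * d + i)"
    unfolding vext_def by (simp del: of_nat_add of_nat_mult)
  then show "blk d (vext (j * int d) ((nat (k - j) + 1) * d) x) p $ i = Matrix.vec d (\<lambda>i. x $ (nat (p - j) * d + i)) $ i"
    using i by (simp only: blk_def index_vec e q_def)
qed (simp add: blk_def)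

lemma blk_at:
  assumes "d > 0"
  shows "v x = blk d v (x div int d) $ nat (x mod int d)"
  using assms by (simp add: blk_def nat_less_iff)

lemma acts_on_edges_blk:
  assumes D: "acts_on_edges d j k b f s D" and x: "x \<in> carrier_vec ((nat (k - j) + 1) * d)" and p: "j \<le> p" "p \<le> k"
  shows "blk d (vext (j * int d) ((nat (k - j) + 1) * d) (D *\<^sub>v x)) p =
    edge_mat d j k b f s p *\<^sub>v blk d (vext (j * int d) ((nat (k - j) + 1) * d) x) p"
proof -
  have "nat (p - j) \<le> nat (k - j)" "j + int (nat (p - j)) = p" using p by auto
  then show ?thesis using D x unfolding acts_on_edges_def blk_vext[OF p] by metis
qed

text \<open>The half-line bounds concern the segments 1, ..., n, while square summability is tested
  on arbitrary finite sets.\<close>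

lemma sum_le_initial_segments:
  fixes g :: "nat \<Rightarrow> real"
  assumes g: "\<And>m. 0 \<le> g m" and C: "\<And>n. P n \<Longrightarrow> (\<Sum>m=1..n. g m) \<le> C" and P0: "P 0"
    and M: "finite M" "\<And>m. m \<in> M \<Longrightarrow> P m \<and> m \<ge> 1"
  shows "sum g M \<le> C"
proof (cases "M = {}")
  case True
  then show ?thesis using C[OF P0] by simp
next
  case False
  have "sum g M \<le> (\<Sum>m=1..Max M. g m)"
    using M g by (intro sum_mono2) auto
  also have "\<dots> \<le> C" using M Max_in[OF M(1) False] by (intro C) auto
  finally show ?thesis .
qed

lemma sum_glue_le:
  fixes g :: "complex vec \<Rightarrow> real"
  assumes g: "\<And>v. 0 \<le> g v" and P: "finite P"
    and r: "\<And>M. finite M \<Longrightarrow> (\<And>m. m \<in> M \<Longrightarrow> k + int m \<in> P \<and> m \<ge> 1) \<Longrightarrow> (\<Sum>m\<in>M. g (r m)) \<le> Cr"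
    and l: "\<And>M. finite M \<Longrightarrow> (\<And>m. m \<in> M \<Longrightarrow> j - int m \<in> P \<and> m \<ge> 1) \<Longrightarrow> (\<Sum>m\<in>M. g (l m)) \<le> Cl"
  shows "(\<Sum>p\<in>P. g (glue j k l c r p)) \<le> Cr + Cl + (\<Sum>p\<in>{j..k}. g (c p))"
proof -
  let ?f = "\<lambda>p. g (glue j k l c r p)"
  let ?R = "{p\<in>P. k < p}" and ?L = "{p\<in>P. p < j \<and> p \<le> k}" and ?C = "{p\<in>P. j \<le> p \<and> p \<le> k}"
  have "P = ?R \<union> (?L \<union> ?C)" by auto
  then have "sum ?f P = sum ?f (?R \<union> (?L \<union> ?C))" by simp
  also have "\<dots> = sum ?f ?R + sum ?f (?L \<union> ?C)" using P by (intro sum.union_disjoint) auto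
  also have "sum ?f (?L \<union> ?C) = sum ?f ?L + sum ?f ?C" using P by (intro sum.union_disjoint) auto
  finally have split: "sum ?f P = sum ?f ?R + (sum ?f ?L + sum ?f ?C)" .
  have "sum ?f ?R = (\<Sum>m\<in>(\<lambda>p. nat (p - k)) ` ?R. g (r m))"
    by (subst sum.reindex) (auto simp: inj_on_def glue_def intro!: sum.cong)
  also have "\<dots> \<le> Cr" by (rule r) (use P in auto)
  finally have 1: "sum ?f ?R \<le> Cr" .
  have "sum ?f ?L = (\<Sum>m\<in>(\<lambda>p. nat (j - p)) ` ?L. g (l m))"
    by (subst sum.reindex) (auto simp: inj_on_def glue_def intro!: sum.cong)
  also have "\<dots> \<le> Cl" by (rule l) (use P in auto)
  finally have 2: "sum ?f ?L \<le> Cl" .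
  have "sum ?f ?C = (\<Sum>p\<in>?C. g (c p))" by (intro sum.cong) (auto simp: glue_def)
  also have "\<dots> \<le> (\<Sum>p\<in>{j..k}. g (c p))" using g by (intro sum_mono2) auto
  finally have 3: "sum ?f ?C \<le> (\<Sum>p\<in>{j..k}. g (c p))" .
  from split 1 2 3 show ?thesis by linarith
qed

lemma vext_support:
  assumes d: "d > 0" and jk: "j \<le> k"
  shows "j * int d \<le> i \<and> i < j * int d + int ((nat (k - j) + 1) * d) \<longleftrightarrow> j \<le> i div int d \<and> i div int d \<le> k"
proof -
  define p where "p = i div int d"
  define r where "r = i mod int d"
  have i: "i = p * int d + r" "0 \<le> r" "r < int d" using d by (auto simp: p_def r_def)
  have n: "j * int d + int ((nat (k - j) + 1) * d) = k * int d + int d" using jk by (simp add: algebra_simps)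
  have lo: "j * int d \<le> i \<longleftrightarrow> j \<le> p"
  proof
    assume "j \<le> p"
    then have "j * int d \<le> p * int d" by (intro mult_right_mono) auto
    then show "j * int d \<le> i" using i by linarith
  next
    assume le: "j * int d \<le> i"
    show "j \<le> p"
    proof (rule ccontr)
      assume "\<not> j \<le> p"
      then have "(p + 1) * int d \<le> j * int d" by (intro mult_right_mono) auto
      then have "p * int d + int d \<le> j * int d" by (simp add: distrib_right)
      then show False using le i by linarith
    qed
  qed
  have hi: "i < k * int d + int d \<longleftrightarrow> p \<le> k"
  proof
    assume "p \<le> k"
    then have "p * int d \<le> k * int d" by (intro mult_right_mono) auto
    then show "i < k * int d + int d" using i by linarith
  next
    assume lt: "i < k * int d + int d"
    show "p \<le> k"
    proof (rule ccontr)
      assume "\<not> p \<le> k"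
      then have "(k + 1) * int d \<le> p * int d" by (intro mult_right_mono) auto
      then have "k * int d + int d \<le> p * int d" by (simp add: distrib_right)
      then show False using lt i by linarith
    qed
  qed
  show ?thesis unfolding n using lo hi by (simp add: p_def)
qed

text \<open>With x the window part of U y, the truncated factors satisfy: type s maps V to D x, type
  1 - s maps y' to V. Here D and D' carry b and f at the edge blocks cut by the respective factor.
  So y' comes from D x by the adjoint truncation A, and the window part of y is D' y'. The
  half-lines continue these blocks to the whole lattice, and \<open>subspace_schur_eqI\<close>
  applies with \<Phi> = D' A D.\<close>

lemma subspace_schur_cmv:
  fixes \<alpha> :: "int \<Rightarrow> complex mat"
  assumes d: "d > 0" and al: "\<forall>i\<in>alpha_idx K. \<alpha> i \<in> carrier_mat d d \<and> opnorm (\<alpha> i) < 1"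
    and j: "j \<in> blocks K" and k: "k \<in> blocks K" and jk: "j \<le> k" and z: "z \<in> ball 0 1 - {0}"
    and D: "acts_on_edges d j k (b_iter d K \<alpha> j z) (f_iter d K \<alpha> k z) s D"
    and D': "acts_on_edges d j k (b_iter d K \<alpha> j z) (f_iter d K \<alpha> k z) (1 - s) D'"
  shows "subspace_schur (l2idx d K) (imult (cmv_factor d \<alpha> (blocks K) s) (cmv_factor d \<alpha> (blocks K) (1 - s)))
     (j * int d) ((nat (k - j) + 1) * d) z = D' * mat_adjoint (trunc d \<alpha> j k s) * D"
proof -
  define n where "n = (nat (k - j) + 1) * d"
  define lo where "lo = j * int d"
  define I where "I = blocks K"
  define J where "J = {j..k}"
  define T where "T = (\<lambda>t. Theta (\<alpha> t))"
  define Td where "Td = (\<lambda>t. mat_adjoint (T t))"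
  define b where "b = b_iter d K \<alpha> j z"
  define f where "f = f_iter d K \<alpha> k z"
  define A where "A = mat_adjoint (trunc d \<alpha> j k s)"
  define E where "E = edge_mat d j k b f"
  note D = D[folded b_def f_def] and D' = D'[folded b_def f_def]
  have z1: "cmod z < 1" "z \<noteq> 0" using z by auto
  have JI: "p \<in> I" if "p \<in> J" for p using that blocks_convex[OF j k] by (auto simp: I_def J_def)
  have alI: "\<alpha> t \<in> carrier_mat d d" "opnorm (\<alpha> t) < 1" if "t \<in> I" "t + 1 \<in> I" for t
    using al that by (auto simp: alpha_idx_iff I_def)
  have Tc: "T t \<in> carrier_mat (d + d) (d + d)" "mat_adjoint (T t) * T t = 1\<^sub>m (d + d)" "T t * Td t = 1\<^sub>m (d + d)"
    if "t \<in> I" "t + 1 \<in> I" for t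
    using Theta_carrier[OF alI[OF that]] Theta_unitary[OF alI[OF that]] by (auto simp: T_def Td_def)
  have Dc: "D \<in> carrier_mat n n" "D' \<in> carrier_mat n n" using D D' by (auto simp: acts_on_edges_def n_def)
  have Ac: "A \<in> carrier_mat n n" by (simp add: A_def trunc_def n_def)
  define F where "F = (\<lambda>s. pair_op d T I s)"
  have FU: "imult (cmv_factor d \<alpha> (blocks K) s) (cmv_factor d \<alpha> (blocks K) (1 - s)) = imult (F s) (F (1 - s))"
    by (simp add: F_def T_def I_def cmv_factor_pair_op)
  have XI: "l2idx d K = {x. x div int d \<in> I}" by (simp add: l2idx_def I_def)
  obtain Gf where Gf: "Gf 0 = f" "\<And>m. k + int m \<in> I \<Longrightarrow> norm_bd d 1 (Gf m)"
    "\<And>m. k + int m \<in> I \<Longrightarrow> k + int m + 1 \<in> I \<Longrightarrow> schur_link d (\<alpha> (k + int m)) z (Gf m) (Gf (Suc m))"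
    "\<And>m. k + int m \<in> I \<Longrightarrow> k + int m + 1 \<notin> I \<Longrightarrow> Gf m = 1\<^sub>m d"
    using f_iter_chain[OF al k z] unfolding I_def f_def by blast
  obtain Gb where Gb: "Gb 0 = b" "\<And>m. j - int m \<in> I \<Longrightarrow> norm_bd d 1 (Gb m)"
    "\<And>m. j - int m \<in> I \<Longrightarrow> j - int m - 1 \<in> I \<Longrightarrow> schur_link d (- mat_adjoint (\<alpha> (j - 1 - int m))) z (Gb m) (Gb (Suc m))"
    "\<And>m. j - int m \<in> I \<Longrightarrow> j - int m - 1 \<notin> I \<Longrightarrow> Gb m = 1\<^sub>m d"
    using b_iter_chain[OF al j z] unfolding I_def b_def by blast
  have bf: "b \<in> carrier_mat d d" "f \<in> carrier_mat d d"
    using Gb(2)[of 0] Gf(2)[of 0] j k by (auto simp: Gb(1) Gf(1) I_def norm_bd_def)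
  have Ec: "E s p \<in> carrier_mat d d" for s p using bf by (simp add: E_def edge_mat_def)
  show ?thesis
    unfolding FU XI n_def[symmetric] lo_def[symmetric] A_def[symmetric]
  proof (rule subspace_schur_eqI)
    show "row_finite (imult (F s) (F (1 - s)))" unfolding F_def by (intro row_finite_imult row_finite_pair_op d)
    show "z \<noteq> 0" by (rule z1)
    show "D' * A * D \<in> carrier_mat n n" using Dc Ac by auto
    show "y = (\<lambda>_. 0)" if "l2 {x. x div int d \<in> I} y" "\<And>i. imv (imult (F s) (F (1 - s))) y i = z * y i" for y
      by (rule pair_op_eigen_unique[OF d _ z1(1) that(1), of T s "1 - s"]) (use Tc that(2) in \<open>auto simp: F_def\<close>)
  next
    fix x :: "complex vec" assume x: "x \<in> carrier_vec n"
    define vx where "vx = vext lo n x"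
    \<comment> \<open>The window part of the solution: undo the factor of type s on D x, then that
      of type 1 - s. The resulting \<open>y'\<close> still lacks the edge correction, which
      \<open>Y\<close> includes.\<close>
    define v' where "v' = imv (pair_op d Td J s) (vext lo n (D *\<^sub>v x))"
    define y' where "y' = imv (pair_op d Td J (1 - s)) v'"
    define X where "X = blk d vx"
    define V where "V = blk d v'"
    define Y where "Y = (\<lambda>p. E (1 - s) p *\<^sub>v blk d y' p)"
    have Dx: "D *\<^sub>v x \<in> carrier_vec n" using Dc x by (auto intro: mult_mat_vec_carrier)
    have ADx: "A *\<^sub>v (D *\<^sub>v x) \<in> carrier_vec n" using Ac Dx by (auto intro: mult_mat_vec_carrier)
    have TJ: "T t \<in> carrier_mat (d + d) (d + d) \<and> Td t \<in> carrier_mat (d + d) (d + d) \<and> T t * Td t = 1\<^sub>m (d + d)"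
      if "t \<in> J" "t + 1 \<in> J" for t
      using Tc[of t] JI that by (auto simp: Td_def)
    have A_eq: "A *\<^sub>v (D *\<^sub>v x) = Matrix.vec n (\<lambda>r. y' (lo + int r))"
    proof -
      have "Theta (\<alpha> t) \<in> carrier_mat (d + d) (d + d)" if "t \<in> {j..k}" "t + 1 \<in> {j..k}" for t
        using TJ[of t] that by (simp add: J_def T_def)
      from trunc_adjoint_vec[OF d this n_def Dx, where s = s]
      show ?thesis by (simp add: A_def y'_def v'_def Td_def T_def J_def lo_def)
    qed
    have blkA: "blk d (vext lo n (A *\<^sub>v (D *\<^sub>v x))) p = blk d y' p" if p: "p \<in> J" for p
    proof -
      have p': "j \<le> p" "p \<le> k" using p by (auto simp: J_def)
      have "(A *\<^sub>v (D *\<^sub>v x)) $ (nat (p - j) * d + i) = y' (p * int d + int i)" if "i < d" for i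
      proof -
        have "nat (p - j) * d + i < n" unfolding n_def using p' that by (intro block_index) auto
        moreover have "lo + int (nat (p - j) * d + i) = p * int d + int i"
          using p' by (simp add: lo_def algebra_simps)
        ultimately show ?thesis unfolding A_eq by (simp del: of_nat_add of_nat_mult)
      qed
      then show ?thesis unfolding lo_def n_def blk_vext[OF p'] unfolding blk_def by (intro eq_vecI) auto
    qed
    define \<Phi> where "\<Phi> = D' * A * D"
    have \<Phi>x: "\<Phi> *\<^sub>v x = D' *\<^sub>v (A *\<^sub>v (D *\<^sub>v x))"
      unfolding \<Phi>_def using Dc Ac x by (simp add: assoc_mult_mat_vec[of _ n n _ n])
    have \<Phi>c: "\<Phi> *\<^sub>v x \<in> carrier_vec n" unfolding \<Phi>x using Dc ADx by (auto intro: mult_mat_vec_carrier)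
    have blk\<Phi>: "blk d (vext lo n (\<Phi> *\<^sub>v x)) p = Y p" if p: "p \<in> J" for p
    proof -
      have p': "j \<le> p" "p \<le> k" using p by (auto simp: J_def)
      have "blk d (vext lo n (\<Phi> *\<^sub>v x)) p = E (1 - s) p *\<^sub>v blk d (vext lo n (A *\<^sub>v (D *\<^sub>v x))) p"
        using acts_on_edges_blk[OF D' _ p'] ADx unfolding \<Phi>x by (simp add: n_def lo_def E_def)
      then show ?thesis by (simp add: blkA[OF p] Y_def)
    qed
    \<comment> \<open>By unitarity the adjoint factor becomes a forward equation for the truncated
      factor, with D visible only at the cut edges.\<close>
    have FRV: "factor_rel T J s V (\<lambda>p. E s p *\<^sub>v X p)"
    proof -
      have "factor_rel Td J s (blk d (vext lo n (D *\<^sub>v x))) V"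
        unfolding V_def v'_def by (rule factor_rel_imv[OF d]) (use TJ in auto)
      then have fr: "factor_rel T J s V (blk d (vext lo n (D *\<^sub>v x)))" by (rule factor_rel_inverse) (use TJ in auto)
      have eq: "blk d (vext lo n (D *\<^sub>v x)) p = E s p *\<^sub>v X p" if "p \<in> J" for p
        using acts_on_edges_blk[OF D _, of x p] x that by (simp add: n_def lo_def E_def X_def vx_def J_def)
      show ?thesis by (rule factor_rel_cong[OF fr]) (simp_all add: eq)
    qed
    have FRY: "factor_rel T J (1 - s) (blk d y') V"
    proof -
      have "factor_rel Td J (1 - s) V (blk d y')"
        unfolding V_def y'_def by (rule factor_rel_imv[OF d]) (use TJ in auto)
      then show ?thesis by (rule factor_rel_inverse) (use TJ in \<open>auto simp: V_def\<close>)
    qed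
    have car: "X p \<in> carrier_vec d" "V p \<in> carrier_vec d" "Y p \<in> carrier_vec d" for p
      using mult_mat_vec_carrier[OF Ec blk_carrier] by (auto simp: X_def V_def Y_def)
    \<comment> \<open>Away from the cut edges the correction is trivial, so pairs inside the window
      satisfy the equations of the full factor.\<close>
    have E1: "E \<sigma> p *\<^sub>v u = u" if "\<not> (p = j \<and> even (j - 1 + \<sigma>))" "\<not> (p = k \<and> even (k + \<sigma>))" "u \<in> carrier_vec d" for \<sigma> p u
      using that by (auto simp: E_def edge_mat_def)
    have midV: "T p *\<^sub>v (V p @\<^sub>v V (p + 1)) = X p @\<^sub>v X (p + 1)" if "j \<le> p" "p < k" "even (p + s)" for p
    proof -
      have "T p *\<^sub>v (V p @\<^sub>v V (p + 1)) = (E s p *\<^sub>v X p) @\<^sub>v (E s (p + 1) *\<^sub>v X (p + 1))"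
        using FRV that by (auto simp: factor_rel_def J_def)
      moreover have "E s p *\<^sub>v X p = X p" by (rule E1) (use that car in \<open>auto simp: \<open>even (p + s)\<close>\<close>)
      moreover have "E s (p + 1) *\<^sub>v X (p + 1) = X (p + 1)" by (rule E1) (use that car in \<open>auto\<close>)
      ultimately show ?thesis by simp
    qed
    have midY: "T p *\<^sub>v (Y p @\<^sub>v Y (p + 1)) = V p @\<^sub>v V (p + 1)" if "j \<le> p" "p < k" "even (p + (1 - s))" for p
    proof -
      have "T p *\<^sub>v (blk d y' p @\<^sub>v blk d y' (p + 1)) = V p @\<^sub>v V (p + 1)"
        using FRY that by (auto simp: factor_rel_def J_def)
      moreover have "Y p = blk d y' p" unfolding Y_def by (rule E1) (use that in \<open>auto\<close>)
      moreover have "Y (p + 1) = blk d y' (p + 1)" unfolding Y_def by (rule E1) (use that in \<open>auto\<close>)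
      ultimately show ?thesis by simp
    qed
    \<comment> \<open>In the truncated factor the cut block k is unpaired, so \<open>V k\<close>
      equals the corrected block: the same relation that the right half-line has between its U and V
      at distance 0.\<close>
    have Vk: "V k = f *\<^sub>v X k" if "even (k + s)"
    proof -
      have "E s k *\<^sub>v X k = V k" using FRV that jk by (auto simp: factor_rel_def J_def)
      moreover have "E s k = f" using that unfolding E_def edge_mat_def by (auto; presburger)
      ultimately show ?thesis by simp
    qed
    have Vj: "V j = b *\<^sub>v X j" if "even (j - 1 + s)"
    proof -
      have "odd (j + s)" using that by presburger
      then have "E s j *\<^sub>v X j = V j" using FRV jk by (auto simp: factor_rel_def J_def)
      moreover have "E s j = b" using that by (simp add: E_def edge_mat_def)
      ultimately show ?thesis by simp
    qed
    \<comment> \<open>If the other factor is cut at k, the relation holds one stage later, between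
      \<open>V k\<close> and \<open>Y k\<close>.\<close>
    have Yk: "Y k = f *\<^sub>v V k" if "even (k + (1 - s))"
    proof -
      have "V k = blk d y' k" using FRY that jk by (auto simp: factor_rel_def J_def)
      moreover have "E (1 - s) k = f" using that unfolding E_def edge_mat_def by (auto; presburger)
      ultimately show ?thesis by (simp add: Y_def)
    qed
    have Yj: "Y j = b *\<^sub>v V j" if "even (j - 1 + (1 - s))"
    proof -
      have "odd (j + (1 - s))" using that by presburger
      then have "V j = blk d y' j" using FRY jk by (auto simp: factor_rel_def J_def)
      moreover have "E (1 - s) j = b" using that by (simp add: E_def edge_mat_def)
      ultimately show ?thesis by (simp add: Y_def)
    qed
    have conv: "\<And>a b p. a \<in> I \<Longrightarrow> b \<in> I \<Longrightarrow> a \<le> p \<Longrightarrow> p \<le> b \<Longrightarrow> p \<in> I"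
      unfolding I_def by (rule blocks_convex)
    have jI: "j \<in> I" "k \<in> I" using j k by (auto simp: I_def)
    have Ssuc: "k + int (Suc m) = k + int m + 1" "j - int (Suc m) = j - int m - 1" "j - int m - 1 = j - 1 - int m" for m by auto
    \<comment> \<open>The window block that drives the right half-line: a block of u if the factor
      of type s is cut at k, a block of v otherwise.\<close>
    define rk where "rk = (if even (k + s) then X k else V k)"
    define rj where "rj = (if even (j - 1 + s) then X j else V j)"
    have rc: "rk \<in> carrier_vec d" "rj \<in> carrier_vec d" using car by (auto simp: rk_def rj_def)
    have "\<exists>Y V U C. half_line_sol d (\<lambda>m. k + int m \<in> I) (\<lambda>m. \<alpha> (k + int m)) z (Gf 0) (even (k + s)) rk Y V U C"
    proof (rule half_line)
      show dn: "k + int m \<in> I" if "k + int (Suc m) \<in> I" for m using conv[OF jI(2) that, of "k + int m"] by simp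
      show "\<alpha> (k + int m) \<in> carrier_mat d d \<and> opnorm (\<alpha> (k + int m)) < 1" if "k + int (Suc m) \<in> I" for m
        using alI[OF dn[OF that]] that unfolding Ssuc(1) by blast
      show "schur_link d (\<alpha> (k + int m)) z (Gf m) (Gf (Suc m))" if "k + int (Suc m) \<in> I" for m
        using Gf(3)[OF dn[OF that]] that unfolding Ssuc(1) by blast
      show "Gf m = 1\<^sub>m d" if "k + int m \<in> I" "k + int (Suc m) \<notin> I" for m
        using Gf(4)[OF that(1)] that(2) unfolding Ssuc(1) by blast
      show "norm_bd d 1 (Gf m)" if "k + int m \<in> I" for m by (rule Gf(2)[OF that])
    qed (rule z1 rc)+
    then obtain Yr Vr Ur Cr where "half_line_sol d (\<lambda>m. k + int m \<in> I) (\<lambda>m. \<alpha> (k + int m)) z (Gf 0) (even (k + s)) rk Yr Vr Ur Cr"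
      by blast
    note right = half_line_solD[OF this]
    \<comment> \<open>The left half-line, read in reversed order of blocks, has the parameters of
      \<open>b_iter\<close>.\<close>
    have "\<exists>Y V U C. half_line_sol d (\<lambda>m. j - int m \<in> I) (\<lambda>m. - mat_adjoint (\<alpha> (j - 1 - int m))) z (Gb 0) (even (j - 1 + s)) rj Y V U C"
    proof (rule half_line)
      show dn: "j - int m \<in> I" if "j - int (Suc m) \<in> I" for m using conv[OF that jI(1), of "j - int m"] by simp
      show "- mat_adjoint (\<alpha> (j - 1 - int m)) \<in> carrier_mat d d \<and> opnorm (- mat_adjoint (\<alpha> (j - 1 - int m))) < 1" if "j - int (Suc m) \<in> I" for m
      proof -
        have "j - 1 - int m \<in> I" using that unfolding Ssuc .
        moreover have "j - 1 - int m + 1 = j - int m" by simp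
        ultimately have "\<alpha> (j - 1 - int m) \<in> carrier_mat d d" "opnorm (\<alpha> (j - 1 - int m)) < 1"
          using alI[of "j - 1 - int m"] dn[OF that] by auto
        then show ?thesis using opnorm_adjoint_less by auto
      qed
      show "schur_link d (- mat_adjoint (\<alpha> (j - 1 - int m))) z (Gb m) (Gb (Suc m))" if "j - int (Suc m) \<in> I" for m
        using Gb(3)[OF dn[OF that]] that unfolding Ssuc(2) by blast
      show "Gb m = 1\<^sub>m d" if "j - int m \<in> I" "j - int (Suc m) \<notin> I" for m
        using Gb(4)[OF that(1)] that(2) unfolding Ssuc(2) by blast
      show "norm_bd d 1 (Gb m)" if "j - int m \<in> I" for m by (rule Gb(2)[OF that])
    qed (rule z1 rc)+
    then obtain Yl Vl Ul Cl where "half_line_sol d (\<lambda>m. j - int m \<in> I) (\<lambda>m. - mat_adjoint (\<alpha> (j - 1 - int m))) z (Gb 0) (even (j - 1 + s)) rj Yl Vl Ul Cl"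
      by blast
    note left = half_line_solD[OF this]
    define ub where "ub = glue j k Ul X Ur"
    define vb where "vb = glue j k Vl V Vr"
    define yb where "yb = glue j k Yl Y Yr"
    \<comment> \<open>Back from the reversed order of the left half-line to the order of the
      lattice.\<close>
    have flip: "T (j - 1 - int m) *\<^sub>v (v1 @\<^sub>v v0) = u1 @\<^sub>v u0"
      if "j - 1 - int m \<in> I" "Theta (- mat_adjoint (\<alpha> (j - 1 - int m))) *\<^sub>v (v0 @\<^sub>v v1) = u0 @\<^sub>v u1"
        "v0 \<in> carrier_vec d" "v1 \<in> carrier_vec d" "u0 \<in> carrier_vec d" "u1 \<in> carrier_vec d" for m v0 v1 u0 u1
    proof -
      have "j - int m \<in> I" using conv[OF that(1) jI(1), of "j - int m"] by simp
      moreover have "j - 1 - int m + 1 = j - int m" by simp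
      ultimately have "\<alpha> (j - 1 - int m) \<in> carrier_mat d d" "opnorm (\<alpha> (j - 1 - int m)) < 1"
        using alI[of "j - 1 - int m"] that(1) by auto
      from Theta_flip[OF this that(3-6) that(2)] show ?thesis by (simp add: T_def)
    qed
    have lm: "j - int m \<in> I" if "j - 1 - int m \<in> I" for m using conv[OF that jI(1), of "j - int m"] by simp
    have pr: "even (k + int m + s) \<longleftrightarrow> (even m \<longleftrightarrow> even (k + s))" "even (k + int m + (1 - s)) \<longleftrightarrow> (even m \<longleftrightarrow> \<not> even (k + s))"
      and pl: "even (j - 1 - int m + s) \<longleftrightarrow> (even m \<longleftrightarrow> even (j - 1 + s))" "even (j - 1 - int m + (1 - s)) \<longleftrightarrow> (even m \<longleftrightarrow> \<not> even (j - 1 + s))" for m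
      by auto
    have FR1: "factor_rel T I s vb ub"
      unfolding vb_def ub_def
    proof (rule factor_rel_glue[OF jI jk conv])
      show "T (k + int m) *\<^sub>v (Vr m @\<^sub>v Vr (Suc m)) = Ur m @\<^sub>v Ur (Suc m)" if "even (k + int m + s)" "k + int m + 1 \<in> I" for m
        using right(5)[of m] that unfolding T_def Ssuc(1) pr by blast
      show "Ur m = Vr m" if "even (k + int m + s)" "k + int m \<in> I" "k + int m + 1 \<notin> I" for m
        using right(7)[of m] that unfolding Ssuc(1) pr by blast
      show "T (j - 1 - int m) *\<^sub>v (Vl (Suc m) @\<^sub>v Vl m) = Ul (Suc m) @\<^sub>v Ul m" if "even (j - 1 - int m + s)" "j - 1 - int m \<in> I" for m
      proof (rule flip[OF that(2)])
        have S: "j - int (Suc m) \<in> I" using that(2) unfolding Ssuc .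
        show "Theta (- mat_adjoint (\<alpha> (j - 1 - int m))) *\<^sub>v (Vl m @\<^sub>v Vl (Suc m)) = Ul m @\<^sub>v Ul (Suc m)"
          using left(5)[OF _ S] that(1) unfolding pl by blast
        show "Vl m \<in> carrier_vec d" "Vl (Suc m) \<in> carrier_vec d" "Ul m \<in> carrier_vec d" "Ul (Suc m) \<in> carrier_vec d"
          using left(3)[OF S] left(3)[OF lm[OF that(2)]] by auto
      qed
      show "Ul m = Vl m" if "even (j - 1 - int m + s)" "j - int m \<in> I" "j - 1 - int m \<notin> I" for m
        using left(7)[of m] that unfolding Ssuc(2,3) pl by blast
      show "T p *\<^sub>v (V p @\<^sub>v V (p + 1)) = X p @\<^sub>v X (p + 1)" if "j \<le> p" "p < k" "even (p + s)" for p
        by (rule midV[OF that])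
      show "Vr 0 = V k \<and> Ur 0 = X k" if "even (k + s)" using right(1)[OF that] Vk[OF that] that by (simp add: Gf(1) rk_def)
      show "Vl 0 = V j \<and> Ul 0 = X j" if "even (j - 1 + s)" using left(1)[OF that] Vj[OF that] that by (simp add: Gb(1) rj_def)
    qed
    have FR2: "factor_rel T I (1 - s) yb vb"
      unfolding vb_def yb_def
    proof (rule factor_rel_glue[OF jI jk conv])
      show "T (k + int m) *\<^sub>v (Yr m @\<^sub>v Yr (Suc m)) = Vr m @\<^sub>v Vr (Suc m)" if "even (k + int m + (1 - s))" "k + int m + 1 \<in> I" for m
        using right(6)[of m] that unfolding T_def Ssuc(1) pr by blast
      show "Vr m = Yr m" if "even (k + int m + (1 - s))" "k + int m \<in> I" "k + int m + 1 \<notin> I" for m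
        using right(8)[of m] that unfolding Ssuc(1) pr by blast
      show "T (j - 1 - int m) *\<^sub>v (Yl (Suc m) @\<^sub>v Yl m) = Vl (Suc m) @\<^sub>v Vl m" if "even (j - 1 - int m + (1 - s))" "j - 1 - int m \<in> I" for m
      proof (rule flip[OF that(2)])
        have S: "j - int (Suc m) \<in> I" using that(2) unfolding Ssuc .
        show "Theta (- mat_adjoint (\<alpha> (j - 1 - int m))) *\<^sub>v (Yl m @\<^sub>v Yl (Suc m)) = Vl m @\<^sub>v Vl (Suc m)"
          using left(6)[OF _ S] that(1) unfolding pl by blast
        show "Vl m \<in> carrier_vec d" "Vl (Suc m) \<in> carrier_vec d" "Yl m \<in> carrier_vec d" "Yl (Suc m) \<in> carrier_vec d"
          using left(3)[OF S] left(3)[OF lm[OF that(2)]] by auto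
      qed
      show "Vl m = Yl m" if "even (j - 1 - int m + (1 - s))" "j - int m \<in> I" "j - 1 - int m \<notin> I" for m
        using left(8)[of m] that unfolding Ssuc(2,3) pl by blast
      show "T p *\<^sub>v (Y p @\<^sub>v Y (p + 1)) = V p @\<^sub>v V (p + 1)" if "j \<le> p" "p < k" "even (p + (1 - s))" for p
        by (rule midY[OF that])
      show "Yr 0 = Y k \<and> Vr 0 = V k" if "even (k + (1 - s))"
      proof -
        have "odd (k + s)" using that by presburger
        then show ?thesis using right(2) Yk[OF that] by (simp add: Gf(1) rk_def)
      qed
      show "Yl 0 = Y j \<and> Vl 0 = V j" if "even (j - 1 + (1 - s))"
      proof -
        have "odd (j - 1 + s)" using that by presburger
        then show ?thesis using left(2) Yj[OF that] by (simp add: Gb(1) rj_def)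
      qed
    qed
    have gcar: "yb p \<in> carrier_vec d" "vb p \<in> carrier_vec d" "ub p \<in> carrier_vec d" if p: "p \<in> I" for p
      using right(3)[of "nat (p - k)"] left(3)[of "nat (j - p)"] car[of p] p
      by (auto simp: yb_def vb_def ub_def glue_def)
    \<comment> \<open>On the half-lines u = z y holds by construction, so (U - z) y is supported in
      the window.\<close>
    have outer: "ub p = z \<cdot>\<^sub>v yb p" if p: "p \<in> I" "p \<notin> J" for p
    proof -
      consider "k < p" | "p < j" "\<not> k < p" using p(2) jk by (auto simp: J_def)
      then show ?thesis
      proof cases
        case 1
        define m where "m = nat (p - k) - 1"
        have "k + int (Suc m) = p" "nat (p - k) = Suc m" using 1 by (auto simp: m_def)
        then show ?thesis using right(4)[of m] p(1) 1 by (simp add: ub_def yb_def glue_def)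
      next
        case 2
        define m where "m = nat (j - p) - 1"
        have "j - int (Suc m) = p" "nat (j - p) = Suc m" using 2 by (auto simp: m_def)
        then show ?thesis using left(4)[of m] p(1) 2 by (simp add: ub_def yb_def glue_def)
      qed
    qed
    have inner: "ub p = X p" "yb p = Y p" if "p \<in> J" for p
      using that by (auto simp: ub_def yb_def glue_def J_def)
    define y where "y = of_blks d I yb"
    have Uy: "imv (imult (F s) (F (1 - s))) y = of_blks d I ub"
    proof -
      have "imv (F (1 - s)) y = of_blks d I vb"
        unfolding F_def y_def by (rule imv_of_blks[OF d Tc(1)]) (use gcar FR2 in auto)
      moreover have "imv (F s) (of_blks d I vb) = of_blks d I ub"
        unfolding F_def by (rule imv_of_blks[OF d Tc(1)]) (use gcar FR1 in auto)
      ultimately show ?thesis by (simp add: imv_imult F_def row_finite_pair_op d)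
    qed
    have l2y: "l2 {x. x div int d \<in> I} y"
      unfolding y_def
    proof (rule l2_of_blks[OF d])
      fix P assume P: "finite P" "P \<subseteq> I"
      show "(\<Sum>p\<in>P. nsq (yb p)) \<le> Cr + Cl + (\<Sum>p\<in>{j..k}. nsq (Y p))"
        unfolding yb_def
      proof (rule sum_glue_le[OF nsq_nonneg P(1)])
        show "(\<Sum>m\<in>M. nsq (Yr m)) \<le> Cr" if "finite M" "\<And>m. m \<in> M \<Longrightarrow> k + int m \<in> P \<and> m \<ge> 1" for M
          by (rule sum_le_initial_segments[where P = "\<lambda>m. k + int m \<in> I"]) (use right(9) jI that P(2) in auto)
        show "(\<Sum>m\<in>M. nsq (Yl m)) \<le> Cl" if "finite M" "\<And>m. m \<in> M \<Longrightarrow> j - int m \<in> P \<and> m \<ge> 1" for M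
          by (rule sum_le_initial_segments[where P = "\<lambda>m. j - int m \<in> I"]) (use left(9) jI that P(2) in auto)
      qed
    qed (use gcar in auto)
    have sup: "lo \<le> i \<and> i < lo + int n \<longleftrightarrow> i div int d \<in> J" for i
      unfolding lo_def n_def vext_support[OF d jk] by (simp add: J_def)
    have yJ: "y i = vext lo n (\<Phi> *\<^sub>v x) i" if "i div int d \<in> J" for i
      using that JI[OF that] blk_at[OF d, of "vext lo n (\<Phi> *\<^sub>v x)" i] by (simp add: y_def of_blks_def inner blk\<Phi>)
    have uJ: "of_blks d I ub i = vext lo n x i" if "i div int d \<in> J" for i
      using that JI[OF that] blk_at[OF d, of "vext lo n x" i] by (simp add: of_blks_def inner X_def vx_def)
    have eqn: "imv (imult (F s) (F (1 - s))) y i - z * y i = vext lo n (x - z \<cdot>\<^sub>v (\<Phi> *\<^sub>v x)) i" for i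
    proof -
      consider "i div int d \<in> J" | "i div int d \<notin> J" "i div int d \<in> I" | "i div int d \<notin> I" "i div int d \<notin> J"
        using JI by blast
      then show ?thesis
      proof cases
        case 1
        then have r: "lo \<le> i \<and> i < lo + int n" by (simp add: sup)
        then have "nat (i - lo) < n" by auto
        then have "(x - z \<cdot>\<^sub>v u) $ nat (i - lo) = x $ nat (i - lo) - z * u $ nat (i - lo)" if "u \<in> carrier_vec n" for u
          using that x by simp
        from this[OF \<Phi>c] show ?thesis using r unfolding Uy uJ[OF 1] yJ[OF 1] by (simp add: vext_def del: index_mult_mat_vec)
      next
        case 2
        have m: "nat (i mod int d) < d" using d by (simp add: nat_less_iff)
        have "of_blks d I ub i = z * y i"
          using 2 outer[of "i div int d"] gcar(1)[of "i div int d"] m by (simp add: y_def of_blks_def)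
        moreover have "vext lo n (x - z \<cdot>\<^sub>v (\<Phi> *\<^sub>v x)) i = 0" using 2(1) sup[of i] by (auto simp: vext_def)
        ultimately show ?thesis unfolding Uy by simp
      next
        case 3
        have "vext lo n (x - z \<cdot>\<^sub>v (\<Phi> *\<^sub>v x)) i = 0" using 3(2) sup[of i] by (auto simp: vext_def)
        then show ?thesis using 3(1) unfolding Uy by (simp add: y_def of_blks_def)
      qed
    qed
    have yr: "y (lo + int r) = (\<Phi> *\<^sub>v x) $ r" if "r < n" for r
    proof -
      have "(lo + int r) div int d \<in> J" using sup[of "lo + int r"] that by simp
      then show ?thesis using that by (simp add: yJ vext_def del: index_mult_mat_vec)
    qed
    show "\<exists>y. l2 {x. x div int d \<in> I} y \<and>
      (\<forall>i. imv (imult (F s) (F (1 - s))) y i - z * y i = vext lo n (x - z \<cdot>\<^sub>v (D' * A * D *\<^sub>v x)) i) \<and>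
      (\<forall>r<n. y (lo + int r) = (D' * A * D *\<^sub>v x) $ r)"
      unfolding \<Phi>_def[symmetric] using l2y eqn yr by blast
  qed
qed


text \<open>A single block has no partner, so both truncated factors are the identity.\<close>

lemma trunc_adjoint_single:
  assumes d: "d > 0"
  shows "mat_adjoint (trunc d \<alpha> j j s) = 1\<^sub>m d"
proof (rule mat_eq_vecI[of _ d d])
  fix w :: "complex vec" assume w: "w \<in> carrier_vec d"
  have 1: "imv (pair_op d T {j} s) v x = v x" if "x div int d = j" for T s v x
    by (rule imv_pair_op_single) (use that in auto)
  have x: "(j * int d + int r) div int d = j" if "r < d" for r using pair_div[of r d j] that by simp
  have v: "vext (j * int d) d w (j * int d + int r) = w $ r" if "r < d" for r using that by (simp add: vext_def)
  have "mat_adjoint (trunc d \<alpha> j j s) *\<^sub>v w = Matrix.vec d (\<lambda>r. imv (pair_op d (\<lambda>t. mat_adjoint (Theta (\<alpha> t))) {j} (1 - s))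
       (imv (pair_op d (\<lambda>t. mat_adjoint (Theta (\<alpha> t))) {j} s) (vext (j * int d) d w)) (j * int d + int r))"
    using trunc_adjoint_vec[OF d, of j j \<alpha> d w s] w by simp
  also have "\<dots> = w" using w by (intro eq_vecI) (auto simp: 1 x v)
  finally show "mat_adjoint (trunc d \<alpha> j j s) *\<^sub>v w = 1\<^sub>m d *\<^sub>v w" using w by simp
qed (simp_all add: trunc_def)

lemma bdiag_empty:
  assumes "A \<in> carrier_mat n n"
  shows "bdiag A (1\<^sub>m 0) = A" "bdiag (1\<^sub>m 0) A = A"
  by (rule eq_matI; use assms in \<open>auto simp: bdiag_def\<close>)+

text \<open>The points z range over the punctured disc because \<open>subspace_schur\<close> carries
  the factor 1 / z.\<close>

theorem theorem4p5:
  fixes d :: nat and K :: cmv_kind and \<alpha> :: "int \<Rightarrow> complex mat"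
  assumes "d > 0"
    and "\<forall>i\<in>alpha_idx K. \<alpha> i \<in> carrier_mat d d \<and> opnorm (\<alpha> i) < 1"
  shows
   "(\<forall>j\<in>blocks K. \<forall>z\<in>ball 0 1 - {0}.
       subspace_schur (l2idx d K) (cmvC d K \<alpha>) (j * int d) d z =
         (if even j then b_iter d K \<alpha> j z * f_iter d K \<alpha> j z
                    else f_iter d K \<alpha> j z * b_iter d K \<alpha> j z)
     \<and> subspace_schur (l2idx d K) (cmvCh d K \<alpha>) (j * int d) d z =
         (if even j then f_iter d K \<alpha> j z * b_iter d K \<alpha> j z
                    else b_iter d K \<alpha> j z * f_iter d K \<alpha> j z))
  \<and> (\<forall>j\<in>blocks K. \<forall>k\<in>blocks K. j \<le> k \<longrightarrow> (\<forall>z\<in>ball 0 1 - {0}.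
      let bj = b_iter d K \<alpha> j z; fk = f_iter d K \<alpha> k z;
          I1 = 1\<^sub>m (nat (k - j) * d); I2 = 1\<^sub>m ((nat (k - j) - 1) * d);
          A = mat_adjoint (truncC d \<alpha> j k); Ah = mat_adjoint (truncCh d \<alpha> j k)
      in subspace_schur (l2idx d K) (cmvC d K \<alpha>) (j * int d) ((nat (k - j) + 1) * d) z =
           (if even j \<and> even k then bdiag bj I1 * A * bdiag I1 fk
            else if odd j \<and> odd k then bdiag I1 fk * A * bdiag bj I1
            else if even j \<and> odd k then bdiag (bdiag bj I2) fk * A
            else A * bdiag (bdiag bj I2) fk)
       \<and> subspace_schur (l2idx d K) (cmvCh d K \<alpha>) (j * int d) ((nat (k - j) + 1) * d) z =
           (if odd j \<and> odd k then bdiag bj I1 * Ah * bdiag I1 fk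
            else if even j \<and> even k then bdiag I1 fk * Ah * bdiag bj I1
            else if odd j \<and> even k then bdiag (bdiag bj I2) fk * Ah
            else Ah * bdiag (bdiag bj I2) fk)))"
proof -
  have bcar: "b_iter d K \<alpha> j z \<in> carrier_mat d d" and fcar: "f_iter d K \<alpha> j z \<in> carrier_mat d d"
    if j: "j \<in> blocks K" and z: "z \<in> ball 0 1 - {0}" for j z
  proof -
    obtain G where "G 0 = b_iter d K \<alpha> j z" "\<And>m. j - int m \<in> blocks K \<Longrightarrow> norm_bd d 1 (G m)"
      using b_iter_chain[OF assms(2) j z] by blast
    from this(1) this(2)[of 0] j show "b_iter d K \<alpha> j z \<in> carrier_mat d d" by (simp add: norm_bd_def)
    obtain G where "G 0 = f_iter d K \<alpha> j z" "\<And>m. j + int m \<in> blocks K \<Longrightarrow> norm_bd d 1 (G m)"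
      using f_iter_chain[OF assms(2) j z] by blast
    from this(1) this(2)[of 0] j show "f_iter d K \<alpha> j z \<in> carrier_mat d d" by (simp add: norm_bd_def)
  qed
  have main: "subspace_schur (l2idx d K) (cmvC d K \<alpha>) (j * int d) ((nat (k - j) + 1) * d) z =
           (if even j \<and> even k then bdiag bj I1 * A * bdiag I1 fk
            else if odd j \<and> odd k then bdiag I1 fk * A * bdiag bj I1
            else if even j \<and> odd k then bdiag (bdiag bj I2) fk * A
            else A * bdiag (bdiag bj I2) fk)"
      (is ?C)
     and mainh: "subspace_schur (l2idx d K) (cmvCh d K \<alpha>) (j * int d) ((nat (k - j) + 1) * d) z =
           (if odd j \<and> odd k then bdiag bj I1 * Ah * bdiag I1 fk
            else if even j \<and> even k then bdiag I1 fk * Ah * bdiag bj I1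
            else if odd j \<and> even k then bdiag (bdiag bj I2) fk * Ah
            else Ah * bdiag (bdiag bj I2) fk)"
      (is ?Ch)
    if j: "j \<in> blocks K" and k: "k \<in> blocks K" and jk: "j \<le> k" and z: "z \<in> ball 0 1 - {0}"
      and bj: "bj = b_iter d K \<alpha> j z" and fk: "fk = f_iter d K \<alpha> k z"
      and I1: "I1 = 1\<^sub>m (nat (k - j) * d)" and I2: "I2 = 1\<^sub>m ((nat (k - j) - 1) * d)"
      and A: "A = mat_adjoint (truncC d \<alpha> j k)" and Ah: "Ah = mat_adjoint (truncCh d \<alpha> j k)"
    for j k z bj fk I1 I2 A Ah
  proof -
    let ?n = "(nat (k - j) + 1) * d"
    let ?act = "acts_on_edges d j k bj fk"
    have bfc: "bj \<in> carrier_mat d d" "fk \<in> carrier_mat d d" using bcar[OF j z] fcar[OF k z] by (simp_all add: bj fk)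
    have Ac: "A \<in> carrier_mat ?n ?n" "Ah \<in> carrier_mat ?n ?n"
      by (simp_all add: A Ah truncC_trunc[OF assms(1) jk] trunc_def)
    \<comment> \<open>C = L M has outer type 0, so the correction for L-cuts stands to the right of
      the adjoint and that for M-cuts to the left; the companion swaps the roles.\<close>
    have S0: "subspace_schur (l2idx d K) (cmvC d K \<alpha>) (j * int d) ?n z = D' * A * D"
      if "?act 0 D" "?act 1 D'" for D D'
      using subspace_schur_cmv[OF assms j k jk z, of 0 D D'] that
      by (simp add: cmvC_def cmvL_def cmvM_def A truncC_trunc[OF assms(1) jk] bj fk)
    have S1: "subspace_schur (l2idx d K) (cmvCh d K \<alpha>) (j * int d) ?n z = D' * Ah * D"
      if "?act 1 D" "?act 0 D'" for D D'
      using subspace_schur_cmv[OF assms j k jk z, of 1 D D'] that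
      by (simp add: cmvCh_def cmvL_def cmvM_def Ah truncC_trunc[OF assms(1) jk] bj fk)
    note acts = acts_on_edges_one[of j _ k d bj fk] acts_on_edges_b[OF jk _ _ bfc(1), of _ fk, folded I1]
      acts_on_edges_f[OF jk _ _ bfc(2), of _ bj, folded I1]
    have actbf: "?act s (bdiag (bdiag bj I2) fk)" if "even (j - 1 + s)" "even (k + s)" for s
    proof -
      have "j \<noteq> k" using that by presburger
      then have "j < k" using jk by simp
      from acts_on_edges_bf[OF this that bfc] show ?thesis by (simp add: I2)
    qed
    show ?C
    proof (cases "even j"; cases "even k")
      assume e: "even j" "even k"
      \<comment> \<open>For even k the pair (k, k + 1) is of type 0; for even j the pair (j - 1, j)
        is of type 1.\<close>
      have "?act 0 (bdiag I1 fk)" "?act 1 (bdiag bj I1)" by (rule acts; use e in simp)+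
      from S0[OF this] show ?thesis using e by simp
    next
      assume e: "even j" "odd k"
      \<comment> \<open>For j even and k odd both cut pairs are of type 1, so type 0 gets the
        identity.\<close>
      have "?act 0 (1\<^sub>m ?n)" by (rule acts; use e in simp)
      moreover have "?act 1 (bdiag (bdiag bj I2) fk)" by (rule actbf; use e in simp)
      moreover from this have "bdiag (bdiag bj I2) fk \<in> carrier_mat ?n ?n" by (simp add: acts_on_edges_def)
      ultimately show ?thesis using e Ac S0[of "1\<^sub>m ?n" "bdiag (bdiag bj I2) fk"] by simp
    next
      assume e: "odd j" "even k"
      have "?act 1 (1\<^sub>m ?n)" by (rule acts; use e in simp)
      moreover have "?act 0 (bdiag (bdiag bj I2) fk)" by (rule actbf; use e in simp)
      ultimately show ?thesis using e Ac S0[of "bdiag (bdiag bj I2) fk" "1\<^sub>m ?n"] by simp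
    next
      assume e: "odd j" "odd k"
      have "?act 0 (bdiag bj I1)" "?act 1 (bdiag I1 fk)" by (rule acts; use e in simp)+
      from S0[OF this] show ?thesis using e by simp
    qed
    show ?Ch
    proof (cases "even j"; cases "even k")
      assume e: "even j" "even k"
      have "?act 1 (bdiag bj I1)" "?act 0 (bdiag I1 fk)" by (rule acts; use e in simp)+
      from S1[OF this] show ?thesis using e by simp
    next
      assume e: "even j" "odd k"
      have "?act 0 (1\<^sub>m ?n)" by (rule acts; use e in simp)
      moreover have "?act 1 (bdiag (bdiag bj I2) fk)" by (rule actbf; use e in simp)
      ultimately show ?thesis using e Ac S1[of "bdiag (bdiag bj I2) fk" "1\<^sub>m ?n"] by simp
    next
      assume e: "odd j" "even k"
      have "?act 1 (1\<^sub>m ?n)" by (rule acts; use e in simp)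
      moreover have "?act 0 (bdiag (bdiag bj I2) fk)" by (rule actbf; use e in simp)
      moreover from this have "bdiag (bdiag bj I2) fk \<in> carrier_mat ?n ?n" by (simp add: acts_on_edges_def)
      ultimately show ?thesis using e Ac S1[of "1\<^sub>m ?n" "bdiag (bdiag bj I2) fk"] by simp
    next
      assume e: "odd j" "odd k"
      have "?act 1 (bdiag I1 fk)" "?act 0 (bdiag bj I1)" by (rule acts; use e in simp)+
      from S1[OF this] show ?thesis using e by simp
    qed
  qed
  \<comment> \<open>The window with j = k: truncation and identity blocks collapse and the product
    of b and f remains.\<close>
  have single: "subspace_schur (l2idx d K) (cmvC d K \<alpha>) (j * int d) d z =
         (if even j then b_iter d K \<alpha> j z * f_iter d K \<alpha> j z
                    else f_iter d K \<alpha> j z * b_iter d K \<alpha> j z)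
     \<and> subspace_schur (l2idx d K) (cmvCh d K \<alpha>) (j * int d) d z =
         (if even j then f_iter d K \<alpha> j z * b_iter d K \<alpha> j z
                    else b_iter d K \<alpha> j z * f_iter d K \<alpha> j z)"
    if j: "j \<in> blocks K" and z: "z \<in> ball 0 1 - {0}" for j z
  proof -
    note m = main[OF j j order_refl z refl refl refl refl refl refl] mainh[OF j j order_refl z refl refl refl refl refl refl]
    have one: "mat_adjoint (truncC d \<alpha> j j) = 1\<^sub>m d" "mat_adjoint (truncCh d \<alpha> j j) = 1\<^sub>m d"
      by (simp_all add: truncC_trunc[OF assms(1) order_refl] trunc_adjoint_single[OF assms(1)])
    show ?thesis using m bcar[OF j z] fcar[OF j z] by (simp add: one bdiag_empty[of _ d])
  qed
  show ?thesis unfolding Let_def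
    apply (intro conjI ballI impI)
    subgoal using single by blast
    subgoal using single by blast
    subgoal by (rule main) (assumption | rule refl)+
    subgoal by (rule mainh) (assumption | rule refl)+
    done
qed

end
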